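(* Let $n\ge 3$. A linear equation in standard form $$y^{(n)}+c_{n-1}(x)\,y^{(n-1)}+c_{n-2}(x)\,y^{(n-2)}+\dots+c_0(x)\,y=0$$ with $c_{n-1}=c_{n-2}=0$ has a maximal symmetry algebra if and only if $c_j=0$ for all $j$. In other words, a linear equation of order $n$ has a maximal symmetry algebra if and only if its Laguerre-Forsyth form is the canonical equation $y^{(n)}=0$.
   Context: All coefficients $c_j=c_j(x)$ are smooth functions on an open interval. The symmetry algebra of an ordinary differential equation is the Lie algebra of its Lie point symmetries, i.e. vector fields $\xi(x,y)\partial_x+\eta(x,y)\partial_y$ satisfying the infinitesimal criterion of invariance for the equation. For a linear ordinary differential equation of order $n\ge 3$ the maximal possible dimension of this algebra is $n+4$; the equation is said to have a maximal symmetry algebra if this dimension is attained. By known results of Lie and of Krause and Michel this is equivalent to the equation being reducible by a (local) invertible point transformation to $y^{(n)}=0$. A Laguerre-Forsyth form of the linear equation is an equation obtained from it by a (local) invertible change of variables of the form $x=f(z)$, $y=g(z)w(z)$, normalized to have leading coefficient $1$, in which the coefficients of the derivatives of orders $n-1$ and $n-2$ both vanish identically; such a change of variables always exists locally. *)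

theory Defs
  imports "HOL-Analysis.Analysis" "HOL-Library.Function_Algebras"
begin

(* Pointwise scaling, so that dim is available for spaces of vector fields. *)
instantiation "fun" :: (type, real_vector) real_vector
begin

definition scaleR_fun :: "real \<Rightarrow> ('a \<Rightarrow> 'b) \<Rightarrow> 'a \<Rightarrow> 'b" where
  "scaleR_fun a f = (\<lambda>x. a *\<^sub>R f x)"

instance
  by standard (simp_all add: scaleR_fun_def fun_eq_iff scaleR_add_right scaleR_add_left)

end

definition open_interval :: "real set \<Rightarrow> bool" where
  "open_interval I \<longleftrightarrow> open I \<and> is_interval I \<and> I \<noteq> {}"

(* C^k and C^infinity on an open subset of a finite-dimensional space. *)
primrec Ck_on :: "nat \<Rightarrow> 'a::real_normed_vector set \<Rightarrow> ('a \<Rightarrow> 'b::real_normed_vector) \<Rightarrow> bool" where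
  "Ck_on 0 S f \<longleftrightarrow> continuous_on S f"
| "Ck_on (Suc k) S f \<longleftrightarrow>
     (\<forall>x\<in>S. f differentiable (at x)) \<and> (\<forall>v. Ck_on k S (\<lambda>x. frechet_derivative f (at x) v))"

definition smooth_on :: "'a::real_normed_vector set \<Rightarrow> ('a \<Rightarrow> 'b::real_normed_vector) \<Rightarrow> bool" where
  "smooth_on S f \<longleftrightarrow> (\<forall>k. Ck_on k S f)"

(* A function on jet space is written F x u, where u k stands for the k-th derivative of y.
   Only finitely many coordinates matter: F of order m depends on x, u 0, ..., u m, and
   the order has to be passed to the operators below. *)
type_synonym jet_fun = "real \<Rightarrow> (nat \<Rightarrow> real) \<Rightarrow> real"

(* A vector field X stands for fst (X (x, y)) d/dx + snd (X (x, y)) d/dy. *)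
type_synonym vfield = "real \<times> real \<Rightarrow> real \<times> real"

definition partial_x :: "jet_fun \<Rightarrow> jet_fun" where
  "partial_x F x u = deriv (\<lambda>t. F t u) x"

definition partial_u :: "nat \<Rightarrow> jet_fun \<Rightarrow> jet_fun" where
  "partial_u i F x u = deriv (\<lambda>t. F x (u(i := t))) (u i)"

definition total_deriv :: "nat \<Rightarrow> jet_fun \<Rightarrow> jet_fun" where
  "total_deriv m F x u = partial_x F x u + (\<Sum>i\<le>m. u (Suc i) * partial_u i F x u)"

definition xi :: "vfield \<Rightarrow> jet_fun" where
  "xi X x u = fst (X (x, u 0))"

(* Prolongation: eta_0 = eta and eta_(k+1) = D_x eta_k - u_(k+1) D_x xi. *)
primrec eta :: "vfield \<Rightarrow> nat \<Rightarrow> jet_fun" where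
  "eta X 0 = (\<lambda>x u. snd (X (x, u 0)))"
| "eta X (Suc k) = (\<lambda>x u. total_deriv k (eta X k) x u - u (Suc k) * total_deriv 0 (xi X) x u)"

definition prolongation :: "nat \<Rightarrow> vfield \<Rightarrow> jet_fun \<Rightarrow> jet_fun" where
  "prolongation n X F x u = xi X x u * partial_x F x u + (\<Sum>j\<le>n. eta X j x u * partial_u j F x u)"

(* The n-th order equation F = 0 is considered for x in I, and its symmetries are vector fields
   on the strip I x R. They are set to 0 outside it, so that distinct functions in this space are
   distinct vector fields on the strip. *)
definition symmetry_algebra :: "nat \<Rightarrow> real set \<Rightarrow> jet_fun \<Rightarrow> vfield set" where
  "symmetry_algebra n I F =
     {X. smooth_on (I \<times> UNIV) X \<and> (\<forall>p. p \<notin> I \<times> UNIV \<longrightarrow> X p = 0) \<and>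
         (\<forall>x\<in>I. \<forall>u. F x u = 0 \<longrightarrow> prolongation n X F x u = 0)}"

(* Left-hand side of the linear equation with coefficients c j, j < n, and leading coefficient 1. *)
definition linear_ode :: "nat \<Rightarrow> (nat \<Rightarrow> real \<Rightarrow> real) \<Rightarrow> jet_fun" where
  "linear_ode n c x u = u n + (\<Sum>j<n. c j x * u j)"

definition linear_op :: "nat \<Rightarrow> (nat \<Rightarrow> real \<Rightarrow> real) \<Rightarrow> (real \<Rightarrow> real) \<Rightarrow> real \<Rightarrow> real" where
  "linear_op n c y x = linear_ode n c x (\<lambda>k. (deriv ^^ k) y x)"

(* dim is 0 on infinite-dimensional spaces, so this includes finite-dimensionality. *)
definition has_maximal_symmetry_algebra :: "nat \<Rightarrow> real set \<Rightarrow> (nat \<Rightarrow> real \<Rightarrow> real) \<Rightarrow> bool" where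
  "has_maximal_symmetry_algebra n I c \<longleftrightarrow> dim (symmetry_algebra n I (linear_ode n c)) = n + 4"

(* The equation d on J arises from the equation c on I by x = f z, y = g z * w z: substituting
   turns the left-hand side for y into that for w up to the factor mu, by which one divides to
   get leading coefficient 1. As J is an interval, deriv f being nowhere 0 makes f
   a diffeomorphism onto the open interval f ` J. *)
definition transforms_to ::
  "nat \<Rightarrow> real set \<Rightarrow> (nat \<Rightarrow> real \<Rightarrow> real) \<Rightarrow> (real \<Rightarrow> real) \<Rightarrow> (real \<Rightarrow> real)
    \<Rightarrow> real set \<Rightarrow> (nat \<Rightarrow> real \<Rightarrow> real) \<Rightarrow> bool" where
  "transforms_to n I c f g J d \<longleftrightarrow>
     open_interval J \<and> (\<forall>j<n. smooth_on J (d j)) \<and>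
     smooth_on J f \<and> (\<forall>z\<in>J. deriv f z \<noteq> 0) \<and> f ` J \<subseteq> I \<and>
     smooth_on J g \<and> (\<forall>z\<in>J. g z \<noteq> 0) \<and>
     (\<exists>\<mu>. (\<forall>z\<in>J. \<mu> z \<noteq> 0) \<and>
        (\<forall>y w. smooth_on (f ` J) y \<longrightarrow> smooth_on J w \<longrightarrow> (\<forall>z\<in>J. y (f z) = g z * w z) \<longrightarrow>
           (\<forall>z\<in>J. linear_op n c y (f z) = \<mu> z * linear_op n d w z)))"

definition laguerre_forsyth_form ::
  "nat \<Rightarrow> real set \<Rightarrow> (nat \<Rightarrow> real \<Rightarrow> real) \<Rightarrow> (real \<Rightarrow> real) \<Rightarrow> (real \<Rightarrow> real)
    \<Rightarrow> real set \<Rightarrow> (nat \<Rightarrow> real \<Rightarrow> real) \<Rightarrow> bool" where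
  "laguerre_forsyth_form n I c f g J d \<longleftrightarrow>
     transforms_to n I c f g J d \<and> (\<forall>z\<in>J. d (n - 1) z = 0 \<and> d (n - 2) z = 0)"

definition canonical_on :: "nat \<Rightarrow> real set \<Rightarrow> (nat \<Rightarrow> real \<Rightarrow> real) \<Rightarrow> bool" where
  "canonical_on n I c \<longleftrightarrow> (\<forall>j<n. \<forall>x\<in>I. c j x = 0)"

end

theory Submission
  imports Defs
begin

text \<open>
  Why the theorem is true. Let \<open>L\<close> be the linear operator of the equation. Along a curve \<open>y\<close> the prolongation of
  \<open>\<xi> d/dx + \<eta> d/dy\<close> differentiates the characteristic \<open>Q = \<eta> - \<xi> y'\<close>, so the field is a symmetry iff
  \<open>L Q = - \<xi> (L y)'\<close> at every point where \<open>L y = 0\<close> (\<open>symmetry_iff_characteristic\<close>). Comparing four curves through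
  one point, whose differences vanish there to orders that add up to \<open>n\<close> or \<open>n + 1\<close>, shows that for \<open>n \<ge> 3\<close> every
  symmetry has \<open>\<xi> = \<xi>(x)\<close> and \<open>\<eta> = a(x) y + b(x)\<close> (\<open>symmetry_affine\<close>). The condition then separates: \<open>b\<close> is a
  solution, and the commutator of \<open>L\<close> with the first order operator \<open>a - \<xi> d/dx\<close> is, modulo left multiples of \<open>L\<close>,
  an operator of order below \<open>n\<close> all of whose coefficients vanish (\<open>commutator_identity\<close>,
  \<open>symmetry_algebra_eq\<close>). The two leading coefficients give \<open>a'\<close> in terms of \<open>\<xi>\<close> and a linear equation of
  order three for \<open>\<xi>\<close>. Hence a symmetry is determined by \<open>n\<close> initial values for \<open>b\<close>, three for \<open>\<xi>\<close> and one for \<open>a\<close>;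
  the dimension is at most \<open>n + 4\<close>, and it equals \<open>n + 4\<close> iff all initial values occur
  (\<open>maximal_iff_all_initial_values\<close>).

  In Laguerre-Forsyth form the equation of order three is \<open>\<xi>''' = 0\<close>. If the symmetry is maximal, then
  translations and dilations are symmetries, which forces constant coefficients and then zero coefficients.
  The pairs \<open>(\<xi>, a)\<close> can be carried along a change of variables, because it conjugates \<open>a - \<xi> d/dx\<close> into an operator of
  the same kind; so this applies to every Laguerre-Forsyth form of the equation (\<open>maximal_imp_canonical\<close>). Conversely,
  pairs for the canonical equation can be carried back, and near every point they realise all initial values. A
  solution on the whole interval of the two leading equations agrees near every point with one of these local pairs
  and is therefore itself a pair, so local canonical forms imply maximal symmetry
  (\<open>locally_canonical_imp_maximal\<close>).

  That Laguerre-Forsyth forms exist near every point (\<open>laguerre_forsyth_form_exists\<close>) closes the circle. Once the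
  coefficient of order \<open>n - 1\<close> has been removed by a factor, choose \<open>q\<close> so that the \<open>(n - 1)\<close>-st symmetric power
  of \<open>v'' + q v = 0\<close> has the right coefficient of order \<open>n - 2\<close>. That symmetric power becomes \<open>w\<^sup>(\<^sup>n\<^sup>) = 0\<close> for the
  quotient of two solutions \<open>v\<close> as new independent variable, and the remaining terms have order at most \<open>n - 3\<close> in any
  variables. For an equation that already is in Laguerre-Forsyth form, the identity is an admissible change of variables.
\<close>

section \<open>Smooth functions\<close>

lemma Ck_on_cong:
  assumes "open S" "\<And>x. x \<in> S \<Longrightarrow> f x = g x"
  shows "Ck_on k S f \<longleftrightarrow> Ck_on k S g"
  using assms(2)
proof (induction k arbitrary: f g)
  case 0
  then show ?case by (simp cong: continuous_on_cong)
next
  case (Suc k)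
  have "Ck_on (Suc k) S g" if fg: "\<And>x. x \<in> S \<Longrightarrow> f x = g x" and f: "Ck_on (Suc k) S f" for f g :: "'a \<Rightarrow> 'b"
  proof -
    have "g differentiable (at x)" if "x \<in> S" for x
    proof -
      have "f differentiable (at x)" using f that by simp
      then have "(f has_derivative frechet_derivative f (at x)) (at x)" by (simp add: frechet_derivative_works)
      from has_derivative_transform_within_open[OF this \<open>open S\<close> that fg]
      show ?thesis using differentiableI by blast
    qed
    moreover have "Ck_on k S (\<lambda>x. frechet_derivative g (at x) v)" for v
    proof -
      have "frechet_derivative f (at x) = frechet_derivative g (at x)" if "x \<in> S" for x
        using f fg that \<open>open S\<close> frechet_derivative_transform_within_open[of f x S g] by force
      then show ?thesis
        using Suc.IH[of "\<lambda>x. frechet_derivative f (at x) v" "\<lambda>x. frechet_derivative g (at x) v"] f by simp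
    qed
    ultimately show ?thesis by simp
  qed
  from this[of f g] this[of g f] Suc.prems show ?case by metis
qed

lemma has_frechet_derivative:
  "f differentiable (at x) \<Longrightarrow> (f has_derivative frechet_derivative f (at x)) (at x)"
  by (simp add: frechet_derivative_works)

lemma Ck_on_SucD: "Ck_on (Suc k) S f \<Longrightarrow> Ck_on k S f"
proof (induction k arbitrary: f)
  case 0
  then show ?case by (auto intro!: continuous_at_imp_continuous_on differentiable_imp_continuous_within)
next
  case (Suc k)
  then show ?case by (metis Ck_on.simps(2))
qed

lemma Ck_on_subset: "Ck_on k S f \<Longrightarrow> T \<subseteq> S \<Longrightarrow> Ck_on k T f"
  by (induction k arbitrary: f) (auto intro: continuous_on_subset)

lemma Ck_on_add: "open S \<Longrightarrow> Ck_on k S f \<Longrightarrow> Ck_on k S g \<Longrightarrow> Ck_on k S (\<lambda>x. f x + g x)"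
proof (induction k arbitrary: f g)
  case 0
  then show ?case by (auto intro: continuous_intros)
next
  case (Suc k)
  have D: "((\<lambda>x. f x + g x) has_derivative
      (\<lambda>v. frechet_derivative f (at x) v + frechet_derivative g (at x) v)) (at x)" if "x \<in> S" for x
    using Suc.prems that
    by (intro has_derivative_add) (rule has_frechet_derivative, simp)+
  have "Ck_on k S (\<lambda>x. frechet_derivative (\<lambda>x. f x + g x) (at x) v)" for v
  proof (subst Ck_on_cong[OF \<open>open S\<close>])
    show "frechet_derivative (\<lambda>x. f x + g x) (at x) v =
       frechet_derivative f (at x) v + frechet_derivative g (at x) v" if "x \<in> S" for x
      using fun_cong[OF frechet_derivative_at[OF D[OF that]], of v] by simp
  qed (use Suc in simp)
  with D show ?case by (auto simp: differentiable_def)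
qed

lemma Ck_on_bounded_linear_comp:
  assumes "open S" "bounded_linear L" "Ck_on k S f"
  shows "Ck_on k S (\<lambda>x. L (f x))"
  using assms(3)
proof (induction k arbitrary: f)
  case 0
  then show ?case
    using assms(2) by (auto intro: bounded_linear.continuous_on)
next
  case (Suc k)
  have D: "((\<lambda>x. L (f x)) has_derivative (\<lambda>v. L (frechet_derivative f (at x) v))) (at x)" if "x \<in> S" for x
    using Suc.prems that
    by (intro bounded_linear.has_derivative[OF assms(2)]) (rule has_frechet_derivative, simp)
  have "Ck_on k S (\<lambda>x. frechet_derivative (\<lambda>x. L (f x)) (at x) v)" for v
  proof (subst Ck_on_cong[OF \<open>open S\<close>])
    show "frechet_derivative (\<lambda>x. L (f x)) (at x) v = L (frechet_derivative f (at x) v)" if "x \<in> S" for x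
      using fun_cong[OF frechet_derivative_at[OF D[OF that]], of v] by simp
  qed (use Suc in simp)
  with D show ?case by (auto simp: differentiable_def)
qed

lemma Ck_on_const: "Ck_on k S (\<lambda>x. c)"
  by (induction k arbitrary: c) auto

lemma Ck_on_bounded_linear:
  assumes "open S" "bounded_linear L" shows "Ck_on k S L"
proof (cases k)
  case 0
  then show ?thesis
    using assms(2) by (simp add: linear_continuous_on)
next
  case (Suc j)
  have "frechet_derivative L (at x) = L" for x
    by (rule frechet_derivative_at[symmetric]) (rule bounded_linear_imp_has_derivative[OF assms(2)])
  then show ?thesis
    using Suc assms(2) by (simp add: Ck_on_const bounded_linear_imp_differentiable)
qed

lemma Ck_on_scaleR:
  fixes f :: "'a::real_normed_vector \<Rightarrow> real" and g :: "'a \<Rightarrow> 'b::real_normed_vector"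
  shows "open S \<Longrightarrow> Ck_on k S f \<Longrightarrow> Ck_on k S g \<Longrightarrow> Ck_on k S (\<lambda>x. f x *\<^sub>R g x)"
proof (induction k arbitrary: f g)
  case 0
  then show ?case by (auto intro: continuous_intros)
next
  case (Suc k)
  have D: "((\<lambda>x. f x *\<^sub>R g x) has_derivative
      (\<lambda>v. f x *\<^sub>R frechet_derivative g (at x) v + frechet_derivative f (at x) v *\<^sub>R g x)) (at x)" if "x \<in> S" for x
    using Suc.prems that
    by (intro has_derivative_scaleR) (rule has_frechet_derivative, simp)+
  have "Ck_on k S (\<lambda>x. frechet_derivative (\<lambda>x. f x *\<^sub>R g x) (at x) v)" for v
  proof (subst Ck_on_cong[OF \<open>open S\<close>])
    show "frechet_derivative (\<lambda>x. f x *\<^sub>R g x) (at x) v =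
       f x *\<^sub>R frechet_derivative g (at x) v + frechet_derivative f (at x) v *\<^sub>R g x" if "x \<in> S" for x
      using fun_cong[OF frechet_derivative_at[OF D[OF that]], of v] by simp
    have "Ck_on k S f" "Ck_on k S g" using Suc.prems Ck_on_SucD by blast+
    then show "Ck_on k S (\<lambda>x. f x *\<^sub>R frechet_derivative g (at x) v + frechet_derivative f (at x) v *\<^sub>R g x)"
      using Suc.IH Suc.prems by (intro Ck_on_add) simp_all
  qed
  with D show ?case by (auto simp: differentiable_def)
qed

lemma Ck_on_sum: 
  assumes "open S" "\<And>i. i \<in> A \<Longrightarrow> Ck_on k S (f i)"
  shows "Ck_on k S (\<lambda>x. \<Sum>i\<in>A. f i x)"
proof (cases "finite A")
  case True
  then show ?thesis using assms(2)
    by (induction A rule: finite_induct) (auto intro: Ck_on_const Ck_on_add[OF assms(1)])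
qed (simp add: Ck_on_const)

text \<open>The chain rule differentiates an outer function along a moving direction; expanding that direction
  in a basis turns the derivative of the composite into a sum of products of functions of lower
  differentiability class.\<close>

lemma Ck_on_compose:
  fixes g :: "'b::euclidean_space \<Rightarrow> 'c::real_normed_vector" and h :: "'a::real_normed_vector \<Rightarrow> 'b"
  assumes "open S" "open T" "\<And>x. x \<in> S \<Longrightarrow> h x \<in> T"
  shows "Ck_on k T g \<Longrightarrow> Ck_on k S h \<Longrightarrow> Ck_on k S (\<lambda>x. g (h x))"
proof (induction k arbitrary: g)
  case 0
  then show ?case
    using continuous_on_compose2[of T g S h] assms(3) by auto
next
  case (Suc k)
  have D: "((\<lambda>x. g (h x)) has_derivative
      (\<lambda>v. frechet_derivative g (at (h x)) (frechet_derivative h (at x) v))) (at x)" if "x \<in> S" for x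
  proof -
    have "(h has_derivative frechet_derivative h (at x)) (at x)"
      using Suc.prems(2) that by (simp add: has_frechet_derivative)
    moreover have "(g has_derivative frechet_derivative g (at (h x))) (at (h x))"
      using Suc.prems(1) assms(3)[OF that] by (simp add: has_frechet_derivative)
    ultimately show ?thesis by (rule has_derivative_compose)
  qed
  have E: "frechet_derivative g (at (h x)) w = (\<Sum>b\<in>Basis. (w \<bullet> b) *\<^sub>R frechet_derivative g (at (h x)) b)"
    if "x \<in> S" for x w
  proof -
    have "linear (frechet_derivative g (at (h x)))"
      using Suc.prems that assms by (simp add: linear_frechet_derivative)
    then have "frechet_derivative g (at (h x)) (\<Sum>b\<in>Basis. (w \<bullet> b) *\<^sub>R b) =
       (\<Sum>b\<in>Basis. (w \<bullet> b) *\<^sub>R frechet_derivative g (at (h x)) b)"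
      by (simp add: linear_sum linear_scale)
    then show ?thesis by (simp add: euclidean_representation)
  qed
  have "Ck_on k S (\<lambda>x. frechet_derivative (\<lambda>x. g (h x)) (at x) v)" for v
  proof (subst Ck_on_cong[OF \<open>open S\<close>])
    show "frechet_derivative (\<lambda>x. g (h x)) (at x) v =
       (\<Sum>b\<in>Basis. (frechet_derivative h (at x) v \<bullet> b) *\<^sub>R frechet_derivative g (at (h x)) b)"
      if "x \<in> S" for x
      using trans[OF fun_cong[OF frechet_derivative_at[OF D[OF that], symmetric]] E[OF that]] .
    have "Ck_on k S h" using Suc.prems(2) by (rule Ck_on_SucD)
    then show "Ck_on k S (\<lambda>x. \<Sum>b\<in>Basis. (frechet_derivative h (at x) v \<bullet> b) *\<^sub>R frechet_derivative g (at (h x)) b)"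
      using Suc.prems Suc.IH
      by (intro Ck_on_sum[OF \<open>open S\<close>] Ck_on_scaleR[OF \<open>open S\<close>]
           Ck_on_bounded_linear_comp[OF \<open>open S\<close> bounded_linear_inner_left]) auto
  qed
  with D show ?case by (auto simp: differentiable_def)
qed

lemma smooth_on_cong: "open S \<Longrightarrow> (\<And>x. x \<in> S \<Longrightarrow> f x = g x) \<Longrightarrow> smooth_on S f \<longleftrightarrow> smooth_on S g"
  unfolding smooth_on_def using Ck_on_cong by blast

lemma smooth_on_subset: "smooth_on S f \<Longrightarrow> T \<subseteq> S \<Longrightarrow> smooth_on T f"
  unfolding smooth_on_def using Ck_on_subset by blast

lemma smooth_on_imp_differentiable: "smooth_on S f \<Longrightarrow> x \<in> S \<Longrightarrow> f differentiable (at x)"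
  unfolding smooth_on_def by (metis Ck_on.simps(2))

lemma smooth_on_frechet_derivative: "smooth_on S f \<Longrightarrow> smooth_on S (\<lambda>x. frechet_derivative f (at x) v)"
  unfolding smooth_on_def by (metis Ck_on.simps(2))

lemma smooth_on_imp_continuous_on: "smooth_on S f \<Longrightarrow> continuous_on S f"
  unfolding smooth_on_def by (metis Ck_on.simps(1))

named_theorems smooth_intros

lemma smooth_on_const [smooth_intros]: "smooth_on S (\<lambda>x. c)"
  by (simp add: smooth_on_def Ck_on_const)

lemma smooth_on_add [smooth_intros]:
  "open S \<Longrightarrow> smooth_on S f \<Longrightarrow> smooth_on S g \<Longrightarrow> smooth_on S (\<lambda>x. f x + g x)"
  by (simp add: smooth_on_def Ck_on_add)

lemma smooth_on_sum [smooth_intros]: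
  "open S \<Longrightarrow> (\<And>i. i \<in> A \<Longrightarrow> smooth_on S (f i)) \<Longrightarrow> smooth_on S (\<lambda>x. \<Sum>i\<in>A. f i x)"
  by (simp add: smooth_on_def Ck_on_sum)

lemma smooth_on_bounded_linear: "open S \<Longrightarrow> bounded_linear L \<Longrightarrow> smooth_on S L"
  by (simp add: smooth_on_def Ck_on_bounded_linear)

lemma smooth_on_bounded_linear_comp:
  "open S \<Longrightarrow> bounded_linear L \<Longrightarrow> smooth_on S f \<Longrightarrow> smooth_on S (\<lambda>x. L (f x))"
  by (simp add: smooth_on_def Ck_on_bounded_linear_comp)

lemma smooth_on_minus [smooth_intros]: "open S \<Longrightarrow> smooth_on S f \<Longrightarrow> smooth_on S (\<lambda>x. - f x)"
  by (rule smooth_on_bounded_linear_comp[OF _ bounded_linear_minus[OF bounded_linear_ident], of S f])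

lemma smooth_on_diff [smooth_intros]:
  "open S \<Longrightarrow> smooth_on S f \<Longrightarrow> smooth_on S g \<Longrightarrow> smooth_on S (\<lambda>x. f x - g x)"
  using smooth_on_add[of S f "\<lambda>x. - g x"] smooth_on_minus[of S g] by simp

lemma smooth_on_ident [smooth_intros]: "open S \<Longrightarrow> smooth_on S (\<lambda>x. x)"
  by (rule smooth_on_bounded_linear[OF _ bounded_linear_ident])

lemma smooth_on_fst [smooth_intros]: "open S \<Longrightarrow> smooth_on S f \<Longrightarrow> smooth_on S (\<lambda>x. fst (f x))"
  by (rule smooth_on_bounded_linear_comp[OF _ bounded_linear_fst])

lemma smooth_on_snd [smooth_intros]: "open S \<Longrightarrow> smooth_on S f \<Longrightarrow> smooth_on S (\<lambda>x. snd (f x))"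
  by (rule smooth_on_bounded_linear_comp[OF _ bounded_linear_snd])

lemma smooth_on_Pair [smooth_intros]:
  assumes "open S" "smooth_on S f" "smooth_on S g"
  shows "smooth_on S (\<lambda>x. (f x, g x))"
proof -
  have "bounded_linear (\<lambda>x. (x, 0) :: 'b \<times> 'c)" "bounded_linear (\<lambda>x. (0, x) :: 'b \<times> 'c)"
    by (auto intro: bounded_linear_Pair bounded_linear_ident bounded_linear_zero)
  then have "smooth_on S (\<lambda>x. (f x, 0) + (0, g x))"
    using assms by (intro smooth_on_add smooth_on_bounded_linear_comp[where L = "\<lambda>x. (x, 0)"]
      smooth_on_bounded_linear_comp[where L = "\<lambda>x. (0, x)"])
  then show ?thesis by simp
qed

lemma smooth_on_mult [smooth_intros]:
  fixes f g :: "'a::real_normed_vector \<Rightarrow> real"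
  shows "open S \<Longrightarrow> smooth_on S f \<Longrightarrow> smooth_on S g \<Longrightarrow> smooth_on S (\<lambda>x. f x * g x)"
  using Ck_on_scaleR[of S _ f g] by (simp add: smooth_on_def)

lemma smooth_on_compose:
  fixes g :: "'b::euclidean_space \<Rightarrow> 'c::real_normed_vector" and h :: "'a::real_normed_vector \<Rightarrow> 'b"
  assumes "open S" "open T" "smooth_on T g" "smooth_on S h" "\<And>x. x \<in> S \<Longrightarrow> h x \<in> T"
  shows "smooth_on S (\<lambda>x. g (h x))"
  using assms by (simp add: smooth_on_def Ck_on_compose[of S T h])

lemma smooth_on_power [smooth_intros]:
  fixes f :: "'a::real_normed_vector \<Rightarrow> real"
  shows "open S \<Longrightarrow> smooth_on S f \<Longrightarrow> smooth_on S (\<lambda>x. f x ^ k)"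
  by (induction k) (auto intro: smooth_intros)

subsection \<open>Functions of one real variable\<close>

lemma frechet_derivative_real:
  fixes f :: "real \<Rightarrow> real"
  assumes "f differentiable (at x)"
  shows "frechet_derivative f (at x) v = deriv f x * v"
proof -
  have "(f has_real_derivative deriv f x) (at x)"
    using assms by (simp add: DERIV_deriv_iff_real_differentiable)
  then have "(f has_derivative (\<lambda>v. deriv f x * v)) (at x)"
    by (simp add: has_field_derivative_def)
  then show ?thesis using frechet_derivative_at by metis
qed

lemma Ck_on_Suc_real:
  fixes f :: "real \<Rightarrow> real"
  assumes "open S"
  shows "Ck_on (Suc k) S f \<longleftrightarrow> (\<forall>x\<in>S. f differentiable (at x)) \<and> Ck_on k S (deriv f)"
proof (cases "\<forall>x\<in>S. f differentiable (at x)")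
  case True
  have "Ck_on k S (\<lambda>x. frechet_derivative f (at x) v) \<longleftrightarrow> Ck_on k S (\<lambda>x. v * deriv f x)" for v
    using True by (intro Ck_on_cong[OF assms]) (simp add: frechet_derivative_real)
  moreover have "Ck_on k S (\<lambda>x. v * deriv f x)" if "Ck_on k S (deriv f)" for v
    using Ck_on_bounded_linear_comp[OF assms bounded_linear_mult_right that] .
  moreover have "(\<lambda>x. 1 * deriv f x) = deriv f" by simp
  ultimately show ?thesis using True by (metis Ck_on.simps(2))
qed auto

lemma smooth_on_real_iff:
  fixes f :: "real \<Rightarrow> real"
  assumes "open S"
  shows "smooth_on S f \<longleftrightarrow> (\<forall>x\<in>S. f differentiable (at x)) \<and> smooth_on S (deriv f)"
  unfolding smooth_on_def using Ck_on_Suc_real[OF assms] Ck_on_SucD by metis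

lemma smooth_on_DERIV:
  fixes f :: "real \<Rightarrow> real"
  shows "smooth_on S f \<Longrightarrow> x \<in> S \<Longrightarrow> (f has_real_derivative deriv f x) (at x)"
  using smooth_on_imp_differentiable DERIV_deriv_iff_real_differentiable by blast

lemma smooth_on_deriv [smooth_intros]:
  fixes f :: "real \<Rightarrow> real"
  shows "open S \<Longrightarrow> smooth_on S f \<Longrightarrow> smooth_on S (deriv f)"
  using smooth_on_real_iff by blast

lemma smooth_on_funpow_deriv [smooth_intros]:
  fixes f :: "real \<Rightarrow> real"
  shows "open S \<Longrightarrow> smooth_on S f \<Longrightarrow> smooth_on S ((deriv ^^ k) f)"
  by (induction k) (auto intro: smooth_intros)

lemma smooth_on_funpow_DERIV:
  fixes f :: "real \<Rightarrow> real"
  shows "open S \<Longrightarrow> smooth_on S f \<Longrightarrow> x \<in> S \<Longrightarrow>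
    ((deriv ^^ k) f has_real_derivative (deriv ^^ Suc k) f x) (at x)"
  using smooth_on_DERIV[OF smooth_on_funpow_deriv] by simp

text \<open>Smoothness of functions that are given by their derivative (primitives, inverse functions, solutions of
  differential equations) is obtained from the next two facts; the version with finite order serves when the derivative
  involves the function itself.\<close>

lemma smooth_on_if_DERIV:
  fixes f :: "real \<Rightarrow> real"
  assumes "open S" "\<And>x. x \<in> S \<Longrightarrow> (f has_real_derivative f' x) (at x)" "smooth_on S f'"
  shows "smooth_on S f"
proof -
  have "deriv f x = f' x" if "x \<in> S" for x using assms(2)[OF that] by (rule DERIV_imp_deriv)
  then have "smooth_on S (deriv f)" using smooth_on_cong[OF assms(1)] assms(3) by metis
  then show ?thesis using smooth_on_real_iff[OF assms(1)] assms(2) real_differentiable_def by blast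
qed

lemma Ck_on_if_DERIV:
  fixes f :: "real \<Rightarrow> real"
  assumes "open S" "\<And>x. x \<in> S \<Longrightarrow> (f has_real_derivative f' x) (at x)" "Ck_on k S f'"
  shows "Ck_on (Suc k) S f"
proof -
  have "deriv f x = f' x" if "x \<in> S" for x using assms(2)[OF that] by (rule DERIV_imp_deriv)
  then have "Ck_on k S (deriv f)" using Ck_on_cong[OF assms(1)] assms(3) by metis
  then show ?thesis using Ck_on_Suc_real[OF assms(1)] assms(2) real_differentiable_def by blast
qed

lemma smooth_on_inverse_real: "smooth_on (- {0}) (inverse :: real \<Rightarrow> real)"
  unfolding smooth_on_def
proof
  fix k show "Ck_on k (- {0}) (inverse :: real \<Rightarrow> real)"
  proof (induction k)
    case 0
    then show ?case by (auto intro!: continuous_intros)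
  next
    case (Suc k)
    have "Ck_on k (- {0}) (\<lambda>x. (- 1) *\<^sub>R (inverse x *\<^sub>R inverse x) :: real)"
      using Suc by (intro Ck_on_scaleR Ck_on_const) auto
    then show ?case
      by (intro Ck_on_if_DERIV[where f' = "\<lambda>x. - 1 * (inverse x * inverse x)"])
         (auto intro!: derivative_eq_intros simp: power2_eq_square)
  qed
qed

lemma smooth_on_inverse [smooth_intros]:
  fixes f :: "'a::real_normed_vector \<Rightarrow> real"
  assumes "open S" "smooth_on S f" "\<And>x. x \<in> S \<Longrightarrow> f x \<noteq> 0"
  shows "smooth_on S (\<lambda>x. inverse (f x))"
  using smooth_on_compose[OF assms(1) _ smooth_on_inverse_real assms(2)] assms(3) by auto

lemma smooth_on_divide [smooth_intros]:
  fixes f g :: "'a::real_normed_vector \<Rightarrow> real"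
  assumes "open S" "smooth_on S f" "smooth_on S g" "\<And>x. x \<in> S \<Longrightarrow> g x \<noteq> 0"
  shows "smooth_on S (\<lambda>x. f x / g x)"
  unfolding divide_inverse using assms by (intro smooth_intros)

lemma smooth_on_exp: "smooth_on UNIV (exp :: real \<Rightarrow> real)"
  unfolding smooth_on_def
proof
  fix k show "Ck_on k UNIV (exp :: real \<Rightarrow> real)"
    by (induction k) (auto intro!: continuous_intros Ck_on_if_DERIV[where f' = exp] DERIV_exp simp del: Ck_on.simps(2))
qed

text \<open>For the inverse of a diffeomorphism the derivative is a smooth function of the inverse itself, so
  its differentiability class can be raised step by step.\<close>

lemma smooth_on_inverse_function:
  fixes f F :: "real \<Rightarrow> real"
  assumes "open S" "open T" "smooth_on S f" "\<And>x. x \<in> S \<Longrightarrow> deriv f x \<noteq> 0"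
    and "\<And>y. y \<in> T \<Longrightarrow> F y \<in> S" "\<And>y. y \<in> T \<Longrightarrow> (F has_real_derivative inverse (deriv f (F y))) (at y)"
  shows "smooth_on T F"
  unfolding smooth_on_def
proof
  fix k show "Ck_on k T F"
  proof (induction k)
    case 0
    have "continuous_on T F"
      using assms(6) DERIV_isCont by (intro continuous_at_imp_continuous_on) blast
    then show ?case by simp
  next
    case (Suc k)
    have "smooth_on S (\<lambda>x. inverse (deriv f x))"
      using assms by (intro smooth_intros)
    then have "Ck_on k S (\<lambda>x. inverse (deriv f x))" unfolding smooth_on_def by blast
    from Ck_on_compose[OF assms(2,1,5) this Suc]
    have "Ck_on k T (\<lambda>y. inverse (deriv f (F y)))" .
    with assms(2,6) show ?case by (rule Ck_on_if_DERIV)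
  qed
qed

subsection \<open>Higher derivatives\<close>

lemma funpow_deriv_cong:
  assumes "open S" "\<And>x. x \<in> S \<Longrightarrow> f x = g x" "x \<in> S"
  shows "(deriv ^^ k) f x = (deriv ^^ k) g x"
  using assms(3)
proof (induction k arbitrary: x)
  case (Suc k)
  have "\<forall>\<^sub>F z in nhds x. (deriv ^^ k) f z = (deriv ^^ k) g z"
    using Suc assms(1) eventually_nhds by blast
  then show ?case by (simp add: deriv_cong_ev)
qed (use assms in simp)

lemma funpow_deriv_Suc_deriv: "(deriv ^^ k) (deriv f) = (deriv ^^ Suc k) f"
  by (simp add: funpow_Suc_right del: funpow.simps)

lemma funpow_deriv_const: "(deriv ^^ k) (\<lambda>x. c) = (\<lambda>x. if k = 0 then c else 0 :: real)"
proof (induction k)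
  case (Suc k)
  show ?case
  proof (cases k)
    case (Suc j)
    then show ?thesis using \<open>(deriv ^^ k) _ = _\<close> by simp
  qed simp
qed auto

lemma funpow_deriv_step:
  assumes "open S" "\<And>x. x \<in> S \<Longrightarrow> (deriv ^^ k) f x = g x" "x \<in> S" "(g has_real_derivative d) (at x)"
  shows "(deriv ^^ Suc k) f x = d"
proof -
  have "\<forall>\<^sub>F z in nhds x. (deriv ^^ k) f z = g z"
    using assms eventually_nhds by blast
  then have "deriv ((deriv ^^ k) f) x = deriv g x" by (intro deriv_cong_ev) auto
  with assms(4) show ?thesis by (simp add: DERIV_imp_deriv)
qed

lemma funpow_deriv_add:
  fixes f g :: "real \<Rightarrow> real"
  assumes "open S" "smooth_on S f" "smooth_on S g" "x \<in> S"
  shows "(deriv ^^ k) (\<lambda>x. f x + g x) x = (deriv ^^ k) f x + (deriv ^^ k) g x"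
  using assms(4)
proof (induction k arbitrary: x)
  case (Suc k)
  show ?case
    by (rule funpow_deriv_step[OF assms(1) Suc.IH Suc.prems])
       (auto intro!: DERIV_add smooth_on_funpow_DERIV[where S = S] simp del: funpow.simps simp: assms Suc.prems)
qed simp

lemma funpow_deriv_cmult:
  fixes f :: "real \<Rightarrow> real"
  assumes "open S" "smooth_on S f" "x \<in> S"
  shows "(deriv ^^ k) (\<lambda>x. c * f x) x = c * (deriv ^^ k) f x"
  using assms(3)
proof (induction k arbitrary: x)
  case (Suc k)
  show ?case
    by (rule funpow_deriv_step[OF assms(1) Suc.IH Suc.prems])
       (auto intro!: DERIV_cmult smooth_on_funpow_DERIV[where S = S] simp del: funpow.simps simp: assms Suc.prems)
qed simp

lemma funpow_deriv_diff:
  fixes f g :: "real \<Rightarrow> real"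
  assumes "open S" "smooth_on S f" "smooth_on S g" "x \<in> S"
  shows "(deriv ^^ k) (\<lambda>x. f x - g x) x = (deriv ^^ k) f x - (deriv ^^ k) g x"
  using funpow_deriv_add[OF assms(1,2) smooth_on_minus[OF assms(1,3)] assms(4), of k]
        funpow_deriv_cmult[OF assms(1,3,4), of k "-1"] by simp

lemma funpow_deriv_sum:
  fixes f :: "'i \<Rightarrow> real \<Rightarrow> real"
  assumes "open S" "finite A" "\<And>i. i \<in> A \<Longrightarrow> smooth_on S (f i)" "x \<in> S"
  shows "(deriv ^^ k) (\<lambda>x. \<Sum>i\<in>A. f i x) x = (\<Sum>i\<in>A. (deriv ^^ k) (f i) x)"
  using assms(2,3)
proof (induction A rule: finite_induct)
  case empty
  then show ?case by (simp add: funpow_deriv_const)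
next
  case (insert a A)
  then show ?case
    using funpow_deriv_add[OF assms(1) _ _ assms(4), of "f a" "\<lambda>x. \<Sum>i\<in>A. f i x"]
    by (simp add: smooth_on_sum assms(1))
qed

lemma funpow_deriv_mult:
  fixes f g :: "real \<Rightarrow> real"
  assumes "open S" "smooth_on S f" "smooth_on S g" "x \<in> S"
  shows "(deriv ^^ k) (\<lambda>x. f x * g x) x =
    (\<Sum>i\<le>k. real (k choose i) * (deriv ^^ (k - i)) f x * (deriv ^^ i) g x)"
  using assms(4)
proof (induction k arbitrary: x)
  case (Suc k)
  let ?f = "\<lambda>i. (deriv ^^ i) f" and ?g = "\<lambda>i. (deriv ^^ i) g"
  note D = smooth_on_funpow_DERIV[OF assms(1,2) Suc.prems] smooth_on_funpow_DERIV[OF assms(1,3) Suc.prems]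
  have 1: "(deriv ^^ Suc k) (\<lambda>x. f x * g x) x =
     (\<Sum>i\<le>k. real (k choose i) * (?f (Suc k - i) x * ?g i x + ?f (k - i) x * ?g (Suc i) x))"
  proof (rule funpow_deriv_step[OF assms(1) Suc.IH Suc.prems])
    show "((\<lambda>x. \<Sum>i\<le>k. real (k choose i) * ?f (k - i) x * ?g i x) has_real_derivative
       (\<Sum>i\<le>k. real (k choose i) * (?f (Suc k - i) x * ?g i x + ?f (k - i) x * ?g (Suc i) x))) (at x)"
      by (intro DERIV_sum) (auto intro!: derivative_eq_intros D simp del: funpow.simps simp: Suc_diff_le algebra_simps)
  qed
  have 2: "(\<Sum>i\<le>k. real (k choose i) * (?f (Suc k - i) x * ?g i x)) =
       (\<Sum>i\<le>Suc k. real (k choose i) * (?f (Suc k - i) x * ?g i x))"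
    by simp
  have 3: "(\<Sum>i\<le>Suc k. real (Suc k choose i) * ?f (Suc k - i) x * ?g i x) =
     (\<Sum>i\<le>Suc k. real (k choose i) * (?f (Suc k - i) x * ?g i x)) +
     (\<Sum>i\<le>k. real (k choose i) * (?f (k - i) x * ?g (Suc i) x))"
    by (simp add: sum.atMost_Suc_shift sum.distrib algebra_simps del: funpow.simps sum.atMost_Suc)
  show ?case unfolding 1 3 using 2 by (simp add: distrib_left sum.distrib del: funpow.simps sum.atMost_Suc)
qed simp

subsection \<open>Monomials and Taylor polynomials\<close>

text \<open>The monomials are divided by factorials so that their jets at the center form the standard basis.\<close>

definition hpow :: "real \<Rightarrow> nat \<Rightarrow> real \<Rightarrow> real" where
  "hpow x0 k x = (x - x0) ^ k / fact k"

lemma smooth_on_hpow [smooth_intros]: "open S \<Longrightarrow> smooth_on S (hpow x0 k)"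
  unfolding hpow_def by (intro smooth_intros) auto

lemma DERIV_hpow: "(hpow x0 (Suc k) has_real_derivative hpow x0 k x) (at x)"
proof -
  have "((\<lambda>x. x - x0) has_real_derivative 1) (at x)"
    by (auto intro!: derivative_eq_intros)
  from DERIV_cdivide[OF DERIV_power_Suc[OF this, of k], of "fact (Suc k)"]
  have "((\<lambda>x. (x - x0) ^ Suc k / fact (Suc k)) has_real_derivative
      (1 + real k) * (1 * (x - x0) ^ k) / fact (Suc k)) (at x)" .
  moreover have "(1 + real k) * (1 * (x - x0) ^ k) / fact (Suc k) = (x - x0) ^ k / fact k"
    by (simp add: divide_simps)
  ultimately show ?thesis unfolding hpow_def[abs_def] by metis
qed

lemma funpow_deriv_hpow:
  "(deriv ^^ j) (hpow x0 k) = (\<lambda>x. if j \<le> k then hpow x0 (k - j) x else 0)"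
proof (induction j)
  case (Suc j)
  have *: "deriv (hpow x0 (Suc i)) = hpow x0 i" for i
    using DERIV_hpow DERIV_imp_deriv by blast
  have "hpow x0 0 = (\<lambda>x. 1)" by (auto simp: hpow_def)
  then have 0: "deriv (hpow x0 0) = (\<lambda>x. 0)" by simp
  show ?case
  proof (cases "j < k")
    case True
    then have "k - j = Suc (k - Suc j)" by simp
    with True Suc * show ?thesis by simp
  next
    case False
    then show ?thesis using Suc 0 by (cases "j = k") auto
  qed
qed simp

lemma hpow_center [simp]: "hpow x0 k x0 = (if k = 0 then 1 else 0)"
  by (simp add: hpow_def)

lemma funpow_deriv_hpow_center [simp]: "(deriv ^^ j) (hpow x0 k) x0 = (if j = k then 1 else 0)"
  by (auto simp: funpow_deriv_hpow)

definition taylor_poly :: "real \<Rightarrow> (nat \<Rightarrow> real) \<Rightarrow> nat \<Rightarrow> real \<Rightarrow> real" where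
  "taylor_poly x0 u m x = (\<Sum>k\<le>m. u k * hpow x0 k x)"

lemma smooth_on_taylor_poly [smooth_intros]: "open S \<Longrightarrow> smooth_on S (taylor_poly x0 u m)"
  unfolding taylor_poly_def by (intro smooth_intros)

lemma funpow_deriv_taylor_poly: "j \<le> m \<Longrightarrow> (deriv ^^ j) (taylor_poly x0 u m) x0 = u j"
proof -
  assume "j \<le> m"
  have "(deriv ^^ j) (taylor_poly x0 u m) x0 = (\<Sum>k\<le>m. (deriv ^^ j) (\<lambda>x. u k * hpow x0 k x) x0)"
    unfolding taylor_poly_def by (rule funpow_deriv_sum[where S = UNIV]) (auto intro!: smooth_intros)
  also have "\<dots> = (\<Sum>k\<le>m. u k * (if j = k then 1 else 0))"
    by (intro sum.cong refl, subst funpow_deriv_cmult[where S = UNIV]) (auto intro: smooth_intros)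
  also have "\<dots> = u j" using \<open>j \<le> m\<close> by (simp add: if_distrib cong: if_cong)
  finally show ?thesis .
qed

section \<open>Prolongations along curves\<close>

definition jet :: "(real \<Rightarrow> real) \<Rightarrow> real \<Rightarrow> nat \<Rightarrow> real" where
  "jet y x k = (deriv ^^ k) y x"

lemma jet_0: "jet y x 0 = y x"
  by (simp add: jet_def)

text \<open>Total derivatives are built from partial derivatives, whose existence does not give a chain rule. The coefficients
  of a prolongation are polynomials in the derivatives of \<open>y\<close> with smooth functions of \<open>(x, y)\<close> as coefficients; for this
  class the chain rule holds, and it is closed under total derivatives. The last rule allows for arbitrary values outside
  \<open>I\<close>, where the derivatives in the definitions have no meaning.\<close>

inductive jet_polynomial :: "real set \<Rightarrow> nat \<Rightarrow> jet_fun \<Rightarrow> bool" for I m where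
  base: "smooth_on (I \<times> UNIV) G \<Longrightarrow> jet_polynomial I m (\<lambda>x u. G (x, u 0))"
| coord: "k \<le> m \<Longrightarrow> jet_polynomial I m (\<lambda>x u. u k)"
| add: "jet_polynomial I m F \<Longrightarrow> jet_polynomial I m G \<Longrightarrow> jet_polynomial I m (\<lambda>x u. F x u + G x u)"
| mult: "jet_polynomial I m F \<Longrightarrow> jet_polynomial I m G \<Longrightarrow> jet_polynomial I m (\<lambda>x u. F x u * G x u)"
| cong: "jet_polynomial I m F \<Longrightarrow> (\<And>x u. x \<in> I \<Longrightarrow> F' x u = F x u) \<Longrightarrow> jet_polynomial I m F'"

lemma DERIV_compose_plane:
  fixes G :: "real \<times> real \<Rightarrow> real"
  assumes "G differentiable (at (p x, q x))"
    and "(p has_real_derivative a) (at x)" "(q has_real_derivative b) (at x)"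
  shows "((\<lambda>t. G (p t, q t)) has_real_derivative
     a * frechet_derivative G (at (p x, q x)) (1, 0) + b * frechet_derivative G (at (p x, q x)) (0, 1)) (at x)"
proof -
  let ?D = "frechet_derivative G (at (p x, q x))"
  have "((\<lambda>t. (p t, q t)) has_derivative (\<lambda>h. (a * h, b * h))) (at x)"
    using assms(2,3) by (intro has_derivative_Pair) (simp_all add: has_field_derivative_def)
  from has_derivative_compose[OF this has_frechet_derivative[OF assms(1)]]
  have "((\<lambda>t. G (p t, q t)) has_derivative (\<lambda>h. ?D (a * h, b * h))) (at x)" .
  moreover have "?D (a * h, b * h) = (a * ?D (1, 0) + b * ?D (0, 1)) * h" for h
  proof -
    have L: "linear ?D" using assms(1) by (rule linear_frechet_derivative)
    have "(a * h, b * h) = (a * h) *\<^sub>R (1, 0) + (b * h) *\<^sub>R (0, 1)" by simp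
    then have "?D (a * h, b * h) = (a * h) *\<^sub>R ?D (1, 0) + (b * h) *\<^sub>R ?D (0, 1)"
      by (simp only: linear_add[OF L] linear_scale[OF L])
    then show ?thesis by (simp add: algebra_simps)
  qed
  ultimately show ?thesis by (simp add: has_field_derivative_def)
qed

lemma jet_polynomial_mono: "jet_polynomial I m F \<Longrightarrow> m \<le> m' \<Longrightarrow> jet_polynomial I m' F"
  by (induction rule: jet_polynomial.induct) (auto intro: jet_polynomial.intros)

lemma jet_polynomial_const: "jet_polynomial I m (\<lambda>x u. a)"
  using jet_polynomial.base[OF smooth_on_const] .

lemma jet_polynomial_sum:
  "finite A \<Longrightarrow> (\<And>i. i \<in> A \<Longrightarrow> jet_polynomial I m (F i)) \<Longrightarrow> jet_polynomial I m (\<lambda>x u. \<Sum>i\<in>A. F i x u)"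
  by (induction A rule: finite_induct) (auto intro: jet_polynomial_const jet_polynomial.add)

lemma jet_polynomial_diff:
  assumes "jet_polynomial I m F" "jet_polynomial I m G"
  shows "jet_polynomial I m (\<lambda>x u. F x u - G x u)"
proof -
  have "jet_polynomial I m (\<lambda>x u. F x u + (- 1) * G x u)"
    by (intro jet_polynomial.add jet_polynomial.mult jet_polynomial_const assms)
  then show ?thesis by simp
qed

lemma jet_polynomial_order:
  "jet_polynomial I m F \<Longrightarrow> x \<in> I \<Longrightarrow> (\<And>k. k \<le> m \<Longrightarrow> u k = v k) \<Longrightarrow> F x u = F x v"
  by (induction rule: jet_polynomial.induct) auto

lemma jet_polynomial_differentiable:
  assumes "open I" "jet_polynomial I m F" "x \<in> I"
  shows "(\<lambda>t. F t u) differentiable (at x)" "(\<lambda>t. F x (u(i := t))) differentiable (at s)"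
proof -
  have "(\<lambda>t. F t u) differentiable (at x) \<and> (\<lambda>t. F x (u(i := t))) differentiable (at s)"
    using assms(2)
  proof (induction rule: jet_polynomial.induct)
    case (base G)
    have G: "G differentiable (at (x, r))" for r
      using smooth_on_imp_differentiable[OF base] assms(3) by simp
    have "((\<lambda>t. t) has_real_derivative 1) (at r)" "((\<lambda>t. c) has_real_derivative 0) (at r)" for r c :: real
      by auto
    then have "((\<lambda>t. G (t, u 0)) has_real_derivative
        1 * frechet_derivative G (at (x, u 0)) (1, 0) + 0 * frechet_derivative G (at (x, u 0)) (0, 1)) (at x)"
      and "((\<lambda>t. G (x, t)) has_real_derivative
        0 * frechet_derivative G (at (x, s)) (1, 0) + 1 * frechet_derivative G (at (x, s)) (0, 1)) (at s)"
      using DERIV_compose_plane[where p = "\<lambda>t. t" and q = "\<lambda>t. u 0" and x = x and G = G]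
       DERIV_compose_plane[where p = "\<lambda>t. x" and q = "\<lambda>t. t" and x = s and G = G] G by blast+
    then show ?case by (cases "i = 0") (auto simp: real_differentiable_def)
  next
    case (cong F F')
    then have "(\<lambda>t. F t u) differentiable (at x)" by simp
    then have "((\<lambda>t. F t u) has_derivative frechet_derivative (\<lambda>t. F t u) (at x)) (at x)"
      by (rule has_frechet_derivative)
    from has_derivative_transform_within_open[OF this \<open>open I\<close> \<open>x \<in> I\<close>, of "\<lambda>t. F' t u"]
    have "((\<lambda>t. F' t u) has_derivative frechet_derivative (\<lambda>t. F t u) (at x)) (at x)"
      using cong.hyps(2) by simp
    then have "(\<lambda>t. F' t u) differentiable (at x)" by (auto simp: differentiable_def)
    moreover have "(\<lambda>t. F' x (u(i := t))) = (\<lambda>t. F x (u(i := t)))" using cong.hyps(2) assms(3) by auto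
    ultimately show ?case using cong.IH by (simp only:)
  next
    case (coord k)
    then show ?case by (cases "i = k") auto
  qed auto
  then show "(\<lambda>t. F t u) differentiable (at x)" "(\<lambda>t. F x (u(i := t))) differentiable (at s)" by auto
qed

lemma partial_DERIV:
  assumes "open I" "jet_polynomial I m F" "x \<in> I"
  shows "((\<lambda>t. F t u) has_real_derivative partial_x F x u) (at x)"
    and "((\<lambda>t. F x (u(i := t))) has_real_derivative partial_u i F x u) (at (u i))"
  using jet_polynomial_differentiable[OF assms] unfolding partial_x_def partial_u_def
  by (simp_all add: DERIV_deriv_iff_real_differentiable)

lemma partial_cong:
  assumes "open I" "\<And>x u. x \<in> I \<Longrightarrow> F' x u = F x u" "x \<in> I"
  shows "partial_x F' x u = partial_x F x u" "partial_u i F' x u = partial_u i F x u"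
proof -
  have "\<forall>\<^sub>F t in nhds x. F' t u = F t u" using assms eventually_nhds by blast
  then show "partial_x F' x u = partial_x F x u" unfolding partial_x_def by (rule deriv_cong_ev) simp
  show "partial_u i F' x u = partial_u i F x u" using assms by (simp add: partial_u_def)
qed

lemma partial_add:
  assumes "open I" "jet_polynomial I m F" "jet_polynomial I m G" "x \<in> I"
  shows "partial_x (\<lambda>x u. F x u + G x u) x u = partial_x F x u + partial_x G x u"
    and "partial_u i (\<lambda>x u. F x u + G x u) x u = partial_u i F x u + partial_u i G x u"
  unfolding partial_x_def[of "\<lambda>x u. F x u + G x u"] partial_u_def[of i "\<lambda>x u. F x u + G x u"]
  by (intro DERIV_imp_deriv DERIV_add partial_DERIV[OF assms(1,2,4)] partial_DERIV[OF assms(1,3,4)])+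

lemma partial_mult:
  assumes "open I" "jet_polynomial I m F" "jet_polynomial I m G" "x \<in> I"
  shows "partial_x (\<lambda>x u. F x u * G x u) x u = partial_x F x u * G x u + F x u * partial_x G x u"
    and "partial_u i (\<lambda>x u. F x u * G x u) x u = partial_u i F x u * G x u + F x u * partial_u i G x u"
proof -
  show "partial_x (\<lambda>x u. F x u * G x u) x u = partial_x F x u * G x u + F x u * partial_x G x u"
    unfolding partial_x_def[of "\<lambda>x u. F x u * G x u"]
    using DERIV_mult[OF partial_DERIV(1)[OF assms(1,2,4), of u] partial_DERIV(1)[OF assms(1,3,4), of u]]
    by (intro DERIV_imp_deriv) (simp add: algebra_simps)
  show "partial_u i (\<lambda>x u. F x u * G x u) x u = partial_u i F x u * G x u + F x u * partial_u i G x u"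
    unfolding partial_u_def[of i "\<lambda>x u. F x u * G x u"]
    using DERIV_mult[OF partial_DERIV(2)[OF assms(1,2,4), of u i] partial_DERIV(2)[OF assms(1,3,4), of u i]]
    by (intro DERIV_imp_deriv) (simp add: algebra_simps)
qed

lemma partial_base:
  fixes G :: "real \<times> real \<Rightarrow> real"
  assumes "G differentiable (at (x, u 0))"
  shows "partial_x (\<lambda>x u. G (x, u 0)) x u = frechet_derivative G (at (x, u 0)) (1, 0)"
    and "partial_u i (\<lambda>x u. G (x, u 0)) x u = (if i = 0 then frechet_derivative G (at (x, u 0)) (0, 1) else 0)"
proof -
  have "((\<lambda>t. t) has_real_derivative 1) (at r)" "((\<lambda>t. c) has_real_derivative 0) (at r)" for r c :: real
    by auto
  then have "((\<lambda>t. G (t, u 0)) has_real_derivative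
      1 * frechet_derivative G (at (x, u 0)) (1, 0) + 0 * frechet_derivative G (at (x, u 0)) (0, 1)) (at x)"
    and "((\<lambda>t. G (x, t)) has_real_derivative
      0 * frechet_derivative G (at (x, u 0)) (1, 0) + 1 * frechet_derivative G (at (x, u 0)) (0, 1)) (at (u 0))"
    using DERIV_compose_plane[where p = "\<lambda>t. t" and q = "\<lambda>t. u 0" and x = x and G = G]
     DERIV_compose_plane[where p = "\<lambda>t. x" and q = "\<lambda>t. t" and x = "u 0" and G = G] assms by blast+
  then show "partial_x (\<lambda>x u. G (x, u 0)) x u = frechet_derivative G (at (x, u 0)) (1, 0)"
    "partial_u i (\<lambda>x u. G (x, u 0)) x u = (if i = 0 then frechet_derivative G (at (x, u 0)) (0, 1) else 0)"
    by (auto simp: partial_x_def partial_u_def DERIV_imp_deriv)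
qed

lemma partial_coord:
  "partial_x (\<lambda>x u. u k) x u = 0" "partial_u i (\<lambda>x u. u k) x u = (if i = k then 1 else 0)"
  by (auto simp: partial_x_def partial_u_def)

lemma jet_polynomial_partial:
  assumes "open I" "jet_polynomial I m F"
  shows "jet_polynomial I m (partial_x F)" "jet_polynomial I m (partial_u i F)"
proof -
  have "jet_polynomial I m (partial_x F) \<and> jet_polynomial I m (partial_u i F)"
    using assms(2)
  proof (induction rule: jet_polynomial.induct)
    case (base G)
    have G: "G differentiable (at (x, r))" if "x \<in> I" for x r
      using smooth_on_imp_differentiable[OF base] that by simp
    have 1: "jet_polynomial I m (\<lambda>x u. frechet_derivative G (at (x, u 0)) v)" for v
      using jet_polynomial.base[OF smooth_on_frechet_derivative[OF base]] by simp
    have "jet_polynomial I m (\<lambda>x u. if i = 0 then frechet_derivative G (at (x, u 0)) (0, 1) else 0)"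
      using 1 jet_polynomial_const by (cases "i = 0") auto
    from jet_polynomial.cong[OF this] jet_polynomial.cong[OF 1[of "(1,0)"]] show ?case
      using partial_base[where G = G, OF G] by blast
  next
    case (coord k)
    show ?case unfolding partial_coord[abs_def] by (simp add: jet_polynomial_const)
  next
    case (add F G)
    note P = partial_add[OF assms(1) add.hyps]
    have "jet_polynomial I m (\<lambda>x u. partial_x F x u + partial_x G x u)"
      "jet_polynomial I m (\<lambda>x u. partial_u i F x u + partial_u i G x u)"
      using add.IH by (auto intro: jet_polynomial.add)
    from this[THEN jet_polynomial.cong] show ?case using P by blast
  next
    case (mult F G)
    note P = partial_mult[OF assms(1) mult.hyps]
    have "jet_polynomial I m (\<lambda>x u. partial_x F x u * G x u + F x u * partial_x G x u)"
      "jet_polynomial I m (\<lambda>x u. partial_u i F x u * G x u + F x u * partial_u i G x u)"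
      using mult.IH mult.hyps by (auto intro!: jet_polynomial.add jet_polynomial.mult)
    from this[THEN jet_polynomial.cong] show ?case using P by blast
  next
    case (cong F F')
    then have "jet_polynomial I m (partial_x F)" "jet_polynomial I m (partial_u i F)" by auto
    from this[THEN jet_polynomial.cong] show ?case
      using partial_cong[OF assms(1), of F' F] cong.hyps(2) by blast
  qed
  then show "jet_polynomial I m (partial_x F)" "jet_polynomial I m (partial_u i F)" by auto
qed

lemma jet_polynomial_total_deriv:
  assumes "open I" "jet_polynomial I m F"
  shows "jet_polynomial I (Suc m) (total_deriv m F)"
proof -
  have "jet_polynomial I (Suc m) (\<lambda>x u. partial_x F x u + (\<Sum>i\<le>m. u (Suc i) * partial_u i F x u))"
    using jet_polynomial_partial[OF assms] jet_polynomial_mono[of I m _ "Suc m"]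
    by (intro jet_polynomial.add jet_polynomial_sum jet_polynomial.mult jet_polynomial.coord) auto
  then show ?thesis unfolding total_deriv_def[abs_def] .
qed

lemma total_deriv_along_curve:
  assumes "open I" "jet_polynomial I m F" "open J" "J \<subseteq> I" "smooth_on J y" "x \<in> J"
  shows "((\<lambda>x. F x (jet y x)) has_real_derivative total_deriv m F x (jet y x)) (at x)"
  using assms(2)
proof (induction rule: jet_polynomial.induct)
  case (base G)
  have xI: "x \<in> I" using assms by auto
  have G: "G differentiable (at (x, r))" for r
    using smooth_on_imp_differentiable[OF base] xI by simp
  have "((\<lambda>t. G (t, y t)) has_real_derivative
      1 * frechet_derivative G (at (x, y x)) (1, 0) + deriv y x * frechet_derivative G (at (x, y x)) (0, 1)) (at x)"
    by (intro DERIV_compose_plane G smooth_on_DERIV[OF assms(5,6)]) auto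
  moreover have "total_deriv m (\<lambda>x u. G (x, u 0)) x (jet y x) =
     frechet_derivative G (at (x, y x)) (1, 0) +
     (\<Sum>i\<le>m. jet y x (Suc i) * (if i = 0 then frechet_derivative G (at (x, y x)) (0, 1) else 0))"
    unfolding total_deriv_def using partial_base[of G x "jet y x", OF G, unfolded jet_0] by simp
  moreover have "\<dots> = frechet_derivative G (at (x, y x)) (1, 0) + deriv y x * frechet_derivative G (at (x, y x)) (0, 1)"
    by (simp add: if_distrib cong: if_cong) (simp add: jet_def)
  ultimately show ?case by (simp add: jet_0)
next
  case (coord k)
  have "total_deriv m (\<lambda>x u. u k) x (jet y x) = (deriv ^^ Suc k) y x"
    unfolding total_deriv_def partial_coord using coord
    by (simp add: if_distrib cong: if_cong) (simp add: jet_def)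
  then show ?case
    using smooth_on_funpow_DERIV[OF assms(3,5,6), of k] by (simp add: jet_def[of y _ k])
next
  case (add F G)
  have xI: "x \<in> I" using assms by auto
  have "total_deriv m (\<lambda>x u. F x u + G x u) x (jet y x) =
    total_deriv m F x (jet y x) + total_deriv m G x (jet y x)"
    unfolding total_deriv_def partial_add[OF assms(1) add.hyps xI]
    by (simp add: algebra_simps sum.distrib)
  then show ?case using DERIV_add[OF add.IH] by simp
next
  case (mult F G)
  have xI: "x \<in> I" using assms by auto
  have "total_deriv m (\<lambda>x u. F x u * G x u) x (jet y x) =
    total_deriv m F x (jet y x) * G x (jet y x) + total_deriv m G x (jet y x) * F x (jet y x)"
    unfolding total_deriv_def partial_mult[OF assms(1) mult.hyps xI]
    by (simp add: algebra_simps sum.distrib sum_distrib_left)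
  then show ?case using DERIV_mult[OF mult.IH] by simp
next
  case (cong F F')
  have xI: "x \<in> I" using assms by auto
  have "total_deriv m F' x (jet y x) = total_deriv m F x (jet y x)"
    unfolding total_deriv_def using partial_cong[OF assms(1), of F' F x] cong.hyps(2) xI by simp
  moreover have "F x (jet y x) = F' x (jet y x)" if "x \<in> J" for x
    using cong.hyps(2) assms(4) that by auto
  ultimately show ?case
    using has_field_derivative_transform_within_open[OF cong.IH assms(3,6)] by simp
qed

text \<open>The characteristic \<open>\<eta> - \<xi> u\<^sub>1\<close> of the vector field, evaluated along a curve.\<close>

definition characteristic :: "vfield \<Rightarrow> (real \<Rightarrow> real) \<Rightarrow> real \<Rightarrow> real" where
  "characteristic X y x = snd (X (x, y x)) - fst (X (x, y x)) * deriv y x"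

lemma smooth_on_vfield_along:
  fixes G :: "real \<times> real \<Rightarrow> 'a::real_normed_vector"
  assumes "open I" "smooth_on (I \<times> UNIV) G" "open J" "J \<subseteq> I" "smooth_on J y"
  shows "smooth_on J (\<lambda>x. G (x, y x))"
  using assms by (intro smooth_on_compose[of J "I \<times> UNIV" G]) (auto intro!: open_Times smooth_intros)

lemma smooth_on_characteristic:
  assumes "open I" "smooth_on (I \<times> UNIV) X" "open J" "J \<subseteq> I" "smooth_on J y"
  shows "smooth_on J (characteristic X y)"
  unfolding characteristic_def[abs_def] using assms
  by (intro smooth_intros smooth_on_vfield_along[of I]) 

lemma jet_polynomial_xi:
  assumes "open I" "smooth_on (I \<times> UNIV) X"
  shows "jet_polynomial I 0 (xi X)"
proof -
  have "smooth_on (I \<times> UNIV) (\<lambda>p. fst (X p))" using assms by (intro smooth_intros open_Times) auto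
  from jet_polynomial.base[OF this] show ?thesis by (simp add: xi_def[abs_def])
qed

lemma jet_polynomial_eta:
  assumes "open I" "smooth_on (I \<times> UNIV) X"
  shows "jet_polynomial I k (eta X k)"
proof (induction k)
  case 0
  have "smooth_on (I \<times> UNIV) (\<lambda>p. snd (X p))" using assms by (intro smooth_intros open_Times) auto
  from jet_polynomial.base[OF this] show ?case by simp
next
  case (Suc k)
  have "jet_polynomial I (Suc k) (total_deriv 0 (xi X))"
    using jet_polynomial_mono[OF jet_polynomial_total_deriv[OF assms(1) jet_polynomial_xi[OF assms]]] by simp
  with jet_polynomial_total_deriv[OF assms(1) Suc] show ?case
    by (auto intro!: jet_polynomial_diff jet_polynomial.mult jet_polynomial.coord)
qed

text \<open>In the recursion for the prolongation the subtracted term is exactly what differentiating the last summand adds, so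
  that the characteristic alone is differentiated.\<close>

lemma eta_along_curve:
  assumes "open I" "smooth_on (I \<times> UNIV) X" "open J" "J \<subseteq> I" "smooth_on J y" "x \<in> J"
  shows "eta X k x (jet y x) =
    (deriv ^^ k) (characteristic X y) x + fst (X (x, y x)) * (deriv ^^ Suc k) y x"
  using assms(6)
proof (induction k arbitrary: x)
  case 0
  then show ?case by (simp add: characteristic_def jet_def)
next
  case (Suc k)
  let ?q = "characteristic X y" and ?f = "\<lambda>x. fst (X (x, y x))"
  have q: "((deriv ^^ k) ?q has_real_derivative (deriv ^^ Suc k) ?q x) (at x)"
    by (rule smooth_on_funpow_DERIV[OF assms(3) smooth_on_characteristic[OF assms(1-5)] Suc.prems])
  have xi: "(?f has_real_derivative total_deriv 0 (xi X) x (jet y x)) (at x)"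
    using total_deriv_along_curve[OF assms(1) jet_polynomial_xi[OF assms(1,2)] assms(3-5) Suc.prems]
    by (simp add: xi_def jet_def)
  have "((\<lambda>x. (deriv ^^ k) ?q x + ?f x * (deriv ^^ Suc k) y x) has_real_derivative
     (deriv ^^ Suc k) ?q x + (total_deriv 0 (xi X) x (jet y x) * (deriv ^^ Suc k) y x
       + (deriv ^^ Suc (Suc k)) y x * ?f x)) (at x)"
    by (intro DERIV_add DERIV_mult q xi smooth_on_funpow_DERIV[OF assms(3,5) Suc.prems])
  moreover have "((\<lambda>x. eta X k x (jet y x)) has_real_derivative total_deriv k (eta X k) x (jet y x)) (at x)"
    by (rule total_deriv_along_curve[OF assms(1) jet_polynomial_eta[OF assms(1,2)] assms(3-5) Suc.prems])
  from has_field_derivative_transform_within_open[OF this assms(3) Suc.prems Suc.IH]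
  have "((\<lambda>x. (deriv ^^ k) ?q x + ?f x * (deriv ^^ Suc k) y x) has_real_derivative
     total_deriv k (eta X k) x (jet y x)) (at x)" .
  ultimately have "total_deriv k (eta X k) x (jet y x) = (deriv ^^ Suc k) ?q x + (total_deriv 0 (xi X) x (jet y x) * (deriv ^^ Suc k) y x
       + (deriv ^^ Suc (Suc k)) y x * ?f x)"
    by (rule DERIV_unique[symmetric])
  then show ?case by (simp add: jet_def[of y x "Suc k"] algebra_simps)
qed

lemma linear_op_eq: "linear_op n c y x = (deriv ^^ n) y x + (\<Sum>j<n. c j x * (deriv ^^ j) y x)"
  by (simp add: linear_op_def linear_ode_def)

lemma linear_ode_jet: "linear_ode n c x (jet y x) = linear_op n c y x"
  by (simp add: linear_op_eq linear_ode_def jet_def)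

lemma smooth_on_linear_op [smooth_intros]:
  "open J \<Longrightarrow> smooth_on J y \<Longrightarrow> (\<And>j. j < n \<Longrightarrow> smooth_on J (c j)) \<Longrightarrow> smooth_on J (linear_op n c y)"
  unfolding linear_op_eq[abs_def] by (intro smooth_intros) auto

lemma deriv_linear_op:
  assumes "open J" "smooth_on J y" "\<And>j. j < n \<Longrightarrow> smooth_on J (c j)" "x \<in> J"
  shows "deriv (linear_op n c y) x = (deriv ^^ Suc n) y x +
     (\<Sum>j<n. deriv (c j) x * (deriv ^^ j) y x + c j x * (deriv ^^ Suc j) y x)"
proof (rule DERIV_imp_deriv)
  have "((\<lambda>x. c j x * (deriv ^^ j) y x) has_real_derivative
     deriv (c j) x * (deriv ^^ j) y x + c j x * (deriv ^^ Suc j) y x) (at x)" if "j < n" for j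
    using DERIV_mult[OF smooth_on_DERIV[OF assms(3)[OF that] assms(4)] smooth_on_funpow_DERIV[OF assms(1,2,4), of j]]
    by (simp add: mult.commute)
  then show "(linear_op n c y has_real_derivative (deriv ^^ Suc n) y x +
     (\<Sum>j<n. deriv (c j) x * (deriv ^^ j) y x + c j x * (deriv ^^ Suc j) y x)) (at x)"
    unfolding linear_op_eq[abs_def]
    by (intro DERIV_add DERIV_sum smooth_on_funpow_DERIV[OF assms(1,2,4)]) auto
qed

lemma linear_op_cong:
  assumes "open S" "\<And>x. x \<in> S \<Longrightarrow> y x = z x" "x \<in> S"
  shows "linear_op n c y x = linear_op n c z x"
  unfolding linear_op_eq using funpow_deriv_cong[OF assms] by simp

lemma linear_op_diff:
  assumes "open S" "smooth_on S y" "smooth_on S z" "x \<in> S"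
  shows "linear_op n c (\<lambda>x. y x - z x) x = linear_op n c y x - linear_op n c z x"
  unfolding linear_op_eq funpow_deriv_diff[OF assms] by (simp add: algebra_simps sum_subtractf)

lemma linear_op_add:
  assumes "open S" "smooth_on S y" "smooth_on S z" "x \<in> S"
  shows "linear_op n c (\<lambda>x. y x + z x) x = linear_op n c y x + linear_op n c z x"
  unfolding linear_op_eq funpow_deriv_add[OF assms] by (simp add: algebra_simps sum.distrib)

lemma linear_op_cmult:
  assumes "open S" "smooth_on S y" "x \<in> S"
  shows "linear_op n c (\<lambda>x. a * y x) x = a * linear_op n c y x"
  unfolding linear_op_eq funpow_deriv_cmult[OF assms] by (simp add: algebra_simps sum_distrib_left)

lemma partial_linear_ode:
  assumes "\<And>j. j < n \<Longrightarrow> (c j) differentiable (at x)"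
  shows "partial_x (linear_ode n c) x u = (\<Sum>j<n. deriv (c j) x * u j)"
    and "j < n \<Longrightarrow> partial_u j (linear_ode n c) x u = c j x"
    and "partial_u n (linear_ode n c) x u = 1"
proof -
  have D: "(c j has_real_derivative deriv (c j) x) (at x)" if "j < n" for j
    using assms[OF that] by (simp add: DERIV_deriv_iff_real_differentiable)
  have "((\<lambda>t. linear_ode n c t u) has_real_derivative 0 + (\<Sum>j<n. deriv (c j) x * u j)) (at x)"
    unfolding linear_ode_def by (intro DERIV_add DERIV_const DERIV_sum DERIV_cmult_right D) auto
  then show "partial_x (linear_ode n c) x u = (\<Sum>j<n. deriv (c j) x * u j)"
    by (simp add: partial_x_def DERIV_imp_deriv)
  have U: "((\<lambda>t. (u(j := t)) k) has_real_derivative (if k = j then 1 else 0)) (at (u j))" for j k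
    by (cases "k = j") auto
  have "((\<lambda>t. linear_ode n c x (u(j := t))) has_real_derivative
    (if n = j then 1 else 0) + (\<Sum>k<n. c k x * (if k = j then 1 else 0))) (at (u j))" for j
    unfolding linear_ode_def by (intro DERIV_add DERIV_sum DERIV_cmult U)
  then have P: "partial_u j (linear_ode n c) x u = (if n = j then 1 else 0) + (\<Sum>k<n. c k x * (if k = j then 1 else 0))" for j
    by (simp only: partial_u_def DERIV_imp_deriv)
  show "j < n \<Longrightarrow> partial_u j (linear_ode n c) x u = c j x" "partial_u n (linear_ode n c) x u = 1"
    unfolding P by (auto simp: if_distrib cong: if_cong)
qed

lemma prolongation_along_curve:
  assumes "open I" "smooth_on (I \<times> UNIV) X" "open J" "J \<subseteq> I" "smooth_on J y" "x \<in> J"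
    and c: "\<And>j. j < n \<Longrightarrow> smooth_on I (c j)"
  shows "prolongation n X (linear_ode n c) x (jet y x) =
    linear_op n c (characteristic X y) x + fst (X (x, y x)) * deriv (linear_op n c y) x"
proof -
  let ?q = "characteristic X y" and ?f = "fst (X (x, y x))"
  have cd: "c j differentiable (at x)" if "j < n" for j
    using smooth_on_imp_differentiable[OF c[OF that]] assms by auto
  have "prolongation n X (linear_ode n c) x (jet y x) =
    ?f * (\<Sum>j<n. deriv (c j) x * jet y x j) + (\<Sum>j<n. eta X j x (jet y x) * c j x) + eta X n x (jet y x)"
    unfolding prolongation_def using partial_linear_ode[OF cd]
    by (simp add: lessThan_Suc_atMost[symmetric] xi_def jet_def)
  also have "\<dots> = linear_op n c ?q x + ?f * ((deriv ^^ Suc n) y x +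
     (\<Sum>j<n. deriv (c j) x * (deriv ^^ j) y x + c j x * (deriv ^^ Suc j) y x))"
    unfolding eta_along_curve[OF assms(1-6)] linear_op_eq
    by (simp add: jet_def algebra_simps sum.distrib sum_distrib_left del: funpow.simps)
  also have "\<dots> = linear_op n c ?q x + ?f * deriv (linear_op n c y) x"
    using deriv_linear_op[OF assms(3,5) smooth_on_subset[OF c assms(4)] assms(6)] by simp
  finally show ?thesis .
qed

lemma prolongation_order:
  assumes "open I" "smooth_on (I \<times> UNIV) X" "x \<in> I"
    and c: "\<And>j. j < n \<Longrightarrow> smooth_on I (c j)" and uv: "\<And>k. k \<le> n \<Longrightarrow> u k = v k"
  shows "prolongation n X (linear_ode n c) x u = prolongation n X (linear_ode n c) x v"
proof -
  have cd: "c j differentiable (at x)" if "j < n" for j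
    using smooth_on_imp_differentiable[OF c[OF that]] assms by auto
  have "eta X j x u = eta X j x v" if "j \<le> n" for j
    using jet_polynomial_order[OF jet_polynomial_eta[OF assms(1,2)] assms(3)] uv that by (meson le_trans)
  then show ?thesis
    unfolding prolongation_def using partial_linear_ode[OF cd] uv[of 0] uv
    by (simp add: lessThan_Suc_atMost[symmetric] xi_def)
qed

text \<open>The prolongation formula is a statement about jets; every jet is the jet of a curve, and along a
  curve \<open>y\<close> the recursion for the prolongation says that the characteristic \<open>\<eta> - \<xi> y'\<close> is differentiated.
  So being a symmetry means that the characteristic solves the equation up to a multiple of the derivative
  of the equation.\<close>

lemma symmetry_iff_characteristic:
  assumes "open I" and c: "\<And>j. j < n \<Longrightarrow> smooth_on I (c j)"
  shows "X \<in> symmetry_algebra n I (linear_ode n c) \<longleftrightarrow>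
    smooth_on (I \<times> UNIV) X \<and> (\<forall>p. p \<notin> I \<times> UNIV \<longrightarrow> X p = 0) \<and>
    (\<forall>x\<in>I. \<forall>y. smooth_on I y \<longrightarrow> linear_op n c y x = 0 \<longrightarrow>
       linear_op n c (characteristic X y) x + fst (X (x, y x)) * deriv (linear_op n c y) x = 0)"
proof (cases "smooth_on (I \<times> UNIV) X")
  case X: True
  have "prolongation n X (linear_ode n c) x u = 0"
    if "x \<in> I" "linear_ode n c x u = 0" and *: "\<And>y. smooth_on I y \<Longrightarrow> linear_op n c y x = 0 \<Longrightarrow>
       linear_op n c (characteristic X y) x + fst (X (x, y x)) * deriv (linear_op n c y) x = 0" for x u
  proof -
    let ?y = "taylor_poly x u n"
    have j: "jet ?y x k = u k" if "k \<le> n" for k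
      using that by (simp add: jet_def funpow_deriv_taylor_poly)
    have "linear_op n c ?y x = 0"
      using that(2) j unfolding linear_ode_jet[symmetric] linear_ode_def by simp
    with *[of ?y] prolongation_along_curve[OF assms(1) X assms(1) _ _ that(1) c, of ?y n]
    have "prolongation n X (linear_ode n c) x (jet ?y x) = 0"
      by (simp add: smooth_on_taylor_poly assms(1))
    moreover have "prolongation n X (linear_ode n c) x u = prolongation n X (linear_ode n c) x (jet ?y x)"
      by (rule prolongation_order[OF assms(1) X that(1) c]) (simp_all add: j)
    ultimately show ?thesis by simp
  qed
  moreover have "linear_op n c (characteristic X y) x + fst (X (x, y x)) * deriv (linear_op n c y) x = 0"
    if "x \<in> I" "smooth_on I y" "linear_op n c y x = 0"
       "\<And>u. linear_ode n c x u = 0 \<Longrightarrow> prolongation n X (linear_ode n c) x u = 0" for x y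
    using that(3) that(4)[of "jet y x"] prolongation_along_curve[OF assms(1) X assms(1) order_refl that(2,1) c, of n]
    by (simp add: linear_ode_jet)
  ultimately show ?thesis unfolding symmetry_algebra_def using X by blast
qed (simp add: symmetry_algebra_def)

section \<open>Symmetries are affine in the dependent variable\<close>

text \<open>This and its converse replace Taylor's formula: the jet of a smooth function can be read off from its order of
  vanishing, without differentiating composite functions repeatedly.\<close>

lemma tendsto_divide_power:
  fixes f :: "real \<Rightarrow> real"
  assumes "open S" "x0 \<in> S" "smooth_on S f" "\<And>j. j < n \<Longrightarrow> (deriv ^^ j) f x0 = 0"
  shows "((\<lambda>x. f x / (x - x0) ^ n) \<longlongrightarrow> (deriv ^^ n) f x0 / fact n) (at x0)"
  using assms(3,4)
proof (induction n arbitrary: f)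
  case 0
  have "isCont f x0" using smooth_on_DERIV[OF 0(1) assms(2)] by (rule DERIV_isCont)
  then show ?case by (simp add: isCont_def)
next
  case (Suc n)
  have "(deriv ^^ j) (deriv f) x0 = 0" if "j < n" for j
    using Suc.prems(2)[of "Suc j"] that by (simp only: funpow_deriv_Suc_deriv Suc_less_eq)
  then have IH: "((\<lambda>x. deriv f x / (x - x0) ^ n) \<longlongrightarrow> (deriv ^^ Suc n) f x0 / fact n) (at x0)"
    using Suc.IH[OF smooth_on_deriv[OF assms(1) Suc.prems(1)]] by (simp only: funpow_deriv_Suc_deriv)
  have 0: "f x0 = 0" using Suc.prems(2)[of 0] by simp
  have "isCont f x0" using smooth_on_DERIV[OF Suc.prems(1) assms(2)] by (rule DERIV_isCont)
  with 0 have f0: "(f \<longlongrightarrow> 0) (at x0)" by (simp add: isCont_def)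
  have g0: "((\<lambda>x. (x - x0) ^ Suc n) \<longlongrightarrow> 0) (at x0)"
    by (rule tendsto_eq_intros refl | simp)+
  have ne: "\<forall>\<^sub>F x in at x0. x \<noteq> x0" by (simp add: eventually_at_filter)
  have S: "\<forall>\<^sub>F x in at x0. x \<in> S" using eventually_at_topological assms(1,2) by blast
  have "((\<lambda>x. f x / (x - x0) ^ Suc n) \<longlongrightarrow> (deriv ^^ Suc n) f x0 / fact n / real (Suc n)) (at x0)"
  proof (rule lhopital[OF f0 g0])
    show "\<forall>\<^sub>F x in at x0. (x - x0) ^ Suc n \<noteq> 0" using ne by eventually_elim simp
    show "\<forall>\<^sub>F x in at x0. real (Suc n) * (x - x0) ^ n \<noteq> 0" using ne by eventually_elim simp
    show "\<forall>\<^sub>F x in at x0. DERIV f x :> deriv f x"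
      using S by eventually_elim (rule smooth_on_DERIV[OF Suc.prems(1)])
    have "((\<lambda>x. (x - x0) ^ Suc n) has_real_derivative real (Suc n) * (x - x0) ^ n) (at x)" for x
    proof -
      have "((\<lambda>x. x - x0) has_real_derivative 1) (at x)" by (auto intro!: derivative_eq_intros)
      from DERIV_power_Suc[OF this, of n] show ?thesis by simp
    qed
    then show "\<forall>\<^sub>F x in at x0. DERIV (\<lambda>x. (x - x0) ^ Suc n) x :> real (Suc n) * (x - x0) ^ n"
      by simp
    from tendsto_divide[OF IH tendsto_const[of "real (Suc n)"]]
    show "((\<lambda>x. deriv f x / (real (Suc n) * (x - x0) ^ n)) \<longlongrightarrow> (deriv ^^ Suc n) f x0 / fact n / real (Suc n)) (at x0)"
      by (simp add: mult.commute)
  qed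
  then show ?case by (simp add: mult.commute)
qed

lemma funpow_deriv_if_tendsto:
  fixes f :: "real \<Rightarrow> real"
  assumes "open S" "x0 \<in> S" "smooth_on S f" "((\<lambda>x. f x / (x - x0) ^ n) \<longlongrightarrow> C) (at x0)"
  shows "j < n \<Longrightarrow> (deriv ^^ j) f x0 = 0" and "(deriv ^^ n) f x0 = fact n * C"
proof -
  have *: "(deriv ^^ j) f x0 = 0" if "j < n" for j
    using that
  proof (induction j rule: less_induct)
    case (less j)
    then have "((\<lambda>x. f x / (x - x0) ^ j) \<longlongrightarrow> (deriv ^^ j) f x0 / fact j) (at x0)"
      by (intro tendsto_divide_power[OF assms(1-3)]) auto
    moreover have "((\<lambda>x. f x / (x - x0) ^ n * (x - x0) ^ (n - j)) \<longlongrightarrow> C * 0 ^ (n - j)) (at x0)"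
      by (intro tendsto_mult assms(4) tendsto_power) (rule tendsto_eq_intros refl | simp)+
    then have "((\<lambda>x. f x / (x - x0) ^ j) \<longlongrightarrow> C * 0 ^ (n - j)) (at x0)"
    proof (rule Lim_transform_eventually)
      have "f x / (x - x0) ^ n * (x - x0) ^ (n - j) = f x / (x - x0) ^ j" if "x \<noteq> x0" for x
        using less.prems that power_diff[of "x - x0" j n] by (simp add: divide_simps)
      then show "\<forall>\<^sub>F x in at x0. f x / (x - x0) ^ n * (x - x0) ^ (n - j) = f x / (x - x0) ^ j"
        by (simp add: eventually_at_filter)
    qed
    ultimately have "(deriv ^^ j) f x0 / fact j = C * 0 ^ (n - j)"
      by (intro tendsto_unique[of "at x0"]) auto
    moreover have "(0::real) ^ (n - j) = 0" using less.prems by (simp add: power_0_left)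
    ultimately show ?case by simp
  qed
  then show "j < n \<Longrightarrow> (deriv ^^ j) f x0 = 0" .
  have "(deriv ^^ n) f x0 / fact n = C"
    using tendsto_divide_power[OF assms(1-3) *] assms(4) by (intro tendsto_unique[of "at x0"]) auto
  then show "(deriv ^^ n) f x0 = fact n * C" by (simp add: field_simps)
qed

definition partial_y :: "(real \<times> real \<Rightarrow> real) \<Rightarrow> real \<times> real \<Rightarrow> real" where
  "partial_y G p = frechet_derivative G (at p) (0, 1)"

lemma smooth_on_partial_y: "smooth_on S G \<Longrightarrow> smooth_on S (partial_y G)"
  unfolding partial_y_def[abs_def] by (rule smooth_on_frechet_derivative)

lemma DERIV_partial_y:
  assumes "smooth_on (I \<times> UNIV) G" "x \<in> I"
  shows "((\<lambda>t. G (x, t)) has_real_derivative partial_y G (x, t)) (at t)"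
  using DERIV_compose_plane[of G "\<lambda>t. x" t "\<lambda>t. t" 0 1] smooth_on_imp_differentiable[OF assms(1)] assms(2)
  by (simp add: partial_y_def)

lemma mean_value:
  fixes f :: "real \<Rightarrow> real"
  assumes "\<And>t. (f has_real_derivative f' t) (at t)"
  obtains s where "\<bar>s - t\<bar> \<le> \<bar>r\<bar>" "f (t + r) - f t = r * f' s"
proof -
  consider "r = 0" | "r > 0" | "r < 0" by linarith
  then show ?thesis
  proof cases
    case 2
    then obtain z where "t < z" "z < t + r" "f (t + r) - f t = (t + r - t) * f' z"
      using MVT2[of t "t + r" f f'] assms by auto
    then show ?thesis using that[of z] by auto
  next
    case 3
    then obtain z where "t + r < z" "z < t" "f t - f (t + r) = (t - (t + r)) * f' z"
      using MVT2[of "t + r" t f f'] assms by auto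
    then show ?thesis using that[of z] by auto
  qed (use that[of t] in auto)
qed

text \<open>Mean value theorem for a mixed second difference. It is what makes second differences of \<open>\<eta>\<close> small when the
  product of the two increments is.\<close>

lemma second_mean_value:
  assumes "smooth_on (I \<times> UNIV) G" "x \<in> I"
  obtains s where "\<bar>s - y\<bar> \<le> \<bar>p\<bar> + \<bar>q\<bar>"
    "G (x, y + p + q) - G (x, y + p) - G (x, y + q) + G (x, y) = p * q * partial_y (partial_y G) (x, s)"
proof -
  note D = DERIV_partial_y[OF assms]
  have "((\<lambda>t. G (x, p + t) - G (x, t)) has_real_derivative partial_y G (x, p + t) - partial_y G (x, t)) (at t)" for t
    using DERIV_shift[of "\<lambda>t. G (x, t)" "partial_y G (x, p + t)" t p] D[of "p + t"]
    by (intro DERIV_diff D) (simp add: add.commute)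
  from mean_value[of "\<lambda>t. G (x, p + t) - G (x, t)" "\<lambda>t. partial_y G (x, p + t) - partial_y G (x, t)" y q, OF this]
  obtain r where r: "\<bar>r - y\<bar> \<le> \<bar>q\<bar>"
    "(G (x, p + (y + q)) - G (x, y + q)) - (G (x, p + y) - G (x, y)) = q * (partial_y G (x, p + r) - partial_y G (x, r))"
    by blast
  from mean_value[of "\<lambda>t. partial_y G (x, t)" "\<lambda>t. partial_y (partial_y G) (x, t)" r p]
    DERIV_partial_y[OF smooth_on_partial_y[OF assms(1)] assms(2)]
  obtain s where s: "\<bar>s - r\<bar> \<le> \<bar>p\<bar>" "partial_y G (x, r + p) - partial_y G (x, r) = p * partial_y (partial_y G) (x, s)"
    by blast
  show ?thesis
  proof (rule that[of s])
    show "\<bar>s - y\<bar> \<le> \<bar>p\<bar> + \<bar>q\<bar>" using r(1) s(1) by linarith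
    have "partial_y G (x, p + r) - partial_y G (x, r) = p * partial_y (partial_y G) (x, s)"
      using s(2) by (simp add: add.commute)
    with r(2) show "G (x, y + p + q) - G (x, y + p) - G (x, y + q) + G (x, y) = p * q * partial_y (partial_y G) (x, s)"
      by (simp add: algebra_simps)
  qed
qed

lemma tendsto_plane:
  fixes G :: "real \<times> real \<Rightarrow> real"
  assumes "open I" "smooth_on (I \<times> UNIV) G" "x0 \<in> I" "(s \<longlongrightarrow> y0) (at x0)"
  shows "((\<lambda>x. G (x, s x)) \<longlongrightarrow> G (x0, y0)) (at x0)"
proof -
  have "isCont G (x0, y0)"
    using smooth_on_imp_continuous_on[OF assms(2)] assms(1,3)
    by (simp add: continuous_on_eq_continuous_at open_Times)
  moreover have "((\<lambda>x. (x, s x)) \<longlongrightarrow> (x0, y0)) (at x0)" using assms(4) by (intro tendsto_Pair tendsto_ident_at)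
  ultimately show ?thesis by (rule isCont_tendsto_compose)
qed

lemma tendsto_first_difference:
  assumes "open I" "smooth_on (I \<times> UNIV) G" "x0 \<in> I"
    and "(y \<longlongrightarrow> y0) (at x0)" "(p \<longlongrightarrow> 0) (at x0)"
    and "((\<lambda>x. p x * m x) \<longlongrightarrow> M) (at x0)"
  shows "((\<lambda>x. (G (x, y x + p x) - G (x, y x)) * m x) \<longlongrightarrow> partial_y G (x0, y0) * M) (at x0)"
proof -
  have "\<exists>s. x \<in> I \<longrightarrow> \<bar>s - y x\<bar> \<le> \<bar>p x\<bar> \<and> G (x, y x + p x) - G (x, y x) = p x * partial_y G (x, s)" for x
    using mean_value[of "\<lambda>t. G (x, t)" "\<lambda>t. partial_y G (x, t)" "y x" "p x"] DERIV_partial_y[OF assms(2)] by metis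
  then obtain s where s: "x \<in> I \<Longrightarrow> \<bar>s x - y x\<bar> \<le> \<bar>p x\<bar> \<and> G (x, y x + p x) - G (x, y x) = p x * partial_y G (x, s x)" for x
    by metis
  have I: "\<forall>\<^sub>F x in at x0. x \<in> I" using eventually_at_topological assms(1,3) by blast
  have "((\<lambda>x. s x - y x) \<longlongrightarrow> 0) (at x0)"
    by (rule Lim_null_comparison[OF eventually_mono[OF I] tendsto_rabs_zero[OF assms(5)]]) (use s in auto)
  from tendsto_add[OF this assms(4)] have "(s \<longlongrightarrow> y0) (at x0)" by simp
  from tendsto_mult[OF tendsto_plane[OF assms(1) smooth_on_partial_y[OF assms(2)] assms(3) this] assms(6)]
  show ?thesis
    by (rule Lim_transform_eventually) (use I in \<open>eventually_elim, simp add: s mult_ac\<close>)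
qed

lemma tendsto_second_difference:
  assumes "open I" "smooth_on (I \<times> UNIV) G" "x0 \<in> I"
    and "(y \<longlongrightarrow> y0) (at x0)" "(p \<longlongrightarrow> 0) (at x0)" "(q \<longlongrightarrow> 0) (at x0)"
    and "((\<lambda>x. p x * q x * m x) \<longlongrightarrow> M) (at x0)"
  shows "((\<lambda>x. (G (x, y x + p x + q x) - G (x, y x + p x) - G (x, y x + q x) + G (x, y x)) * m x)
    \<longlongrightarrow> partial_y (partial_y G) (x0, y0) * M) (at x0)"
proof -
  let ?d = "\<lambda>x. G (x, y x + p x + q x) - G (x, y x + p x) - G (x, y x + q x) + G (x, y x)"
  have "\<exists>s. x \<in> I \<longrightarrow> \<bar>s - y x\<bar> \<le> \<bar>p x\<bar> + \<bar>q x\<bar> \<and> ?d x = p x * q x * partial_y (partial_y G) (x, s)" for x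
    using second_mean_value[OF assms(2), of x "y x" "p x" "q x"] by metis
  then obtain s where s: "x \<in> I \<Longrightarrow> \<bar>s x - y x\<bar> \<le> \<bar>p x\<bar> + \<bar>q x\<bar> \<and> ?d x = p x * q x * partial_y (partial_y G) (x, s x)" for x
    by metis
  have I: "\<forall>\<^sub>F x in at x0. x \<in> I" using eventually_at_topological assms(1,3) by blast
  have "((\<lambda>x. \<bar>p x\<bar> + \<bar>q x\<bar>) \<longlongrightarrow> 0) (at x0)"
    using tendsto_add[OF tendsto_rabs_zero[OF assms(5)] tendsto_rabs_zero[OF assms(6)]] by simp
  from Lim_null_comparison[OF eventually_mono[OF I] this, of "\<lambda>x. s x - y x"]
  have "((\<lambda>x. s x - y x) \<longlongrightarrow> 0) (at x0)" using s by auto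
  from tendsto_add[OF this assms(4)] have "(s \<longlongrightarrow> y0) (at x0)" by simp
  from tendsto_mult[OF tendsto_plane[OF assms(1) smooth_on_partial_y[OF smooth_on_partial_y[OF assms(2)]] assms(3) this] assms(7)]
  show ?thesis
    by (rule Lim_transform_eventually) (use I in \<open>eventually_elim, simp add: s mult_ac\<close>)
qed

text \<open>Polynomials that satisfy the equation at the single point \<open>x0\<close> and whose \<open>(n - 1)\<close>-jets
  there form the standard basis.\<close>

definition jet_basis :: "nat \<Rightarrow> (nat \<Rightarrow> real \<Rightarrow> real) \<Rightarrow> real \<Rightarrow> nat \<Rightarrow> real \<Rightarrow> real" where
  "jet_basis n c x0 k x = hpow x0 k x - c k x0 * hpow x0 n x"

lemma smooth_on_jet_basis [smooth_intros]: "open S \<Longrightarrow> smooth_on S (jet_basis n c x0 k)"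
  unfolding jet_basis_def[abs_def] by (intro smooth_intros)

lemma funpow_deriv_jet_basis:
  "(deriv ^^ j) (jet_basis n c x0 k) x0 = (if j = k then 1 else 0) - (if j = n then c k x0 else 0)"
proof -
  have "(deriv ^^ j) (\<lambda>x. c k x0 * hpow x0 n x) x0 = c k x0 * (if j = n then 1 else 0)"
    by (subst funpow_deriv_cmult[where S = UNIV]) (auto intro: smooth_intros)
  then show ?thesis unfolding jet_basis_def[abs_def]
    by (subst funpow_deriv_diff[where S = UNIV]) (auto intro!: smooth_intros)
qed

lemma linear_op_jet_basis: "k < n \<Longrightarrow> linear_op n c (jet_basis n c x0 k) x0 = 0"
proof -
  assume "k < n"
  have "(\<Sum>j<n. c j x0 * ((if j = k then 1 else 0) - (if j = n then c k x0 else 0))) = (\<Sum>j<n. if j = k then c k x0 else 0)"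
    by (rule sum.cong) auto
  then show ?thesis unfolding linear_op_eq funpow_deriv_jet_basis using \<open>k < n\<close> by simp
qed

lemma tendsto_jet_basis:
  assumes "k < n"
  shows "((\<lambda>x. jet_basis n c x0 k x / (x - x0) ^ k) \<longlongrightarrow> 1 / fact k) (at x0)"
    and "k > 0 \<Longrightarrow> ((\<lambda>x. deriv (jet_basis n c x0 k) x / (x - x0) ^ (k - 1)) \<longlongrightarrow> 1 / fact (k - 1)) (at x0)"
    and "k > 0 \<Longrightarrow> (jet_basis n c x0 k \<longlongrightarrow> 0) (at x0)"
proof -
  let ?p = "jet_basis n c x0 k"
  have s: "smooth_on UNIV ?p" by (intro smooth_intros) simp
  have *: "(deriv ^^ j) ?p x0 = (if j = k then 1 else 0)" if "j < n" for j
    using that by (simp add: funpow_deriv_jet_basis)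
  show "((\<lambda>x. ?p x / (x - x0) ^ k) \<longlongrightarrow> 1 / fact k) (at x0)"
    using tendsto_divide_power[OF open_UNIV UNIV_I s, of k x0] * assms by simp
  assume "k > 0"
  have "(deriv ^^ j) (deriv ?p) x0 = 0" if "j < k - 1" for j
    using *[of "Suc j"] that assms by (simp add: funpow_deriv_Suc_deriv del: funpow.simps)
  moreover have "(deriv ^^ (k - 1)) (deriv ?p) x0 = 1"
    using *[of k] \<open>k > 0\<close> assms by (simp add: funpow_deriv_Suc_deriv del: funpow.simps)
  ultimately show "((\<lambda>x. deriv ?p x / (x - x0) ^ (k - 1)) \<longlongrightarrow> 1 / fact (k - 1)) (at x0)"
    using tendsto_divide_power[OF open_UNIV UNIV_I smooth_on_deriv[OF open_UNIV s], of "k - 1" x0] by simp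
  have "isCont ?p x0" using smooth_on_DERIV[OF s UNIV_I] by (rule DERIV_isCont)
  moreover have "?p x0 = 0" using *[of 0] \<open>k > 0\<close> assms by simp
  ultimately show "(?p \<longlongrightarrow> 0) (at x0)" by (simp add: isCont_def)
qed

definition second_difference :: "vfield \<Rightarrow> (real \<Rightarrow> real) \<Rightarrow> (real \<Rightarrow> real) \<Rightarrow> (real \<Rightarrow> real) \<Rightarrow> real \<Rightarrow> real" where
  "second_difference X y p q x = characteristic X (\<lambda>x. y x + p x + q x) x - characteristic X (\<lambda>x. y x + p x) x
     - characteristic X (\<lambda>x. y x + q x) x + characteristic X y x"

text \<open>Four curves through the same point that all satisfy the equation there: in the alternating sum of the
  symmetry conditions the coefficient \<open>\<xi>\<close> is common, and the derivatives of the equation cancel by linearity.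
  Therefore the second difference of the characteristic cannot vanish to order exactly \<open>n\<close>.\<close>

lemma second_difference_limit:
  assumes "open I" and c: "\<And>j. j < n \<Longrightarrow> smooth_on I (c j)" and X: "X \<in> symmetry_algebra n I (linear_ode n c)"
    and "x0 \<in> I" "smooth_on I y" "smooth_on I p" "smooth_on I q"
    and "linear_op n c y x0 = 0" "linear_op n c p x0 = 0" "linear_op n c q x0 = 0" "p x0 = 0" "q x0 = 0"
    and lim: "((\<lambda>x. second_difference X y p q x / (x - x0) ^ n) \<longlongrightarrow> C) (at x0)"
  shows "C = 0"
proof -
  have Xs: "smooth_on (I \<times> UNIV) X" using X by (simp add: symmetry_algebra_def)
  let ?Q = "characteristic X"
  note add = linear_op_add[OF assms(1) _ _ assms(4)] smooth_on_add[OF assms(1)]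
  have sym: "linear_op n c (?Q z) x0 = - (fst (X (x0, y x0)) * deriv (linear_op n c z) x0)"
    if "smooth_on I z" "linear_op n c z x0 = 0" "z x0 = y x0" for z
    using X that assms(4) symmetry_iff_characteristic[where n = n and c = c, OF assms(1) c] by fastforce
  have d: "deriv (linear_op n c (\<lambda>x. z x + w x)) x0 = deriv (linear_op n c z) x0 + deriv (linear_op n c w) x0"
    if "smooth_on I z" "smooth_on I w" for z w
    using that c assms(1,4)
    by (simp add: deriv_linear_op[OF assms(1)] smooth_on_add funpow_deriv_add[OF assms(1)] algebra_simps sum.distrib
        del: funpow.simps)
  have "smooth_on I (?Q z)" if "smooth_on I z" for z
    using smooth_on_characteristic[OF assms(1) Xs assms(1) order_refl that] .
  note Q = this[OF assms(5)] this[OF smooth_on_add[OF assms(1,5,6)]] this[OF smooth_on_add[OF assms(1,5,7)]]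
    this[OF smooth_on_add[OF assms(1) smooth_on_add[OF assms(1,5,6)] assms(7)]]
  have sm: "smooth_on I (second_difference X y p q)"
    unfolding second_difference_def[abs_def] using Q assms(1) by (intro smooth_intros)
  have "linear_op n c (second_difference X y p q) x0 =
     linear_op n c (?Q (\<lambda>x. y x + p x + q x)) x0 - linear_op n c (?Q (\<lambda>x. y x + p x)) x0
     - linear_op n c (?Q (\<lambda>x. y x + q x)) x0 + linear_op n c (?Q y) x0"
    unfolding second_difference_def[abs_def] using Q assms(1,4)
    by (simp add: linear_op_add[OF assms(1)] linear_op_diff[OF assms(1)] smooth_intros)
  also have "\<dots> = 0"
    using assms by (simp add: sym add d algebra_simps)
  finally have "linear_op n c (second_difference X y p q) x0 = 0" .
  with funpow_deriv_if_tendsto[OF assms(1,4) sm lim] show "C = 0"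
    by (simp add: linear_op_eq)
qed

text \<open>Increments \<open>p\<close> and \<open>q\<close> vanishing to orders \<open>2\<close> and \<open>n - 1\<close> are used, and it matters that \<open>2 \<le> n - 1\<close>. Their product
  vanishes to order \<open>n + 1\<close>, so that second differences of \<open>\<xi>\<close> and \<open>\<eta>\<close> are negligible; the second difference of \<open>\<xi> y'\<close>,
  however, contains \<open>(p q)'\<close> times the derivative of \<open>\<xi>\<close> by \<open>y\<close>, of order exactly \<open>n\<close> unless that derivative vanishes.\<close>

theorem symmetry_xi_independent:
  assumes "n \<ge> 3" "open I" and c: "\<And>j. j < n \<Longrightarrow> smooth_on I (c j)"
    and X: "X \<in> symmetry_algebra n I (linear_ode n c)" and x0: "x0 \<in> I"
  shows "partial_y (\<lambda>p. fst (X p)) (x0, y0) = 0"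
proof -
  let ?xi = "\<lambda>p. fst (X p)" and ?eta = "\<lambda>p. snd (X p)"
  have Xs: "smooth_on (I \<times> UNIV) X" using X by (simp add: symmetry_algebra_def)
  have XI: "smooth_on (I \<times> UNIV) ?xi" "smooth_on (I \<times> UNIV) ?eta"
    using Xs assms(2) by (auto intro!: smooth_intros open_Times)
  define y where "y = (\<lambda>x. y0 * jet_basis n c x0 0 x)"
  define p where "p = jet_basis n c x0 2"
  define q where "q = jet_basis n c x0 (n - 1)"
  have ys: "smooth_on UNIV y" unfolding y_def by (intro smooth_intros) auto
  have ps: "smooth_on UNIV p" and qs: "smooth_on UNIV q" unfolding p_def q_def by (auto intro: smooth_intros)
  have yx0: "y x0 = y0" using assms(1) by (simp add: y_def jet_basis_def)
  have y: "(y \<longlongrightarrow> y0) (at x0)" "(deriv y \<longlongrightarrow> deriv y x0) (at x0)"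
    using smooth_on_DERIV[OF ys UNIV_I, of x0] smooth_on_DERIV[OF smooth_on_deriv[OF open_UNIV ys] UNIV_I, of x0]
    by (auto dest!: DERIV_isCont simp: isCont_def yx0)
  let ?h = "\<lambda>x. x - x0"
  have h: "(?h \<longlongrightarrow> 0) (at x0)" by (rule tendsto_eq_intros refl | simp)+
  have p: "((\<lambda>x. p x / ?h x ^ 2) \<longlongrightarrow> 1 / 2) (at x0)" "((\<lambda>x. deriv p x / ?h x) \<longlongrightarrow> 1) (at x0)" "(p \<longlongrightarrow> 0) (at x0)"
    using tendsto_jet_basis[of 2 n c x0] assms(1) unfolding p_def by (simp_all add: numeral_2_eq_2)
  have q: "((\<lambda>x. q x / ?h x ^ (n - 1)) \<longlongrightarrow> 1 / fact (n - 1)) (at x0)"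
     "((\<lambda>x. deriv q x / ?h x ^ (n - 2)) \<longlongrightarrow> 1 / fact (n - 2)) (at x0)" "(q \<longlongrightarrow> 0) (at x0)"
    using tendsto_jet_basis[of "n - 1" n c x0] assms(1) unfolding q_def by (simp_all add: numeral_2_eq_2)
  obtain m where n: "n = Suc (Suc m)" using le_Suc_ex[OF assms(1)] by (auto simp: numeral_3_eq_3)
  have ne: "\<forall>\<^sub>F x in at x0. x \<noteq> x0" by (simp add: eventually_at_filter)
  have pq: "((\<lambda>x. p x * q x * inverse (?h x ^ n)) \<longlongrightarrow> 0) (at x0)"
  proof (rule Lim_transform_eventually)
    show "((\<lambda>x. (p x / ?h x ^ 2) * (q x / ?h x ^ (n - 1)) * ?h x) \<longlongrightarrow> 0) (at x0)"
      using tendsto_mult[OF tendsto_mult[OF p(1) q(1)] h] by simp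
    have "(p x / ?h x ^ 2) * (q x / ?h x ^ (n - 1)) * ?h x = p x * q x * inverse (?h x ^ n)" if "x \<noteq> x0" for x
      using that by (simp add: n power2_eq_square divide_simps)
    then show "\<forall>\<^sub>F x in at x0. (p x / ?h x ^ 2) * (q x / ?h x ^ (n - 1)) * ?h x = p x * q x * inverse (?h x ^ n)"
      using ne by (auto elim!: eventually_mono)
  qed
  have qp': "((\<lambda>x. q x * (deriv p x * inverse (?h x ^ n))) \<longlongrightarrow> 1 / fact (n - 1)) (at x0)"
  proof (rule Lim_transform_eventually)
    show "((\<lambda>x. (q x / ?h x ^ (n - 1)) * (deriv p x / ?h x)) \<longlongrightarrow> 1 / fact (n - 1)) (at x0)"
      using tendsto_mult[OF q(1) p(2)] by simp
    have "(q x / ?h x ^ (n - 1)) * (deriv p x / ?h x) = q x * (deriv p x * inverse (?h x ^ n))" if "x \<noteq> x0" for x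
      using that by (simp add: n power2_eq_square divide_simps)
    then show "\<forall>\<^sub>F x in at x0. (q x / ?h x ^ (n - 1)) * (deriv p x / ?h x) = q x * (deriv p x * inverse (?h x ^ n))"
      using ne by (auto elim!: eventually_mono)
  qed
  have pq': "((\<lambda>x. p x * (deriv q x * inverse (?h x ^ n))) \<longlongrightarrow> 1 / (2 * fact (n - 2))) (at x0)"
  proof (rule Lim_transform_eventually)
    show "((\<lambda>x. (p x / ?h x ^ 2) * (deriv q x / ?h x ^ (n - 2))) \<longlongrightarrow> 1 / (2 * fact (n - 2))) (at x0)"
      using tendsto_mult[OF p(1) q(2)] by simp
    have "(p x / ?h x ^ 2) * (deriv q x / ?h x ^ (n - 2)) = p x * (deriv q x * inverse (?h x ^ n))" if "x \<noteq> x0" for x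
      using that by (simp add: n power2_eq_square divide_simps)
    then show "\<forall>\<^sub>F x in at x0. (p x / ?h x ^ 2) * (deriv q x / ?h x ^ (n - 2)) = p x * (deriv q x * inverse (?h x ^ n))"
      using ne by (auto elim!: eventually_mono)
  qed
  have yp: "((\<lambda>x. y x + p x) \<longlongrightarrow> y0) (at x0)" and yq: "((\<lambda>x. y x + q x) \<longlongrightarrow> y0) (at x0)"
    using tendsto_add[OF y(1) p(3)] tendsto_add[OF y(1) q(3)] by simp_all
  have L1: "((\<lambda>x. (?eta (x, y x + p x + q x) - ?eta (x, y x + p x) - ?eta (x, y x + q x) + ?eta (x, y x)) * inverse (?h x ^ n)) \<longlongrightarrow> 0) (at x0)"
    using tendsto_second_difference[OF assms(2) XI(2) x0 y(1) p(3) q(3) pq] by simp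
  have L2: "((\<lambda>x. (?xi (x, y x + p x + q x) - ?xi (x, y x + p x) - ?xi (x, y x + q x) + ?xi (x, y x)) * inverse (?h x ^ n) * deriv y x) \<longlongrightarrow> 0) (at x0)"
    using tendsto_mult[OF tendsto_second_difference[OF assms(2) XI(1) x0 y(1) p(3) q(3) pq] y(2)] by simp
  have L3: "((\<lambda>x. (?xi (x, y x + p x + q x) - ?xi (x, y x + p x)) * (deriv p x * inverse (?h x ^ n)))
     \<longlongrightarrow> partial_y ?xi (x0, y0) * (1 / fact (n - 1))) (at x0)"
    using tendsto_first_difference[OF assms(2) XI(1) x0 yp q(3) qp'] .
  have L4: "((\<lambda>x. (?xi (x, y x + q x + p x) - ?xi (x, y x + q x)) * (deriv q x * inverse (?h x ^ n)))
     \<longlongrightarrow> partial_y ?xi (x0, y0) * (1 / (2 * fact (n - 2)))) (at x0)"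
    using tendsto_first_difference[OF assms(2) XI(1) x0 yq p(3) pq'] .
  have Dadd: "deriv (\<lambda>x. f x + g x) x = deriv f x + deriv g x" if "smooth_on UNIV f" "smooth_on UNIV g" for f g :: "real \<Rightarrow> real" and x
    using funpow_deriv_add[OF open_UNIV that UNIV_I, of 1] by simp
  have lim: "((\<lambda>x. second_difference X y p q x / ?h x ^ n) \<longlongrightarrow>
     - (partial_y ?xi (x0, y0) * (1 / fact (n - 1)) + partial_y ?xi (x0, y0) * (1 / (2 * fact (n - 2))))) (at x0)"
  proof -
    have "second_difference X y p q x / ?h x ^ n =
      (?eta (x, y x + p x + q x) - ?eta (x, y x + p x) - ?eta (x, y x + q x) + ?eta (x, y x)) * inverse (?h x ^ n)
      - (?xi (x, y x + p x + q x) - ?xi (x, y x + p x) - ?xi (x, y x + q x) + ?xi (x, y x)) * inverse (?h x ^ n) * deriv y x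
      - (?xi (x, y x + p x + q x) - ?xi (x, y x + p x)) * (deriv p x * inverse (?h x ^ n))
      - (?xi (x, y x + q x + p x) - ?xi (x, y x + q x)) * (deriv q x * inverse (?h x ^ n))" for x
      by (simp add: second_difference_def characteristic_def Dadd ys ps qs smooth_on_add divide_inverse algebra_simps)
    note eq = this
    show ?thesis
      unfolding eq using tendsto_diff[OF tendsto_diff[OF tendsto_diff[OF L1 L2] L3] L4] by simp
  qed
  have "smooth_on I y" "smooth_on I p" "smooth_on I q" using ys ps qs smooth_on_subset by blast+
  from second_difference_limit[OF assms(2) c X x0 this _ _ _ _ _ lim]
  have "partial_y ?xi (x0, y0) * (1 / fact (n - 1)) + partial_y ?xi (x0, y0) * (1 / (2 * fact (n - 2))) = 0"
    using assms(1) unfolding y_def p_def q_def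
    by (simp add: linear_op_jet_basis linear_op_cmult[OF open_UNIV] smooth_intros) (simp add: jet_basis_def)
  then have "partial_y ?xi (x0, y0) * (1 / fact (n - 1) + 1 / (2 * fact (n - 2))) = 0"
    by (simp add: distrib_left)
  moreover have "1 / fact (n - 1) + 1 / (2 * fact (n - 2)) > (0::real)" by (intro add_pos_pos) auto
  ultimately show ?thesis by simp
qed

lemma constant_in_y:
  assumes "smooth_on (I \<times> UNIV) G" "x \<in> I" "\<And>t. partial_y G (x, t) = 0"
  shows "G (x, y) = G (x, 0)"
  using DERIV_const_ratio_const[of _ _ "\<lambda>t. G (x, t)"] DERIV_isconst_all[of "\<lambda>t. G (x, t)" y 0]
    DERIV_partial_y[OF assms(1,2)] assms(3) by simp

text \<open>Once \<open>\<xi>\<close> does not depend on \<open>y\<close>, the term \<open>\<xi> y'\<close> drops out of second differences. Increments vanishing to orders \<open>1\<close>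
  and \<open>n - 1\<close>, with a product of order exactly \<open>n\<close>, then show that the second derivative of \<open>\<eta>\<close> by \<open>y\<close> vanishes.\<close>

theorem symmetry_affine:
  assumes "n \<ge> 3" "open I" and c: "\<And>j. j < n \<Longrightarrow> smooth_on I (c j)"
    and X: "X \<in> symmetry_algebra n I (linear_ode n c)" and x0: "x0 \<in> I"
  shows "fst (X (x0, y0)) = fst (X (x0, 0))"
    and "snd (X (x0, y0)) = (snd (X (x0, 1)) - snd (X (x0, 0))) * y0 + snd (X (x0, 0))"
proof -
  let ?xi = "\<lambda>p. fst (X p)" and ?eta = "\<lambda>p. snd (X p)"
  have Xs: "smooth_on (I \<times> UNIV) X" using X by (simp add: symmetry_algebra_def)
  have XI: "smooth_on (I \<times> UNIV) ?xi" "smooth_on (I \<times> UNIV) ?eta"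
    using Xs assms(2) by (auto intro!: smooth_intros open_Times)
  have xi: "?xi (x, t) = ?xi (x, 0)" if "x \<in> I" for x t
    using constant_in_y[OF XI(1) that] symmetry_xi_independent[OF assms(1,2) c X that] by blast
  from xi[OF x0] show "fst (X (x0, y0)) = fst (X (x0, 0))" .
  have "partial_y (partial_y ?eta) (x0, t) = 0" for t
  proof -
    define y where "y = (\<lambda>x. t * jet_basis n c x0 0 x)"
    define p where "p = jet_basis n c x0 1"
    define q where "q = jet_basis n c x0 (n - 1)"
    have ys: "smooth_on UNIV y" unfolding y_def by (intro smooth_intros) auto
    have ps: "smooth_on UNIV p" and qs: "smooth_on UNIV q" unfolding p_def q_def by (auto intro: smooth_intros)
    have yx0: "y x0 = t" using assms(1) by (simp add: y_def jet_basis_def)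
    have y: "(y \<longlongrightarrow> t) (at x0)"
      using smooth_on_DERIV[OF ys UNIV_I, of x0] by (auto dest!: DERIV_isCont simp: isCont_def yx0)
    let ?h = "\<lambda>x. x - x0"
    have p: "((\<lambda>x. p x / ?h x) \<longlongrightarrow> 1) (at x0)" "(p \<longlongrightarrow> 0) (at x0)"
      using tendsto_jet_basis[of 1 n c x0] assms(1) unfolding p_def by simp_all
    have q: "((\<lambda>x. q x / ?h x ^ (n - 1)) \<longlongrightarrow> 1 / fact (n - 1)) (at x0)" "(q \<longlongrightarrow> 0) (at x0)"
      using tendsto_jet_basis[of "n - 1" n c x0] assms(1) unfolding q_def by simp_all
    have ne: "\<forall>\<^sub>F x in at x0. x \<noteq> x0" by (simp add: eventually_at_filter)
    obtain m where n: "n = Suc m" using assms(1) by (cases n) auto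
    have pq: "((\<lambda>x. p x * q x * inverse (?h x ^ n)) \<longlongrightarrow> 1 / fact (n - 1)) (at x0)"
    proof (rule Lim_transform_eventually)
      show "((\<lambda>x. (p x / ?h x) * (q x / ?h x ^ (n - 1))) \<longlongrightarrow> 1 / fact (n - 1)) (at x0)"
        using tendsto_mult[OF p(1) q(1)] by simp
      have "(p x / ?h x) * (q x / ?h x ^ (n - 1)) = p x * q x * inverse (?h x ^ n)" if "x \<noteq> x0" for x
        using that by (simp add: n power2_eq_square divide_simps)
      then show "\<forall>\<^sub>F x in at x0. (p x / ?h x) * (q x / ?h x ^ (n - 1)) = p x * q x * inverse (?h x ^ n)"
        using ne by (auto elim!: eventually_mono)
    qed
    have Dadd: "deriv (\<lambda>x. f x + g x) x = deriv f x + deriv g x" if "smooth_on UNIV f" "smooth_on UNIV g" for f g :: "real \<Rightarrow> real" and x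
      using funpow_deriv_add[OF open_UNIV that UNIV_I, of 1] by simp
    have I: "\<forall>\<^sub>F x in at x0. x \<in> I" using eventually_at_topological assms(2) x0 by blast
    have lim: "((\<lambda>x. second_difference X y p q x / ?h x ^ n) \<longlongrightarrow> partial_y (partial_y ?eta) (x0, t) * (1 / fact (n - 1))) (at x0)"
    proof (rule Lim_transform_eventually[OF tendsto_second_difference[OF assms(2) XI(2) x0 y p(2) q(2) pq]])
      have "(?eta (x, y x + p x + q x) - ?eta (x, y x + p x) - ?eta (x, y x + q x) + ?eta (x, y x)) * inverse (?h x ^ n)
         = second_difference X y p q x / ?h x ^ n" if "x \<in> I" for x
        unfolding second_difference_def characteristic_def
          xi[OF that, of "y x + p x + q x"] xi[OF that, of "y x + p x"] xi[OF that, of "y x + q x"] xi[OF that, of "y x"]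
        by (simp add: Dadd ys ps qs smooth_on_add divide_inverse algebra_simps)
      then show "\<forall>\<^sub>F x in at x0. (?eta (x, y x + p x + q x) - ?eta (x, y x + p x) - ?eta (x, y x + q x) + ?eta (x, y x)) * inverse (?h x ^ n)
         = second_difference X y p q x / ?h x ^ n"
        using I by (auto elim!: eventually_mono)
    qed
    have "smooth_on I y" "smooth_on I p" "smooth_on I q" using ys ps qs smooth_on_subset by blast+
    from second_difference_limit[OF assms(2) c X x0 this _ _ _ _ _ lim]
    have "partial_y (partial_y ?eta) (x0, t) * (1 / fact (n - 1)) = 0"
      using assms(1) unfolding y_def p_def q_def
      by (simp add: linear_op_jet_basis linear_op_cmult[OF open_UNIV] smooth_intros) (simp add: jet_basis_def)
    then show ?thesis by simp
  qed
  note e = constant_in_y[OF smooth_on_partial_y[OF XI(2)] x0 this]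
  have k: "((\<lambda>t. ?eta (x0, t)) has_real_derivative partial_y ?eta (x0, 0)) (at t)" for t
    using DERIV_partial_y[OF XI(2) x0, of t] unfolding e[of t] .
  have "?eta (x0, t) - t * partial_y ?eta (x0, 0) = ?eta (x0, 0) - 0 * partial_y ?eta (x0, 0)" for t
  proof (rule DERIV_isconst_all[of "\<lambda>t. ?eta (x0, t) - t * partial_y ?eta (x0, 0)"], rule allI)
    show "((\<lambda>t. ?eta (x0, t) - t * partial_y ?eta (x0, 0)) has_real_derivative 0) (at s)" for s
      using DERIV_diff[OF k DERIV_cmult_right[OF DERIV_ident], of "partial_y ?eta (x0, 0)" s] by simp
  qed
  from this[of 1] this[of y0]
  show "snd (X (x0, y0)) = (snd (X (x0, 1)) - snd (X (x0, 0))) * y0 + snd (X (x0, 0))"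
    by (simp add: algebra_simps)
qed

section \<open>The determining equations\<close>

definition full_coeff :: "nat \<Rightarrow> (nat \<Rightarrow> real \<Rightarrow> real) \<Rightarrow> nat \<Rightarrow> real \<Rightarrow> real" where
  "full_coeff n c k x = (if k = n then 1 else c k x)"

lemma linear_op_full: "linear_op n c y x = (\<Sum>k\<le>n. full_coeff n c k x * (deriv ^^ k) y x)"
  unfolding linear_op_eq lessThan_Suc_atMost[symmetric] sum.lessThan_Suc
  by (simp add: full_coeff_def)

text \<open>The coefficient of \<open>y\<^sup>(\<^sup>j\<^sup>)\<close> in the operator that remains of the commutator with \<open>a - \<xi> d/dx\<close> below. The case
  distinction stands for the binomial coefficient of \<open>k\<close> over \<open>j - 1\<close>, which truncated subtraction would get wrong at \<open>j = 0\<close>.\<close>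

definition defect :: "nat \<Rightarrow> (nat \<Rightarrow> real \<Rightarrow> real) \<Rightarrow> (real \<Rightarrow> real) \<Rightarrow> (real \<Rightarrow> real) \<Rightarrow> nat \<Rightarrow> real \<Rightarrow> real" where
  "defect n c \<xi> a j x =
    (\<Sum>k\<in>{j<..n}. full_coeff n c k x *
       (real (k choose j) * (deriv ^^ (k - j)) a x
        - (if j = 0 then 0 else real (k choose (j - 1))) * (deriv ^^ Suc (k - j)) \<xi> x))
    + real (n - j) * deriv \<xi> x * c j x + \<xi> x * deriv (c j) x"

lemma funpow_deriv_characteristic:
  assumes "open S" "smooth_on S \<xi>" "smooth_on S a" "smooth_on S w" "x \<in> S"
  shows "(deriv ^^ k) (\<lambda>x. a x * w x - \<xi> x * deriv w x) x =
    (\<Sum>j<k. (real (k choose j) * (deriv ^^ (k - j)) a x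
        - (if j = 0 then 0 else real (k choose (j - 1))) * (deriv ^^ Suc (k - j)) \<xi> x) * (deriv ^^ j) w x)
    + (a x - real k * deriv \<xi> x) * (deriv ^^ k) w x - \<xi> x * (deriv ^^ Suc k) w x"
proof -
  let ?a = "\<lambda>i. (deriv ^^ i) a x" and ?xi = "\<lambda>i. (deriv ^^ i) \<xi> x" and ?w = "\<lambda>i. (deriv ^^ i) w x"
  let ?b = "\<lambda>j. if j = 0 then 0 else real (k choose (j - 1))"
  have "(deriv ^^ k) (\<lambda>x. a x * w x - \<xi> x * deriv w x) x =
     (deriv ^^ k) (\<lambda>x. a x * w x) x - (deriv ^^ k) (\<lambda>x. \<xi> x * deriv w x) x"
    using assms by (intro funpow_deriv_diff[OF assms(1)] smooth_intros)
  also have "(deriv ^^ k) (\<lambda>x. a x * w x) x = (\<Sum>i\<le>k. real (k choose i) * ?a (k - i) * ?w i)"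
    by (rule funpow_deriv_mult[OF assms(1,3,4,5)])
  also have "\<dots> = (\<Sum>i<k. real (k choose i) * ?a (k - i) * ?w i) + a x * ?w k"
    by (simp add: lessThan_Suc_atMost[symmetric])
  also have "(deriv ^^ k) (\<lambda>x. \<xi> x * deriv w x) x = (\<Sum>i\<le>k. real (k choose i) * ?xi (k - i) * ?w (Suc i))"
    using funpow_deriv_mult[OF assms(1,2) smooth_on_deriv[OF assms(1,4)] assms(5), of k]
    by (simp only: funpow_deriv_Suc_deriv)
  also have "\<dots> = (\<Sum>j\<le>Suc k. ?b j * ?xi (Suc k - j) * ?w j)"
    by (subst sum.atMost_Suc_shift) simp
  also have "\<dots> = (\<Sum>j<k. ?b j * ?xi (Suc k - j) * ?w j) + real k * deriv \<xi> x * ?w k + \<xi> x * ?w (Suc k)"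
    by (cases k) (simp_all add: lessThan_Suc_atMost[symmetric])
  finally show ?thesis
    by (simp add: algebra_simps sum_subtractf Suc_diff_le del: funpow.simps)
qed

text \<open>Commuting the equation past the first order operator \<open>a - \<xi> d/dx\<close>. Suitable multiples of the equation
  and of its derivative remove the terms of order \<open>n\<close> and \<open>n + 1\<close>; what remains has order below \<open>n\<close>, so it can
  vanish on all solutions only if each of its coefficients does.\<close>

lemma commutator_identity:
  assumes S: "open S" "\<And>j. j < n \<Longrightarrow> smooth_on S (c j)" "smooth_on S \<xi>" "smooth_on S a" "smooth_on S w" "x \<in> S"
  shows "linear_op n c (\<lambda>x. a x * w x - \<xi> x * deriv w x) x + \<xi> x * deriv (linear_op n c w) x
      - (a x - real n * deriv \<xi> x) * linear_op n c w x = (\<Sum>j<n. defect n c \<xi> a j x * (deriv ^^ j) w x)"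
proof -
  let ?w = "\<lambda>i. (deriv ^^ i) w x" and ?C = "\<lambda>k. full_coeff n c k x"
  define A where "A k j = real (k choose j) * (deriv ^^ (k - j)) a x
        - (if j = 0 then 0 else real (k choose (j - 1))) * (deriv ^^ Suc (k - j)) \<xi> x" for k j
  have 1: "linear_op n c (\<lambda>x. a x * w x - \<xi> x * deriv w x) x =
     (\<Sum>k\<le>n. ?C k * ((\<Sum>j<k. A k j * ?w j) + (a x - real k * deriv \<xi> x) * ?w k - \<xi> x * ?w (Suc k)))"
    unfolding linear_op_full A_def by (simp only: funpow_deriv_characteristic[OF S(1,3-6)])
  have 2: "deriv (linear_op n c w) x = (\<Sum>k\<le>n. ?C k * ?w (Suc k)) + (\<Sum>j<n. deriv (c j) x * ?w j)"
  proof -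
    have "deriv (linear_op n c w) x = ?w (Suc n) + (\<Sum>j<n. deriv (c j) x * ?w j + c j x * ?w (Suc j))"
      by (rule deriv_linear_op[OF S(1,5) _ S(6)]) (rule S(2))
    then show ?thesis
      unfolding lessThan_Suc_atMost[symmetric] sum.lessThan_Suc
      by (simp add: full_coeff_def sum.distrib)
  qed
  have 3: "(\<Sum>k\<le>n. ?C k * (\<Sum>j<k. A k j * ?w j)) = (\<Sum>j<n. (\<Sum>k\<in>{j<..n}. ?C k * A k j) * ?w j)"
  proof -
    have "(\<Sum>k\<le>n. ?C k * (\<Sum>j<k. A k j * ?w j)) = (\<Sum>k\<in>{..n}. \<Sum>j\<in>{j\<in>{..<n}. j < k}. ?C k * (A k j * ?w j))"
      unfolding sum_distrib_left by (intro sum.cong) auto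
    also have "\<dots> = (\<Sum>j\<in>{..<n}. \<Sum>k\<in>{k\<in>{..n}. j < k}. ?C k * (A k j * ?w j))"
      by (rule sum.swap_restrict) auto
    also have "\<dots> = (\<Sum>j<n. (\<Sum>k\<in>{j<..n}. ?C k * A k j) * ?w j)"
      unfolding sum_distrib_right by (intro sum.cong) auto
    finally show ?thesis .
  qed
  have 4: "(\<Sum>k\<le>n. ?C k * ((real n - real k) * deriv \<xi> x * ?w k)) = (\<Sum>j<n. real (n - j) * deriv \<xi> x * c j x * ?w j)"
    unfolding lessThan_Suc_atMost[symmetric] sum.lessThan_Suc
    by (auto intro!: sum.cong simp: full_coeff_def of_nat_diff)
  have "linear_op n c (\<lambda>x. a x * w x - \<xi> x * deriv w x) x + \<xi> x * deriv (linear_op n c w) x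
      - (a x - real n * deriv \<xi> x) * linear_op n c w x =
    (\<Sum>k\<le>n. ?C k * (\<Sum>j<k. A k j * ?w j)) + (\<Sum>k\<le>n. ?C k * ((real n - real k) * deriv \<xi> x * ?w k))
      + (\<Sum>j<n. \<xi> x * deriv (c j) x * ?w j)"
    unfolding 1 2 linear_op_full[of n c w]
    by (simp add: algebra_simps sum.distrib sum_subtractf sum_distrib_left del: funpow.simps)
  also have "\<dots> = (\<Sum>j<n. defect n c \<xi> a j x * ?w j)"
    unfolding 3 4 defect_def by (simp add: sum.distrib distrib_right A_def)
  finally show ?thesis .
qed

lemma linear_op_hpow:
  "j < n \<Longrightarrow> linear_op n c (hpow x j) x = c j x" "linear_op n c (hpow x n) x = 1"
  unfolding linear_op_eq by (auto simp: if_distrib cong: if_cong)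

text \<open>Test functions \<open>(t - x)\<^sup>j / j!\<close> pick out the single coefficients at \<open>x\<close>; the one with \<open>j = n\<close> identifies the multiplier \<open>l\<close>.\<close>

lemma defect_zero_if_multiple:
  assumes S: "open S" "\<And>j. j < n \<Longrightarrow> smooth_on S (c j)" "smooth_on S \<xi>" "smooth_on S a" "x \<in> S"
    and *: "\<And>w. smooth_on S w \<Longrightarrow> linear_op n c (\<lambda>x. a x * w x - \<xi> x * deriv w x) x
      = - \<xi> x * deriv (linear_op n c w) x + l * linear_op n c w x"
    and "j < n"
  shows "defect n c \<xi> a j x = 0"
proof -
  have E: "(l - (a x - real n * deriv \<xi> x)) * linear_op n c w x = (\<Sum>j<n. defect n c \<xi> a j x * (deriv ^^ j) w x)"
    if "smooth_on S w" for w
    using commutator_identity[where c = c and n = n, OF S(1,2,3,4) that S(5)] *[OF that] by (simp add: algebra_simps)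
  have "l - (a x - real n * deriv \<xi> x) = 0"
    using E[OF smooth_on_hpow[OF S(1), of x n]] by (simp add: linear_op_hpow)
  with E[OF smooth_on_hpow[OF S(1), of x j]] \<open>j < n\<close> show ?thesis
    by (simp add: if_distrib cong: if_cong)
qed

text \<open>The determining equations for a field \<open>\<xi> d/dx + a y d/dy\<close>.\<close>

definition symmetry_pair :: "nat \<Rightarrow> real set \<Rightarrow> (nat \<Rightarrow> real \<Rightarrow> real) \<Rightarrow> (real \<Rightarrow> real) \<Rightarrow> (real \<Rightarrow> real) \<Rightarrow> bool" where
  "symmetry_pair n I c \<xi> a \<longleftrightarrow> smooth_on I \<xi> \<and> smooth_on I a \<and> (\<forall>j<n. \<forall>x\<in>I. defect n c \<xi> a j x = 0)"

definition affine_field :: "real set \<Rightarrow> (real \<Rightarrow> real) \<Rightarrow> (real \<Rightarrow> real) \<Rightarrow> (real \<Rightarrow> real) \<Rightarrow> vfield" where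
  "affine_field I \<xi> a b p = (if p \<in> I \<times> UNIV then (\<xi> (fst p), a (fst p) * snd p + b (fst p)) else 0)"

lemma smooth_on_affine_field:
  assumes "open I" "smooth_on I \<xi>" "smooth_on I a" "smooth_on I b"
  shows "smooth_on (I \<times> UNIV) (affine_field I \<xi> a b)"
proof -
  have o: "open (I \<times> (UNIV :: real set))" using assms(1) by (simp add: open_Times)
  have f: "smooth_on (I \<times> (UNIV::real set)) (\<lambda>p. f (fst p))" if "smooth_on I f" for f :: "real \<Rightarrow> real"
    by (rule smooth_on_compose[OF o assms(1) that smooth_on_fst[OF o smooth_on_ident[OF o]]]) auto
  have "smooth_on (I \<times> (UNIV::real set)) (\<lambda>p. (\<xi> (fst p), a (fst p) * snd p + b (fst p)))"
    using assms(2-4) by (intro smooth_intros o f)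
  then show ?thesis
    using smooth_on_cong[OF o, of "affine_field I \<xi> a b"] by (simp add: affine_field_def)
qed

lemma characteristic_affine_field:
  "x \<in> I \<Longrightarrow> characteristic (affine_field I \<xi> a b) y x = (a x * y x - \<xi> x * deriv y x) + b x"
  by (simp add: characteristic_def affine_field_def)

text \<open>The condition is to hold for all solutions at a point. The zero solution isolates the condition on \<open>b\<close>, and curves with
  prescribed jets of order \<open>n - 1\<close> isolate the determining equations for \<open>\<xi>\<close> and \<open>a\<close> one by one.\<close>

lemma affine_field_symmetry_iff:
  assumes "open I" and c: "\<And>j. j < n \<Longrightarrow> smooth_on I (c j)"
    and s: "smooth_on I \<xi>" "smooth_on I a" "smooth_on I b"
  shows "affine_field I \<xi> a b \<in> symmetry_algebra n I (linear_ode n c) \<longleftrightarrow>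
    symmetry_pair n I c \<xi> a \<and> (\<forall>x\<in>I. linear_op n c b x = 0)"
proof -
  let ?X = "affine_field I \<xi> a b"
  have *: "linear_op n c (characteristic ?X y) x + fst (?X (x, y x)) * deriv (linear_op n c y) x =
      (\<Sum>j<n. defect n c \<xi> a j x * (deriv ^^ j) y x) + linear_op n c b x"
    if "x \<in> I" "smooth_on I y" "linear_op n c y x = 0" for x y
  proof -
    have "linear_op n c (characteristic ?X y) x = linear_op n c (\<lambda>x. (a x * y x - \<xi> x * deriv y x) + b x) x"
      by (rule linear_op_cong[OF assms(1) characteristic_affine_field that(1)])
    also have "\<dots> = linear_op n c (\<lambda>x. a x * y x - \<xi> x * deriv y x) x + linear_op n c b x"
      using s that assms(1) by (intro linear_op_add[OF assms(1)] smooth_intros)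
    finally show ?thesis
      using commutator_identity[where c = c and n = n, OF assms(1) c s(1,2) that(2,1)] that(1,3)
      by (simp add: affine_field_def)
  qed
  have "?X \<in> symmetry_algebra n I (linear_ode n c) \<longleftrightarrow>
     (\<forall>x\<in>I. \<forall>y. smooth_on I y \<longrightarrow> linear_op n c y x = 0 \<longrightarrow>
        (\<Sum>j<n. defect n c \<xi> a j x * (deriv ^^ j) y x) + linear_op n c b x = 0)"
  proof -
    have "?X \<in> symmetry_algebra n I (linear_ode n c) \<longleftrightarrow>
      smooth_on (I \<times> UNIV) ?X \<and> (\<forall>p. p \<notin> I \<times> UNIV \<longrightarrow> ?X p = 0) \<and>
      (\<forall>x\<in>I. \<forall>y. smooth_on I y \<longrightarrow> linear_op n c y x = 0 \<longrightarrow>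
       linear_op n c (characteristic ?X y) x + fst (?X (x, y x)) * deriv (linear_op n c y) x = 0)"
      by (rule symmetry_iff_characteristic[OF assms(1)]) (rule c)
    moreover have "\<forall>p. p \<notin> I \<times> UNIV \<longrightarrow> ?X p = 0" by (simp add: affine_field_def)
    moreover have "(\<forall>x\<in>I. \<forall>y. smooth_on I y \<longrightarrow> linear_op n c y x = 0 \<longrightarrow>
        linear_op n c (characteristic ?X y) x + fst (?X (x, y x)) * deriv (linear_op n c y) x = 0) \<longleftrightarrow>
      (\<forall>x\<in>I. \<forall>y. smooth_on I y \<longrightarrow> linear_op n c y x = 0 \<longrightarrow>
        (\<Sum>j<n. defect n c \<xi> a j x * (deriv ^^ j) y x) + linear_op n c b x = 0)"
      by (intro ball_cong all_cong1 imp_cong refl) (simp only: *)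
    ultimately show ?thesis using smooth_on_affine_field[OF assms(1) s] by (iprover intro: iffI conjI elim: conjE iffE)
  qed
  also have "\<dots> \<longleftrightarrow> (\<forall>x\<in>I. linear_op n c b x = 0 \<and> (\<forall>j<n. defect n c \<xi> a j x = 0))"
  proof (intro ball_cong refl iffI allI impI conjI)
    fix x assume x: "x \<in> I" and H: "\<forall>y. smooth_on I y \<longrightarrow> linear_op n c y x = 0 \<longrightarrow>
        (\<Sum>j<n. defect n c \<xi> a j x * (deriv ^^ j) y x) + linear_op n c b x = 0"
    have z: "linear_op n c (\<lambda>x. 0) x = 0" by (simp add: linear_op_eq funpow_deriv_const)
    show b: "linear_op n c b x = 0"
      using H[rule_format, OF smooth_on_const z] by (simp add: funpow_deriv_const)
    fix j assume "j < n"
    have "(\<Sum>i<n. defect n c \<xi> a i x * (deriv ^^ i) (jet_basis n c x j) x) + linear_op n c b x = 0"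
      using H smooth_on_jet_basis[OF assms(1)] linear_op_jet_basis[OF \<open>j < n\<close>] by blast
    moreover have "(\<Sum>i<n. defect n c \<xi> a i x * (deriv ^^ i) (jet_basis n c x j) x) = (\<Sum>i<n. if i = j then defect n c \<xi> a j x else 0)"
      by (intro sum.cong) (auto simp: funpow_deriv_jet_basis)
    ultimately show "defect n c \<xi> a j x = 0" using b \<open>j < n\<close> by simp
  qed auto
  finally show ?thesis unfolding symmetry_pair_def using s by blast
qed

theorem symmetry_algebra_eq:
  assumes "n \<ge> 3" "open I" and c: "\<And>j. j < n \<Longrightarrow> smooth_on I (c j)"
  shows "symmetry_algebra n I (linear_ode n c) =
    {affine_field I \<xi> a b | \<xi> a b. symmetry_pair n I c \<xi> a \<and> smooth_on I b \<and> (\<forall>x\<in>I. linear_op n c b x = 0)}"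
    (is "?L = ?R")
proof
  show "?R \<subseteq> ?L"
    using affine_field_symmetry_iff[where n = n and c = c, OF assms(2) c] unfolding symmetry_pair_def by blast
  show "?L \<subseteq> ?R"
  proof
    fix X assume X: "X \<in> ?L"
    define \<xi> where "\<xi> = (\<lambda>x. fst (X (x, 0)))"
    define a where "a = (\<lambda>x. snd (X (x, 1)) - snd (X (x, 0)))"
    define b where "b = (\<lambda>x. snd (X (x, 0)))"
    have Xs: "smooth_on (I \<times> UNIV) X" and X0: "\<And>p. p \<notin> I \<times> UNIV \<Longrightarrow> X p = 0"
      using X unfolding symmetry_algebra_def by blast+
    have "smooth_on I (\<lambda>x. X (x, r))" for r
      using smooth_on_vfield_along[OF assms(2) Xs assms(2) order_refl smooth_on_const] .
    then have s: "smooth_on I \<xi>" "smooth_on I a" "smooth_on I b"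
      unfolding \<xi>_def a_def b_def using assms(2) by (auto intro!: smooth_intros)
    have "X = affine_field I \<xi> a b"
    proof
      fix p
      show "X p = affine_field I \<xi> a b p"
      proof (cases "p \<in> I \<times> UNIV")
        case True
        then have x: "fst p \<in> I" by auto
        show ?thesis
          using True symmetry_affine[where c = c, OF assms(1,2) c X x, of "snd p"]
          by (simp add: affine_field_def \<xi>_def a_def b_def prod_eq_iff)
      qed (simp add: X0 affine_field_def)
    qed
    with X affine_field_symmetry_iff[where n = n and c = c, OF assms(2) c s] s(3) show "X \<in> ?R" by blast
  qed
qed

subsection \<open>The two leading determining equations\<close>

lemma choose_Suc_Suc: "real (Suc (Suc m) choose m) = (real m + 2) * (real m + 1) / 2"
proof (induction m)
  case (Suc m)
  have "real (Suc (Suc (Suc m)) choose Suc m) = real (Suc (Suc m) choose m) + real (Suc (Suc m) choose Suc m)"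
    by (simp only: binomial_Suc_Suc of_nat_add)
  then show ?case using Suc binomial_Suc_n[of "Suc m"] by (simp add: field_simps)
qed simp

lemma choose_Suc_Suc_Suc: "real (Suc (Suc (Suc m)) choose m) = (real m + 3) * (real m + 2) * (real m + 1) / 6"
proof (induction m)
  case (Suc m)
  have "real (Suc (Suc (Suc (Suc m))) choose Suc m) = real (Suc (Suc (Suc m)) choose m) + real (Suc (Suc (Suc m)) choose Suc m)"
    by (simp only: binomial_Suc_Suc of_nat_add)
  then show ?case using Suc choose_Suc_Suc[of "Suc m"] by (simp add: field_simps)
qed simp

lemma defect_first:
  assumes "n = Suc (Suc (Suc m))"
  shows "defect n c \<xi> a (n - 1) x =
    real n * deriv a x - real n * (real n - 1) / 2 * deriv (deriv \<xi>) x
      + deriv \<xi> x * c (n - 1) x + \<xi> x * deriv (c (n - 1)) x"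
proof -
  have "{n - 1<..n} = {n}" using assms by auto
  moreover have "real (n choose (n - 1)) = real n" using assms binomial_Suc_n by simp
  moreover have "real (n choose (n - 1 - 1)) = real n * (real n - 1) / 2"
    using choose_Suc_Suc[of "Suc m"] by (simp add: assms algebra_simps)
  moreover have "n - (n - 1) = Suc 0" "n - 1 \<noteq> 0" using assms by auto
  ultimately show ?thesis unfolding defect_def by (simp add: full_coeff_def)
qed

lemma defect_second:
  assumes "n = Suc (Suc (Suc m))"
  shows "defect n c \<xi> a (n - 2) x =
    real n * (real n - 1) / 2 * deriv (deriv a) x
    - real n * (real n - 1) * (real n - 2) / 6 * deriv (deriv (deriv \<xi>)) x
    + c (n - 1) x * ((real n - 1) * deriv a x - (real n - 1) * (real n - 2) / 2 * deriv (deriv \<xi>) x)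
    + 2 * deriv \<xi> x * c (n - 2) x + \<xi> x * deriv (c (n - 2)) x"
proof -
  have s: "{n - 2<..n} = {n - 1, n}" and ne: "n - 1 \<noteq> n" and nz: "n - 2 \<noteq> 0"
    and i: "n - (n - 2) = 2" "n - 1 - (n - 2) = 1" using assms by auto
  have pair: "(\<Sum>k\<in>{n - 1, n}. g k) = g (n - 1) + g n" for g :: "nat \<Rightarrow> real" using ne by simp
  have 1: "real (n choose (n - 2)) = real n * (real n - 1) / 2"
    using choose_Suc_Suc[of "Suc m"] by (simp add: assms algebra_simps)
  have 2: "real (n choose (n - 2 - 1)) = real n * (real n - 1) * (real n - 2) / 6"
    using choose_Suc_Suc_Suc[of m] by (simp add: assms algebra_simps)
  have 3: "real (n - 1 choose (n - 2)) = real n - 1"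
    using binomial_Suc_n[of "Suc m"] by (simp add: assms)
  have 4: "real (n - 1 choose (n - 2 - 1)) = (real n - 1) * (real n - 2) / 2"
    using choose_Suc_Suc[of m] by (simp add: assms algebra_simps)
  show ?thesis
    unfolding defect_def s pair 1 2 3 4 i if_not_P[OF nz] using ne
    by (simp add: full_coeff_def numeral_2_eq_2)
qed

text \<open>The coefficient of order \<open>n - 2\<close> that results when a factor of the dependent variable removes the one of order \<open>n - 1\<close>.\<close>

definition laguerre_invariant :: "nat \<Rightarrow> (nat \<Rightarrow> real \<Rightarrow> real) \<Rightarrow> real \<Rightarrow> real" where
  "laguerre_invariant n c x = c (n - 2) x - (real n - 1) / 2 * deriv (c (n - 1)) x
     - (real n - 1) / (2 * real n) * (c (n - 1) x)\<^sup>2"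

lemma smooth_on_laguerre_invariant:
  assumes "open S" "n \<ge> 3" "\<And>j. j < n \<Longrightarrow> smooth_on S (c j)"
  shows "smooth_on S (laguerre_invariant n c)"
  unfolding laguerre_invariant_def[abs_def] using assms by (intro smooth_intros) auto

lemma symmetry_pair_first:
  assumes "n \<ge> 3" "symmetry_pair n S c \<xi> a" "x \<in> S"
  shows "deriv a x = (real n - 1) / 2 * deriv (deriv \<xi>) x - (deriv \<xi> x * c (n - 1) x + \<xi> x * deriv (c (n - 1)) x) / real n"
proof -
  obtain m where n: "n = Suc (Suc (Suc m))" using le_Suc_ex[OF assms(1)] by (auto simp: numeral_3_eq_3)
  have "defect n c \<xi> a (n - 1) x = 0" using assms(2,3) n unfolding symmetry_pair_def by simp
  then show ?thesis unfolding defect_first[OF n] using assms(1) by (simp add: field_simps)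
qed

text \<open>Eliminating \<open>a\<close> from the two leading determining equations leaves an equation for \<open>\<xi>\<close> whose leading coefficient is a
  nonzero constant: the contributions \<open>n (n - 1)\<^sup>2 / 4\<close> from \<open>a''\<close> and \<open>- n (n - 1) (n - 2) / 6\<close> do not cancel.\<close>

lemma symmetry_pair_second:
  assumes "n \<ge> 3" "open S" and c: "\<And>j. j < n \<Longrightarrow> smooth_on S (c j)" and p: "symmetry_pair n S c \<xi> a" and x: "x \<in> S"
  shows "real n * (real n - 1) * (real n + 1) / 12 * deriv (deriv (deriv \<xi>)) x
     + 2 * laguerre_invariant n c x * deriv \<xi> x + deriv (laguerre_invariant n c) x * \<xi> x = 0"
proof -
  obtain m where n: "n = Suc (Suc (Suc m))" using le_Suc_ex[OF assms(1)] by (auto simp: numeral_3_eq_3)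
  define N where "N = real n"
  define C where "C = c (n - 1)"
  define b where "b = c (n - 2)"
  have N: "N \<noteq> 0" using n by (simp add: N_def)
  have sm: "smooth_on S \<xi>" "smooth_on S a" "smooth_on S C" "smooth_on S b"
    using p c n unfolding symmetry_pair_def C_def b_def by auto
  note ds = smooth_on_deriv[OF assms(2)]
  note D = smooth_on_DERIV[OF sm(1) x] smooth_on_DERIV[OF ds[OF sm(1)] x] smooth_on_DERIV[OF ds[OF ds[OF sm(1)]] x]
    smooth_on_DERIV[OF sm(3) x] smooth_on_DERIV[OF ds[OF sm(3)] x] smooth_on_DERIV[OF sm(4) x]
  have a': "deriv a z = (N - 1) / 2 * deriv (deriv \<xi>) z - (deriv \<xi> z * C z + \<xi> z * deriv C z) / N" if "z \<in> S" for z
    using symmetry_pair_first[OF assms(1) p that] unfolding N_def C_def .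
  have a'': "deriv (deriv a) x = (N - 1) / 2 * deriv (deriv (deriv \<xi>)) x
     - (deriv (deriv \<xi>) x * C x + 2 * deriv \<xi> x * deriv C x + \<xi> x * deriv (deriv C) x) / N"
  proof -
    have "((\<lambda>z. (N - 1) / 2 * deriv (deriv \<xi>) z - (deriv \<xi> z * C z + \<xi> z * deriv C z) / N) has_real_derivative
      (N - 1) / 2 * deriv (deriv (deriv \<xi>)) x
     - (deriv (deriv \<xi>) x * C x + 2 * deriv \<xi> x * deriv C x + \<xi> x * deriv (deriv C) x) / N) (at x)"
      by (rule DERIV_cdivide derivative_eq_intros refl D)+ (use N in \<open>simp_all add: field_simps\<close>)
    moreover have "\<forall>\<^sub>F z in nhds x. deriv a z = (N - 1) / 2 * deriv (deriv \<xi>) z - (deriv \<xi> z * C z + \<xi> z * deriv C z) / N"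
      using a' assms(2) x eventually_nhds by blast
    then have "deriv (deriv a) x = deriv (\<lambda>z. (N - 1) / 2 * deriv (deriv \<xi>) z - (deriv \<xi> z * C z + \<xi> z * deriv C z) / N) x"
      by (rule deriv_cong_ev) simp
    ultimately show ?thesis by (simp only: DERIV_imp_deriv)
  qed
  have B: "laguerre_invariant n c = (\<lambda>z. b z - (N - 1) / 2 * deriv C z - (N - 1) / (2 * N) * (C z)\<^sup>2)"
    by (simp add: fun_eq_iff laguerre_invariant_def b_def C_def N_def)
  have B': "deriv (laguerre_invariant n c) x = deriv b x - (N - 1) / 2 * deriv (deriv C) x - (N - 1) / N * C x * deriv C x"
    unfolding B by (rule DERIV_imp_deriv, (rule derivative_eq_intros refl D)+) (use N in \<open>simp_all add: field_simps\<close>)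
  have z: "defect n c \<xi> a (n - 2) x = 0" using p x n unfolding symmetry_pair_def by simp
  note z' = z[unfolded defect_second[OF n], folded N_def C_def b_def, unfolded a'' a'[OF x]]
  show ?thesis
    unfolding B' unfolding B N_def[symmetric] using z' N by (simp add: field_simps power2_eq_square)
qed

section \<open>Linear differential equations\<close>

lemma open_interval_compact_part:
  assumes "open_interval I" "x \<in> I" "z \<in> I"
  obtains a b where "{a..b} \<subseteq> I" "a < x" "x < b" "a < z" "z < b"
proof -
  have o: "open I" and i: "is_interval I" using assms by (auto simp: open_interval_def)
  have "min x z \<in> I" "max x z \<in> I" using assms by (auto simp: min_def max_def)
  then obtain e d where e: "e > 0" "cball (min x z) e \<subseteq> I" and d: "d > 0" "cball (max x z) d \<subseteq> I"
    using o open_contains_cball by meson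
  have ab: "min x z - e \<in> I" "max x z + d \<in> I"
    using e d by (auto simp: subset_iff dist_real_def)
  then have "{min x z - e..max x z + d} \<subseteq> I" using i unfolding is_interval_1 by fastforce
  then show ?thesis using e(1) d(1) by (intro that[of "min x z - e" "max x z + d"]) auto
qed

definition primitive :: "real \<Rightarrow> (real \<Rightarrow> real) \<Rightarrow> real \<Rightarrow> real" where
  "primitive x0 f x = (LBINT t=x0..x. f t)"

lemma DERIV_primitive:
  assumes "open_interval I" "continuous_on I f" "x0 \<in> I" "x \<in> I"
  shows "(primitive x0 f has_real_derivative f x) (at x)"
proof -
  obtain a b where ab: "{a..b} \<subseteq> I" "a < x0" "x0 < b" "a < x" "x < b"
    using open_interval_compact_part[OF assms(1,3,4)] .
  have "((\<lambda>u. LBINT y=x0..u. f y) has_vector_derivative f x) (at x within {a..b})"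
    using ab continuous_on_subset[OF assms(2) ab(1)] by (intro interval_integral_FTC2) auto
  then show ?thesis
    using ab by (simp add: primitive_def[abs_def] has_real_derivative_iff_has_vector_derivative at_within_Icc_at)
qed

lemma primitive_center [simp]: "primitive x0 f x0 = 0"
  by (simp add: primitive_def)

lemma smooth_on_primitive:
  assumes "open_interval I" "smooth_on I f" "x0 \<in> I"
  shows "smooth_on I (primitive x0 f)"
proof (rule smooth_on_if_DERIV[OF _ _ assms(2)])
  show "open I" using assms(1) by (simp add: open_interval_def)
  show "(primitive x0 f has_real_derivative f x) (at x)" if "x \<in> I" for x
    using DERIV_primitive[OF assms(1) smooth_on_imp_continuous_on[OF assms(2)] assms(3) that] .
qed

text \<open>Both sides of the base point are treated at once by restricting to the segment from it.\<close>

lemma power_bound_from_derivative: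
  fixes F :: "real \<Rightarrow> real"
  assumes "\<And>t. t \<in> {a<..<b} \<Longrightarrow> (F has_real_derivative f t) (at t)" "F x0 = 0"
    and f: "\<And>t. t \<in> {a<..<b} \<Longrightarrow> \<bar>f t\<bar> \<le> C * \<bar>t - x0\<bar> ^ m"
    and x0: "x0 \<in> {a<..<b}" and x: "x \<in> {a<..<b}"
  shows "\<bar>F x\<bar> \<le> C * \<bar>x - x0\<bar> ^ Suc m / real (Suc m)"
proof -
  define r where "r = x - x0"
  define h where "h s = F (x0 + s * r)" for s
  define g where "g s = C * \<bar>r\<bar> ^ Suc m / real (Suc m) * s ^ Suc m" for s
  have seg: "x0 + s * r \<in> {a<..<b}" if "0 \<le> s" "s \<le> 1" for s
  proof -
    have "closed_segment x0 x \<subseteq> {a<..<b}" using x0 x by (intro closed_segment_subset) auto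
    moreover have "x0 + s * r = (1 - s) *\<^sub>R x0 + s *\<^sub>R x" by (simp add: r_def algebra_simps)
    ultimately show ?thesis using that unfolding closed_segment_def by blast
  qed
  have h': "(h has_real_derivative f (x0 + s * r) * r) (at s)" if "0 \<le> s" "s \<le> 1" for s
  proof -
    have "((\<lambda>s. x0 + s * r) has_real_derivative r) (at s)" by (auto intro!: derivative_eq_intros)
    from DERIV_chain2[OF assms(1)[OF seg[OF that]] this] show ?thesis unfolding h_def[abs_def] .
  qed
  have g': "(g has_real_derivative C * \<bar>r\<bar> ^ Suc m * s ^ m) (at s)" for s
  proof -
    have "((\<lambda>s. s ^ Suc m) has_real_derivative real (Suc m) * s ^ m) (at s)"
      using DERIV_pow[of "Suc m" s] by simp
    from DERIV_cmult[OF this, of "C * \<bar>r\<bar> ^ Suc m / real (Suc m)"] show ?thesis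
      unfolding g_def[abs_def] by (simp add: field_simps del: of_nat_Suc power_Suc)
  qed
  have b: "\<bar>f (x0 + s * r) * r\<bar> \<le> C * \<bar>r\<bar> ^ Suc m * s ^ m" if "0 \<le> s" "s \<le> 1" for s
  proof -
    have "\<bar>f (x0 + s * r)\<bar> \<le> C * (s ^ m * \<bar>r\<bar> ^ m)"
      using f[OF seg[OF that]] that by (simp add: abs_mult power_mult_distrib)
    then have "\<bar>f (x0 + s * r)\<bar> * \<bar>r\<bar> \<le> C * (s ^ m * \<bar>r\<bar> ^ m) * \<bar>r\<bar>" by (intro mult_right_mono) auto
    then show ?thesis by (simp add: abs_mult algebra_simps)
  qed
  have "g 0 - h 0 \<le> g 1 - h 1"
  proof (rule DERIV_nonneg_imp_nondecreasing[of 0 1 "\<lambda>s. g s - h s"])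
    fix s :: real assume s: "0 \<le> s" "s \<le> 1"
    show "\<exists>y. ((\<lambda>s. g s - h s) has_real_derivative y) (at s) \<and> 0 \<le> y"
      using DERIV_diff[OF g' h'[OF s]] b[OF s] by fastforce
  qed simp
  moreover have "g 0 + h 0 \<le> g 1 + h 1"
  proof (rule DERIV_nonneg_imp_nondecreasing[of 0 1 "\<lambda>s. g s + h s"])
    fix s :: real assume s: "0 \<le> s" "s \<le> 1"
    show "\<exists>y. ((\<lambda>s. g s + h s) has_real_derivative y) (at s) \<and> 0 \<le> y"
      using DERIV_add[OF g' h'[OF s]] b[OF s] by fastforce
  qed simp
  ultimately have "\<bar>h 1\<bar> \<le> g 1" using assms(2) by (simp add: g_def h_def)
  then show ?thesis by (simp add: g_def h_def r_def)
qed

text \<open>The right-hand side of the first order system for \<open>(y, y', ..., y\<^sup>(\<^sup>n\<^sup>-\<^sup>1\<^sup>))\<close>.\<close>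

definition companion :: "nat \<Rightarrow> (nat \<Rightarrow> real \<Rightarrow> real) \<Rightarrow> (nat \<Rightarrow> real \<Rightarrow> real) \<Rightarrow> nat \<Rightarrow> real \<Rightarrow> real" where
  "companion n c u j x = (if Suc j < n then u (Suc j) x else - (\<Sum>k<n. c k x * u k x))"

lemma continuous_on_companion:
  assumes "\<And>j. j < n \<Longrightarrow> continuous_on S (c j)" "\<And>j. j < n \<Longrightarrow> continuous_on S (u j)"
  shows "continuous_on S (companion n c u j)"
  unfolding companion_def[abs_def] using assms by (cases "Suc j < n") (auto intro!: continuous_intros)

lemma companion_bound:
  assumes "\<And>j. j < n \<Longrightarrow> \<bar>u j x\<bar> \<le> M" "0 \<le> M" "(\<Sum>k<n. \<bar>c k x\<bar>) \<le> K" "1 \<le> K"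
  shows "\<bar>companion n c u j x\<bar> \<le> K * M"
proof (cases "Suc j < n")
  case True
  then have "\<bar>companion n c u j x\<bar> \<le> 1 * M" using assms(1)[of "Suc j"] by (simp add: companion_def)
  also have "\<dots> \<le> K * M" using assms by (intro mult_right_mono) auto
  finally show ?thesis .
next
  case False
  then have "\<bar>companion n c u j x\<bar> \<le> (\<Sum>k<n. \<bar>c k x\<bar> * \<bar>u k x\<bar>)"
    by (simp add: companion_def abs_mult[symmetric] sum_abs)
  also have "\<dots> \<le> (\<Sum>k<n. \<bar>c k x\<bar> * M)" using assms(1) by (intro sum_mono mult_left_mono) auto
  also have "\<dots> \<le> K * M" using assms by (simp add: sum_distrib_right[symmetric] mult_right_mono)
  finally show ?thesis .
qed

lemma coefficient_bound:
  fixes c :: "nat \<Rightarrow> real \<Rightarrow> real"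
  assumes "\<And>j. j < n \<Longrightarrow> continuous_on {a..b} (c j)"
  obtains K where "1 \<le> K" "\<And>x. x \<in> {a..b} \<Longrightarrow> (\<Sum>k<n. \<bar>c k x\<bar>) \<le> K"
proof -
  have "continuous_on {a..b} (\<lambda>x. \<Sum>k<n. \<bar>c k x\<bar>)" using assms by (auto intro!: continuous_intros)
  then have "bounded ((\<lambda>x. \<Sum>k<n. \<bar>c k x\<bar>) ` {a..b})"
    by (intro compact_imp_bounded compact_continuous_image) auto
  then obtain B where "\<forall>z\<in>(\<lambda>x. \<Sum>k<n. \<bar>c k x\<bar>) ` {a..b}. norm z \<le> B" unfolding bounded_iff by blast
  then have "norm (\<Sum>k<n. \<bar>c k x\<bar>) \<le> B" if "x \<in> {a..b}" for x using that by blast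
  then show ?thesis by (intro that[of "max 1 B"]) force+
qed

text \<open>One step of the Picard iteration gains a factor \<open>K r / (m + 1)\<close> at distance \<open>r\<close> from the base point. The same estimate gives convergence of the
  series of iterates and, applied to a solution with zero initial values, its uniqueness.\<close>

lemma picard_step_bound:
  assumes K: "1 \<le> K" "\<And>x. x \<in> {a<..<b} \<Longrightarrow> (\<Sum>k<n. \<bar>c k x\<bar>) \<le> K"
    and u: "\<And>j x. j < n \<Longrightarrow> x \<in> {a<..<b} \<Longrightarrow> \<bar>u j x\<bar> \<le> M * (K * \<bar>x - x0\<bar>) ^ m / fact m"
    and "0 \<le> M" "x0 \<in> {a<..<b}"
    and w: "\<And>j x. j < n \<Longrightarrow> x \<in> {a<..<b} \<Longrightarrow> (w j has_real_derivative companion n c u j x) (at x)"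
      "\<And>j. j < n \<Longrightarrow> w j x0 = 0"
    and "j < n" "x \<in> {a<..<b}"
  shows "\<bar>w j x\<bar> \<le> M * (K * \<bar>x - x0\<bar>) ^ Suc m / fact (Suc m)"
proof -
  have "\<bar>companion n c u j t\<bar> \<le> (M * K ^ Suc m / fact m) * \<bar>t - x0\<bar> ^ m" if "t \<in> {a<..<b}" for t
  proof -
    have "\<bar>companion n c u j t\<bar> \<le> K * (M * (K * \<bar>t - x0\<bar>) ^ m / fact m)"
      using u[OF _ that] K(1) K(2)[OF that] assms(4) by (intro companion_bound) auto
    then show ?thesis by (simp add: power_mult_distrib mult_ac)
  qed
  from power_bound_from_derivative[of a b "w j" "companion n c u j" x0, OF w(1)[OF \<open>j < n\<close>] w(2)[OF \<open>j < n\<close>] this assms(5) \<open>x \<in> _\<close>]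
  have "\<bar>w j x\<bar> \<le> M * K ^ Suc m / fact m * \<bar>x - x0\<bar> ^ Suc m / real (Suc m)" .
  also have "\<dots> = M * (K * \<bar>x - x0\<bar>) ^ Suc m / fact (Suc m)"
    unfolding power_mult_distrib fact_Suc by (simp add: mult_ac del: power_Suc)
  finally show ?thesis .
qed

theorem linear_ode_unique:
  assumes I: "open_interval I" "\<And>j. j < n \<Longrightarrow> smooth_on I (c j)" "x0 \<in> I"
    and y: "smooth_on I y" "\<And>x. x \<in> I \<Longrightarrow> linear_op n c y x = 0" "\<And>j. j < n \<Longrightarrow> (deriv ^^ j) y x0 = 0"
    and "n > 0" "x \<in> I"
  shows "y x = 0"
proof -
  have o: "open I" using I(1) by (simp add: open_interval_def)
  obtain a b where ab: "{a..b} \<subseteq> I" "a < x0" "x0 < b" "a < x" "x < b"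
    using open_interval_compact_part[OF I(1,3) \<open>x \<in> I\<close>] .
  have cont: "continuous_on {a..b} (c j)" if "j < n" for j
    using smooth_on_imp_continuous_on[OF I(2)[OF that]] ab(1) by (rule continuous_on_subset)
  from coefficient_bound[where n = n and c = c, OF cont]
  obtain K where K: "1 \<le> K" "\<And>x. x \<in> {a..b} \<Longrightarrow> (\<Sum>k<n. \<bar>c k x\<bar>) \<le> K" by blast
  have conty: "continuous_on {a..b} ((deriv ^^ j) y)" for j
    using smooth_on_imp_continuous_on[OF smooth_on_funpow_deriv[OF o y(1)]] ab(1) by (rule continuous_on_subset)
  have "continuous_on {a..b} (\<lambda>x. \<Sum>j<n. \<bar>(deriv ^^ j) y x\<bar>)" using conty by (auto intro!: continuous_intros)
  then have "bounded ((\<lambda>x. \<Sum>j<n. \<bar>(deriv ^^ j) y x\<bar>) ` {a..b})"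
    by (intro compact_imp_bounded compact_continuous_image) auto
  then obtain M where "\<forall>z\<in>(\<lambda>x. \<Sum>j<n. \<bar>(deriv ^^ j) y x\<bar>) ` {a..b}. norm z \<le> M" unfolding bounded_iff by blast
  then have M: "norm (\<Sum>j<n. \<bar>(deriv ^^ j) y x\<bar>) \<le> M" if "x \<in> {a..b}" for x using that by blast
  have M0: "0 \<le> M" using M[of x0] ab by (meson atLeastAtMost_iff less_imp_le norm_ge_zero order_trans)
  have Mj: "\<bar>(deriv ^^ j) y x\<bar> \<le> M" if "j < n" "x \<in> {a..b}" for j x
  proof -
    have "\<bar>(deriv ^^ j) y x\<bar> \<le> (\<Sum>j<n. \<bar>(deriv ^^ j) y x\<bar>)" using that(1) by (intro member_le_sum) auto
    also have "\<dots> \<le> M" using M[OF that(2)] by simp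
    finally show ?thesis .
  qed
  have comp: "companion n c (\<lambda>j. (deriv ^^ j) y) j x = (deriv ^^ Suc j) y x" if "j < n" "x \<in> I" for j x
  proof (cases "Suc j < n")
    case False
    with that have "Suc j = n" by simp
    then show ?thesis using y(2)[OF that(2)] by (auto simp: companion_def linear_op_eq)
  qed (simp add: companion_def)
  have "\<bar>(deriv ^^ j) y x\<bar> \<le> M * (K * \<bar>x - x0\<bar>) ^ m / fact m" if "j < n" "x \<in> {a<..<b}" for j x m
    using that
  proof (induction m arbitrary: j x)
    case 0
    then show ?case using Mj[of j x] by simp
  next
    case (Suc m)
    show ?case
    proof (rule picard_step_bound[where c = c and n = n and u = "\<lambda>j. (deriv ^^ j) y" and w = "\<lambda>j. (deriv ^^ j) y", OF K(1) _ Suc.IH])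
      fix j x assume jx: "j < n" "x \<in> {a<..<b}"
      then have "x \<in> I" using ab(1) by auto
      show "((deriv ^^ j) y has_real_derivative companion n c (\<lambda>j. (deriv ^^ j) y) j x) (at x)"
        unfolding comp[OF jx(1) \<open>x \<in> I\<close>] using smooth_on_funpow_DERIV[OF o y(1) \<open>x \<in> I\<close>] .
    next
      show "(\<Sum>k<n. \<bar>c k x\<bar>) \<le> K" if "x \<in> {a<..<b}" for x using that K(2) by simp
      show "(deriv ^^ j) y x0 = 0" if "j < n" for j using y(3)[OF that] .
    qed (use M0 ab(2,3) Suc.prems in simp_all)
  qed
  note bound = this
  have "\<bar>y x\<bar> \<le> M * ((K * \<bar>x - x0\<bar>) ^ m / fact m)" for m
  proof -
    have "\<bar>(deriv ^^ 0) y x\<bar> \<le> M * (K * \<bar>x - x0\<bar>) ^ m / fact m"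
      by (rule bound) (use \<open>n > 0\<close> ab(4,5) in simp_all)
    then show ?thesis by simp
  qed
  moreover have "(\<lambda>m. M * ((K * \<bar>x - x0\<bar>) ^ m / fact m)) \<longlonglongrightarrow> M * 0"
    using summable_LIMSEQ_zero[OF summable_exp[of "K * \<bar>x - x0\<bar>"]]
    by (intro tendsto_mult tendsto_const) (simp add: divide_inverse mult.commute)
  ultimately have "\<bar>y x\<bar> \<le> M * 0" by (intro LIMSEQ_le_const) blast+
  then show "y x = 0" by simp
qed

primrec picard :: "nat \<Rightarrow> (nat \<Rightarrow> real \<Rightarrow> real) \<Rightarrow> real \<Rightarrow> (nat \<Rightarrow> real) \<Rightarrow> nat \<Rightarrow> nat \<Rightarrow> real \<Rightarrow> real" where
  "picard n c x0 v 0 = (\<lambda>j x. v j)"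
| "picard n c x0 v (Suc m) = (\<lambda>j. primitive x0 (companion n c (picard n c x0 v m) j))"

text \<open>The Picard iterates are written as a series, with terms defined on all of \<open>I\<close>. The estimates are needed on compact parts
  of \<open>I\<close> only, so the sum is a solution on the whole interval and no local solutions have to be glued.\<close>

theorem linear_ode_exists:
  assumes I: "open_interval I" "\<And>j. j < n \<Longrightarrow> smooth_on I (c j)" "x0 \<in> I" and "n > 0"
  obtains y where "smooth_on I y" "\<And>x. x \<in> I \<Longrightarrow> linear_op n c y x = 0" "\<And>j. j < n \<Longrightarrow> (deriv ^^ j) y x0 = v j"
proof -
  have o: "open I" using I(1) by (simp add: open_interval_def)
  let ?p = "picard n c x0 v"
  have cc: "continuous_on I (c j)" if "j < n" for j using smooth_on_imp_continuous_on[OF I(2)[OF that]] .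
  have p': "continuous_on I (?p m j) \<and> (\<forall>x\<in>I. (?p (Suc m) j has_real_derivative companion n c (?p m) j x) (at x))"
    if "j < n" for j m
    using that
  proof (induction m arbitrary: j)
    case 0
    have "continuous_on I (companion n c (?p 0) j)" by (intro continuous_on_companion cc) auto
    then show ?case using DERIV_primitive[OF I(1) _ I(3)] by simp
  next
    case (Suc m)
    have c1: "continuous_on I (?p (Suc m) j)" if "j < n" for j
      using Suc.IH[OF that] DERIV_isCont by (intro continuous_at_imp_continuous_on) blast
    then have "continuous_on I (companion n c (?p (Suc m)) j)" by (intro continuous_on_companion cc)
    with c1[OF Suc.prems] show ?case using DERIV_primitive[OF I(1) _ I(3)] by simp
  qed
  have p0: "?p (Suc m) j x0 = 0" for m j by simp
  define u where "u j x = (\<Sum>m. ?p m j x)" for j x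
  have main: "(\<lambda>m. ?p m j x) sums u j x \<and> (u j has_real_derivative companion n c u j x) (at x)" if j: "j < n" and x: "x \<in> I" for j x
  proof -
    obtain a b where ab: "{a..b} \<subseteq> I" "a < x0" "x0 < b" "a < x" "x < b"
      using open_interval_compact_part[OF I(1,3) x] .
    have sub: "{a<..<b} \<subseteq> I" using ab(1) by auto
    from coefficient_bound[where n = n and c = c, OF continuous_on_subset[OF cc ab(1)]]
    obtain K where K: "1 \<le> K" "\<And>x. x \<in> {a..b} \<Longrightarrow> (\<Sum>k<n. \<bar>c k x\<bar>) \<le> K" by blast
    define V where "V = (\<Sum>j<n. \<bar>v j\<bar>)"
    have V0: "0 \<le> V" unfolding V_def by (simp add: sum_nonneg)
    have bound: "\<bar>?p m j x\<bar> \<le> V * (K * \<bar>x - x0\<bar>) ^ m / fact m" if "j < n" "x \<in> {a<..<b}" for j x m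
      using that
    proof (induction m arbitrary: j x)
      case 0
      then show ?case unfolding V_def using member_le_sum[of j "{..<n}" "\<lambda>j. \<bar>v j\<bar>"] by simp
    next
      case (Suc m)
      show ?case
      proof (rule picard_step_bound[where c = c and n = n and u = "?p m" and w = "?p (Suc m)", OF K(1) _ Suc.IH])
        fix j x assume "j < n" "x \<in> {a<..<b}"
        with p'[of j m] sub show "(?p (Suc m) j has_real_derivative companion n c (?p m) j x) (at x)" by blast
      next
        show "?p (Suc m) j x0 = 0" for j by (rule p0)
        show "(\<Sum>k<n. \<bar>c k x\<bar>) \<le> K" if "x \<in> {a<..<b}" for x using that K(2) by simp
      qed (use V0 ab(2,3) Suc.prems in simp_all)
    qed
    define R where "R = K * (b - a)"
    have R: "V * (K * \<bar>x - x0\<bar>) ^ m / fact m \<le> V * (R ^ m / fact m)" if "x \<in> {a<..<b}" for x m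
    proof -
      have "K * \<bar>x - x0\<bar> \<le> R" unfolding R_def
      proof (rule mult_left_mono)
        have "a < x" "x < b" using that by simp_all
        with ab(2,3) show "\<bar>x - x0\<bar> \<le> b - a" by linarith
        show "0 \<le> K" using K(1) by linarith
      qed
      then have "(K * \<bar>x - x0\<bar>) ^ m \<le> R ^ m" 
        using K(1) by (intro power_mono mult_nonneg_nonneg) linarith+
      then have "(K * \<bar>x - x0\<bar>) ^ m / fact m \<le> R ^ m / fact m" by (rule divide_right_mono) simp
      from mult_left_mono[OF this V0] show ?thesis by simp
    qed
    have sumR: "summable (\<lambda>m. R ^ m / fact m)" using summable_exp[of R] by (simp add: divide_inverse mult.commute)
    have sums: "(\<lambda>m. ?p m j x) sums u j x" if "j < n" "x \<in> {a<..<b}" for j x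
    proof -
      have "summable (\<lambda>m. V * (R ^ m / fact m))" using sumR by (rule summable_mult)
      then have "summable (\<lambda>m. ?p m j x)"
        by (rule summable_comparison_test'[of _ 0]) (use order_trans[OF bound[OF that] R[OF that(2)]] in simp)
      then show ?thesis unfolding u_def by (rule summable_sums)
    qed
    define f' where "f' m x = (case m of 0 \<Rightarrow> 0 | Suc k \<Rightarrow> companion n c (?p k) j x)" for m x
    have f': "(?p m j has_real_derivative f' m t) (at t within {a<..<b})" if "t \<in> {a<..<b}" for m t
    proof (cases m)
      case (Suc k)
      have "t \<in> I" using sub that by blast
      then have "(?p (Suc k) j has_real_derivative companion n c (?p k) j t) (at t)" using p'[OF j, of k] by blast
      then show ?thesis unfolding Suc f'_def by (simp add: has_field_derivative_at_within del: picard.simps)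
    qed (simp add: f'_def)
    have f'b: "norm (f' m t) \<le> K * V * (R ^ (m - 1) / fact (m - 1))" if "t \<in> {a<..<b}" for m t
    proof (cases m)
      case 0
      then show ?thesis using K(1) V0 by (simp add: f'_def)
    next
      case (Suc k)
      have "\<bar>companion n c (?p k) j t\<bar> \<le> K * (V * (K * \<bar>t - x0\<bar>) ^ k / fact k)"
      proof (rule companion_bound[OF _ _ _ K(1)])
        show "\<bar>?p k i t\<bar> \<le> V * (K * \<bar>t - x0\<bar>) ^ k / fact k" if "i < n" for i using bound[OF that \<open>t \<in> _\<close>] .
        show "(\<Sum>k<n. \<bar>c k t\<bar>) \<le> K" using K(2) that by simp
      qed (use K(1) V0 in simp)
      also have "\<dots> \<le> K * (V * (R ^ k / fact k))" using R[OF that] K(1) by (intro mult_left_mono) auto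
      finally show ?thesis using Suc by (simp add: f'_def mult_ac)
    qed
    have "summable (\<lambda>m. K * V * (R ^ (m - 1) / fact (m - 1)))"
      using summable_mult[OF sumR, of "K * V"] by (subst summable_Suc_iff[symmetric]) simp
    then have unif: "uniformly_convergent_on {a<..<b} (\<lambda>m t. \<Sum>i<m. f' i t)"
      by (intro uniformly_convergentI[OF Weierstrass_m_test[OF f'b]])
    have "((\<lambda>x. \<Sum>m. ?p m j x) has_real_derivative (\<Sum>m. f' m x)) (at x)"
      by (rule has_field_derivative_series'(2)[OF _ f' unif, where ?x0.0 = x0])
         (use ab sums[OF j, of x0] in \<open>auto simp: sums_iff interior_open\<close>)
    moreover have "(\<lambda>m. f' m x) sums companion n c u j x"
    proof -
      have "(\<lambda>k. companion n c (?p k) j x) sums companion n c u j x"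
        unfolding companion_def using sums ab
        by (cases "Suc j < n") (auto intro!: sums_minus sums_sum sums_mult)
      then have "(\<lambda>k. f' (Suc k) x) sums companion n c u j x" by (simp add: f'_def)
      then show ?thesis by (subst (asm) sums_Suc_iff) (simp add: f'_def)
    qed
    ultimately show ?thesis using sums[OF j, of x] ab by (auto simp: sums_iff u_def[abs_def])
  qed
  have Ck: "Ck_on k I (u j)" if "j < n" for j k
    using that
  proof (induction k arbitrary: j)
    case 0
    have "isCont (u j) x" if "x \<in> I" for x using main[OF 0 that] DERIV_isCont by blast
    then show ?case by (simp add: continuous_at_imp_continuous_on)
  next
    case (Suc k)
    have "Ck_on k I (companion n c u j)"
    proof (cases "Suc j < n")
      case True
      then show ?thesis using Suc.IH[OF True] by (simp add: companion_def[abs_def])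
    next
      case False
      have "Ck_on k I (\<lambda>x. (- 1) *\<^sub>R (\<Sum>k<n. c k x *\<^sub>R u k x))"
        using Suc.IH I(2) by (intro Ck_on_scaleR[OF o] Ck_on_sum[OF o] Ck_on_const) (auto simp: smooth_on_def)
      with False show ?thesis by (simp add: companion_def[abs_def])
    qed
    then show ?case using main[OF Suc.prems] by (intro Ck_on_if_DERIV[OF o]) auto
  qed
  have D: "(deriv ^^ j) (u 0) x = u j x" if "j < n" "x \<in> I" for j x
    using that
  proof (induction j arbitrary: x)
    case (Suc j)
    have "(deriv ^^ Suc j) (u 0) x = companion n c u j x"
      by (rule funpow_deriv_step[OF o Suc.IH Suc.prems(2)]) (use main Suc.prems in auto)
    then show ?case using Suc.prems by (simp add: companion_def)
  qed simp
  have "(deriv ^^ n) (u 0) x = - (\<Sum>k<n. c k x * u k x)" if "x \<in> I" for x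
  proof -
    obtain m where n: "n = Suc m" using \<open>n > 0\<close> by (cases n) auto
    have "(deriv ^^ Suc m) (u 0) x = companion n c u m x"
      by (rule funpow_deriv_step[OF o D that]) (use main that n in auto)
    then show ?thesis by (simp add: companion_def n)
  qed
  then have "linear_op n c (u 0) x = 0" if "x \<in> I" for x
    unfolding linear_op_eq using D that by simp
  moreover have "smooth_on I (u 0)" using Ck[OF \<open>n > 0\<close>] by (simp add: smooth_on_def)
  moreover have "(deriv ^^ j) (u 0) x0 = v j" if "j < n" for j
  proof -
    have "(\<lambda>m. ?p m j x0) = (\<lambda>m. if m = 0 then v j else 0)"
    proof
      fix m show "?p m j x0 = (if m = 0 then v j else 0)" by (cases m) auto
    qed
    then have "(\<lambda>m. ?p m j x0) sums v j" using sums_single[of 0 "\<lambda>m. v j"] by simp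
    then have "u j x0 = v j" using main[OF that I(3)] sums_unique2 by blast
    then show ?thesis using D[OF that I(3)] by simp
  qed
  ultimately show ?thesis using that[of "u 0"] by blast
qed

section \<open>The dimension of the symmetry algebra\<close>

lemma sum_fun_apply: "(\<Sum>i\<in>A. f i) x = (\<Sum>i\<in>A. f i x)"
  by (induction A rule: infinite_finite_induct) auto

text \<open>\<open>N\<close> functionals that separate the points of \<open>S\<close> embed it into an \<open>N\<close>-dimensional space, so \<open>S\<close> has dimension \<open>N\<close> iff the
  embedding is onto. Additivity is asked for on \<open>S\<close> only, as the functionals of interest are derivatives; in the proof they
  are replaced by a linear map that agrees with them on a basis.\<close>

lemma dim_eq_iff_functionals_onto:
  fixes S :: "'a::real_vector set" and \<phi> :: "'a \<Rightarrow> nat \<Rightarrow> real"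
  assumes S: "subspace S"
    and add: "\<And>x y i. x \<in> S \<Longrightarrow> y \<in> S \<Longrightarrow> \<phi> (x + y) i = \<phi> x i + \<phi> y i"
    and scale: "\<And>r x i. x \<in> S \<Longrightarrow> \<phi> (r *\<^sub>R x) i = r * \<phi> x i"
    and inj: "\<And>x. x \<in> S \<Longrightarrow> (\<And>i. i < N \<Longrightarrow> \<phi> x i = 0) \<Longrightarrow> x = 0"
    and "N > 0"
  shows "dim S = N \<longleftrightarrow> (\<forall>v. \<exists>x\<in>S. \<forall>i<N. \<phi> x i = v i)"
proof
  have sumphi: "\<phi> (\<Sum>i\<in>A. u i *\<^sub>R X i) k = (\<Sum>i\<in>A. u i * \<phi> (X i) k) \<and> (\<Sum>i\<in>A. u i *\<^sub>R X i) \<in> S"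
    if "finite A" "\<And>i. i \<in> A \<Longrightarrow> X i \<in> S" for A :: "'b set" and u X k
    using that
  proof (induction A rule: finite_induct)
    case empty
    have "\<phi> 0 k = 0" using scale[OF subspace_0[OF S], of 0 k] by simp
    then show ?case using subspace_0[OF S] by simp
  next
    case (insert i A)
    then show ?case
      by (simp add: add scale subspace_scale[OF S] subspace_add[OF S])
  qed
  assume onto: "\<forall>v. \<exists>x\<in>S. \<forall>i<N. \<phi> x i = v i"
  have "\<forall>j. \<exists>x\<in>S. \<forall>i<N. \<phi> x i = (if i = j then 1 else 0)"
  proof
    fix j show "\<exists>x\<in>S. \<forall>i<N. \<phi> x i = (if i = j then 1 else 0)"
      using onto by (rule allE[where x = "\<lambda>i. if i = j then 1 else 0"])
  qed
  then obtain X where X: "\<And>j. X j \<in> S" "\<And>i j. i < N \<Longrightarrow> \<phi> (X j) i = (if i = j then 1 else 0)" by metis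
  have injX: "inj_on X {..<N}"
  proof (rule inj_onI)
    fix i j assume "i \<in> {..<N}" "j \<in> {..<N}" "X i = X j"
    then have "\<phi> (X i) i = \<phi> (X j) i" "i < N" by auto
    then show "i = j" using X(2) by (simp split: if_splits)
  qed
  show "dim S = N"
  proof (rule dim_unique)
    show "X ` {..<N} \<subseteq> S" using X by auto
    show "card (X ` {..<N}) = N" using injX by (simp add: card_image)
    show "independent (X ` {..<N})"
    proof (rule independent_if_scalars_zero)
      fix f x assume f: "(\<Sum>x\<in>X ` {..<N}. f x *\<^sub>R x) = 0" and "x \<in> X ` {..<N}"
      then obtain k where k: "k < N" "x = X k" by auto
      have "(\<Sum>i<N. f (X i) *\<^sub>R X i) = 0" using f injX by (simp add: sum.reindex)
      then have "\<phi> (\<Sum>i<N. f (X i) *\<^sub>R X i) k = 0" using scale[OF subspace_0[OF S], of 0 k] by simp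
      then have "(\<Sum>i<N. f (X i) * \<phi> (X i) k) = 0" using sumphi[of "{..<N}" X] X(1) by simp
      then show "f x = 0" using k X(2) by (simp add: if_distrib cong: if_cong)
    qed simp
    show "S \<subseteq> span (X ` {..<N})"
    proof
      fix x assume x: "x \<in> S"
      let ?s = "\<Sum>i<N. \<phi> x i *\<^sub>R X i"
      have s: "\<phi> ?s k = (\<Sum>i<N. \<phi> x i * \<phi> (X i) k)" "?s \<in> S" for k using sumphi[of "{..<N}" X] X(1) by auto
      have "x + (- 1) *\<^sub>R ?s = 0"
      proof (rule inj)
        show "x + (- 1) *\<^sub>R ?s \<in> S" using x s(2) subspace_add[OF S] subspace_scale[OF S] by blast
        fix k assume k: "k < N"
        have "(\<Sum>i<N. \<phi> x i * \<phi> (X i) k) = (\<Sum>i<N. if k = i then \<phi> x k else 0)"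
          by (intro sum.cong) (auto simp: X(2)[OF k])
        then have "\<phi> ?s k = \<phi> x k" using s(1)[of k] k by simp
        moreover have "\<phi> (x + (- 1) *\<^sub>R ?s) k = \<phi> x k + (- 1) * \<phi> ?s k"
          by (simp only: add[OF x subspace_scale[OF S s(2)]] scale[OF s(2)])
        ultimately show "\<phi> (x + (- 1) *\<^sub>R ?s) k = 0" by simp
      qed
      then have "x = ?s" by simp
      moreover have "?s \<in> span (X ` {..<N})" by (intro span_sum span_scale span_base) auto
      ultimately show "x \<in> span (X ` {..<N})" by simp
    qed
  qed
next
  assume d: "dim S = N"
  obtain B where B: "B \<subseteq> S" "independent B" "S \<subseteq> span B" "card B = N"
    using basis_exists[of S] d by metis
  have fB: "finite B" using B(4) \<open>N > 0\<close> card_gt_0_iff by metis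
  have SB: "S = span B" using B(1,3) span_minimal[OF B(1) S] by blast
  define f where "f x = (\<lambda>i. if i < N then \<phi> x i else 0)" for x
  obtain g where g: "linear g" "\<And>x. x \<in> B \<Longrightarrow> g x = f x"
    using linear_independent_extend[OF B(2), of f] by blast
  have f_lin: "f (x + y) = f x + f y" "f (r *\<^sub>R x) = r *\<^sub>R f x" if "x \<in> S" "y \<in> S" for x y r
    using that add scale by (auto simp: f_def fun_eq_iff scaleR_fun_def)
  have "subspace {x \<in> S. g x = f x}"
  proof (rule subspaceI)
    have "f 0 = 0" using f_lin(2)[OF subspace_0[OF S] subspace_0[OF S], of 0] by simp
    then show "0 \<in> {x \<in> S. g x = f x}" using subspace_0[OF S] linear_0[OF g(1)] by simp
  qed (use f_lin g(1) subspace_add[OF S] subspace_scale[OF S] in \<open>auto simp: linear_add linear_scale\<close>)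
  then have "span B \<subseteq> {x \<in> S. g x = f x}" using B(1) g(2) by (intro span_minimal) auto
  then have gf: "g x = f x" if "x \<in> S" for x using that SB by auto
  have g_inj: "inj_on g (span B)"
  proof -
    have "x = 0" if "x \<in> span B" "g x = 0" for x
    proof (rule inj)
      show "x \<in> S" using that SB by simp
      then have f0: "f x = 0" using gf that(2) by simp
      show "\<phi> x i = 0" if "i < N" for i using fun_cong[OF f0, of i] that by (simp add: f_def)
    qed
    then show ?thesis using linear_inj_on_span_iff_independent_image[OF g(1)] linear_inj_on_iff_eq_0[OF g(1) subspace_span] by blast
  qed
  have ind: "independent (g ` B)" using linear_independent_injective_image[OF g(1) B(2) g_inj] .
  have "inj_on g B" using g_inj span_superset by (rule inj_on_subset)
  then have card: "card (g ` B) = N" using B(4) by (simp add: card_image)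
  define e :: "nat \<Rightarrow> nat \<Rightarrow> real" where "e i = (\<lambda>k. if k = i then 1 else 0)" for i
  have trunc: "(\<lambda>i. if i < N then v i else 0) \<in> span (e ` {..<N})" for v :: "nat \<Rightarrow> real"
  proof -
    have "(\<lambda>i. if i < N then v i else 0) = (\<Sum>i<N. v i *\<^sub>R e i)"
      by (auto simp: fun_eq_iff sum_fun_apply scaleR_fun_def e_def if_distrib cong: if_cong)
    also have "\<dots> \<in> span (e ` {..<N})" by (intro span_sum span_scale span_base) auto
    finally show ?thesis .
  qed
  have gB: "g ` B \<subseteq> span (e ` {..<N})" using g(2) trunc by (auto simp: f_def)
  show "\<forall>v. \<exists>x\<in>S. \<forall>i<N. \<phi> x i = v i"
  proof
    fix v :: "nat \<Rightarrow> real"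
    let ?v = "\<lambda>i. if i < N then v i else 0"
    have "?v \<in> span (g ` B)"
    proof (rule ccontr)
      assume nin: "?v \<notin> span (g ` B)"
      then have "independent (insert ?v (g ` B))" using ind by (rule independent_insertI)
      moreover have "insert ?v (g ` B) \<subseteq> span (e ` {..<N})" using gB trunc by blast
      ultimately have "card (insert ?v (g ` B)) \<le> card (e ` {..<N})"
        using independent_span_bound[of "e ` {..<N}"] by blast
      also have "\<dots> \<le> N" using card_image_le[of "{..<N}" e] by simp
      finally show False using nin span_base[of ?v "g ` B"] fB card by (simp add: card_insert_if split: if_splits)
    qed
    then have "?v \<in> g ` S" using SB linear_span_image[OF g(1)] by simp
    then obtain x where x: "x \<in> S" "g x = ?v" by auto
    have "\<phi> x i = v i" if "i < N" for i
      using fun_cong[OF x(2)[unfolded gf[OF x(1)]], of i] that by (simp add: f_def)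
    with x(1) show "\<exists>x\<in>S. \<forall>i<N. \<phi> x i = v i" by blast
  qed
qed

lemma defect_comb:
  assumes S: "open S" "smooth_on S \<xi>" "smooth_on S \<xi>'" "smooth_on S a" "smooth_on S a'" "x \<in> S"
  shows "defect n c (\<lambda>x. \<xi> x + r * \<xi>' x) (\<lambda>x. a x + r * a' x) j x = defect n c \<xi> a j x + r * defect n c \<xi>' a' j x"
proof -
  have D: "(deriv ^^ k) (\<lambda>x. f x + r * g x) x = (deriv ^^ k) f x + r * (deriv ^^ k) g x"
    if "smooth_on S f" "smooth_on S g" for f g k
    using funpow_deriv_add[OF S(1) that(1) smooth_on_mult[OF S(1) smooth_on_const that(2)] S(6)]
      funpow_deriv_cmult[OF S(1) that(2) S(6)] by simp
  have D1: "deriv (\<lambda>x. \<xi> x + r * \<xi>' x) x = deriv \<xi> x + r * deriv \<xi>' x" using D[OF S(2,3), of 1] by simp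
  show ?thesis
    unfolding defect_def D[OF S(2,3)] D[OF S(4,5)] D1
    by (simp add: algebra_simps sum.distrib sum_subtractf sum_distrib_left del: funpow.simps)
qed

lemma symmetry_pair_comb:
  assumes "open S" "symmetry_pair n S c \<xi> a" "symmetry_pair n S c \<xi>' a'"
  shows "symmetry_pair n S c (\<lambda>x. \<xi> x + r * \<xi>' x) (\<lambda>x. a x + r * a' x)"
proof -
  have s: "smooth_on S \<xi>" "smooth_on S \<xi>'" "smooth_on S a" "smooth_on S a'"
    using assms by (simp_all add: symmetry_pair_def)
  have "smooth_on S (\<lambda>x. f x + r * g x)" if "smooth_on S f" "smooth_on S g" for f g :: "real \<Rightarrow> real"
    using that by (intro smooth_intros assms(1))
  from this[OF s(1,2)] this[OF s(3,4)]
  have "smooth_on S (\<lambda>x. \<xi> x + r * \<xi>' x)" "smooth_on S (\<lambda>x. a x + r * a' x)" .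
  then show ?thesis
    using assms(2,3) unfolding symmetry_pair_def by (simp add: defect_comb[OF assms(1) s])
qed

text \<open>By the two leading determining equations \<open>\<xi>\<close> solves a linear equation of order three, and \<open>a'\<close> is determined by \<open>\<xi>\<close>.\<close>

lemma symmetry_pair_zero:
  assumes "n \<ge> 3" "open_interval S" and c: "\<And>j. j < n \<Longrightarrow> smooth_on S (c j)" and p: "symmetry_pair n S c \<xi> a"
    and x0: "x0 \<in> S" "\<And>k. k < 3 \<Longrightarrow> (deriv ^^ k) \<xi> x0 = 0" "a x0 = 0" and x: "x \<in> S"
  shows "\<xi> x = 0" "a x = 0"
proof -
  have o: "open S" and i: "is_interval S" using assms(2) by (simp_all add: open_interval_def)
  have s: "smooth_on S \<xi>" "smooth_on S a" using p by (simp_all add: symmetry_pair_def)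
  define K where "K = real n * (real n - 1) * (real n + 1) / 12"
  have K: "K \<noteq> 0" using assms(1) by (simp add: K_def)
  let ?B = "laguerre_invariant n c"
  have B: "smooth_on S ?B" by (rule smooth_on_laguerre_invariant[OF o assms(1)]) (rule c)
  define d where "d j = (if j = 0 then (\<lambda>x. deriv ?B x / K) else if j = 1 then (\<lambda>x. 2 * ?B x / K) else (\<lambda>x. 0))" for j :: nat
  have xi0: "\<xi> x = 0" if "x \<in> S" for x
  proof (rule linear_ode_unique[where n = 3 and c = d, OF assms(2) _ x0(1) s(1) _ x0(2) _ that])
    show "smooth_on S (d j)" for j unfolding d_def using B o K by (auto intro!: smooth_intros)
    fix x assume "x \<in> S"
    have "K * deriv (deriv (deriv \<xi>)) x + 2 * ?B x * deriv \<xi> x + deriv ?B x * \<xi> x = 0"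
      unfolding K_def by (rule symmetry_pair_second[OF assms(1) o c p \<open>x \<in> S\<close>])
    then have "deriv (deriv (deriv \<xi>)) x + 2 * ?B x / K * deriv \<xi> x + deriv ?B x / K * \<xi> x = 0"
      using K by (simp add: field_simps)
    then show "linear_op 3 d \<xi> x = 0"
      by (simp add: linear_op_eq numeral_3_eq_3 d_def)
  qed auto
  then show "\<xi> x = 0" using x .
  have z: "(deriv ^^ k) \<xi> x = 0" if "x \<in> S" for x k
    using funpow_deriv_cong[OF o, of \<xi> "\<lambda>x. 0" x k] xi0 that by (simp add: funpow_deriv_const)
  have "deriv a x = 0" if "x \<in> S" for x
    using symmetry_pair_first[OF assms(1) p that] z[OF that, of 0] z[OF that, of 1] z[OF that, of 2]
    by (simp add: numeral_2_eq_2)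
  then have "(a has_real_derivative 0) (at x within S)" if "x \<in> S" for x
    using smooth_on_DERIV[OF s(2) that] that by (simp add: has_field_derivative_at_within)
  then obtain k where "\<And>x. x \<in> S \<Longrightarrow> a x = k"
    using has_field_derivative_zero_constant[of S a] i is_interval_convex_1 by blast
  then show "a x = 0" using x0(1,3) x by force
qed

text \<open>The \<open>n + 4\<close> initial values of a symmetry: those of \<open>b\<close> first, then those of \<open>\<xi>\<close>, and \<open>a(x\<^sub>0)\<close> as the last one.\<close>

definition field_jet :: "nat \<Rightarrow> real \<Rightarrow> vfield \<Rightarrow> nat \<Rightarrow> real" where
  "field_jet n x0 X i =
    (if i < n then (deriv ^^ i) (\<lambda>x. snd (X (x, 0))) x0
     else if i < n + 3 then (deriv ^^ (i - n)) (\<lambda>x. fst (X (x, 0))) x0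
     else snd (X (x0, 1)) - snd (X (x0, 0)))"

lemma field_jet_affine_field:
  assumes "open I" "x0 \<in> I"
  shows "field_jet n x0 (affine_field I \<xi> a b) i =
    (if i < n then (deriv ^^ i) b x0 else if i < n + 3 then (deriv ^^ (i - n)) \<xi> x0 else a x0)"
proof -
  have "(deriv ^^ k) (\<lambda>x. snd (affine_field I \<xi> a b (x, 0))) x0 = (deriv ^^ k) b x0"
    "(deriv ^^ k) (\<lambda>x. fst (affine_field I \<xi> a b (x, 0))) x0 = (deriv ^^ k) \<xi> x0" for k
    by (rule funpow_deriv_cong[OF assms(1) _ assms(2)], simp add: affine_field_def)+
  then show ?thesis using assms(2) by (simp add: field_jet_def affine_field_def)
qed

lemma field_jet_linear:
  assumes "open I" "x0 \<in> I" "smooth_on (I \<times> UNIV) X" "smooth_on (I \<times> UNIV) Y"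
  shows "field_jet n x0 (X + Y) i = field_jet n x0 X i + field_jet n x0 Y i"
    and "field_jet n x0 (r *\<^sub>R X) i = r * field_jet n x0 X i"
proof -
  have s: "smooth_on I (\<lambda>x. fst (Z (x, 0)))" "smooth_on I (\<lambda>x. snd (Z (x, 0)))" if "smooth_on (I \<times> UNIV) Z" for Z :: vfield
    using smooth_on_vfield_along[OF assms(1) that assms(1) order_refl smooth_on_const, of 0] assms(1)
    by (auto intro!: smooth_intros)
  show "field_jet n x0 (X + Y) i = field_jet n x0 X i + field_jet n x0 Y i"
    using funpow_deriv_add[OF assms(1) s(1)[OF assms(3)] s(1)[OF assms(4)] assms(2)]
      funpow_deriv_add[OF assms(1) s(2)[OF assms(3)] s(2)[OF assms(4)] assms(2)]
    by (simp add: field_jet_def)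
  show "field_jet n x0 (r *\<^sub>R X) i = r * field_jet n x0 X i"
    using funpow_deriv_cmult[OF assms(1) s(1)[OF assms(3)] assms(2), of _ r]
      funpow_deriv_cmult[OF assms(1) s(2)[OF assms(3)] assms(2), of _ r]
    by (simp add: field_jet_def scaleR_fun_def algebra_simps)
qed

lemma affine_field_comb:
  "affine_field I \<xi> a b + r *\<^sub>R affine_field I \<xi>' a' b' =
   affine_field I (\<lambda>x. \<xi> x + r * \<xi>' x) (\<lambda>x. a x + r * a' x) (\<lambda>x. b x + r * b' x)"
  by (auto simp: fun_eq_iff affine_field_def scaleR_fun_def algebra_simps)

lemma symmetry_algebra_iff:
  assumes "n \<ge> 3" "open I" and c: "\<And>j. j < n \<Longrightarrow> smooth_on I (c j)"
  shows "X \<in> symmetry_algebra n I (linear_ode n c) \<longleftrightarrow>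
    (\<exists>\<xi> a b. X = affine_field I \<xi> a b \<and> symmetry_pair n I c \<xi> a \<and> smooth_on I b \<and> (\<forall>x\<in>I. linear_op n c b x = 0))"
proof -
  have "symmetry_algebra n I (linear_ode n c) =
    {affine_field I \<xi> a b | \<xi> a b. symmetry_pair n I c \<xi> a \<and> smooth_on I b \<and> (\<forall>x\<in>I. linear_op n c b x = 0)}"
    by (rule symmetry_algebra_eq[OF assms(1,2)]) (rule c)
  then show ?thesis by blast
qed

lemma subspace_symmetry_algebra:
  assumes "n \<ge> 3" "open I" and c: "\<And>j. j < n \<Longrightarrow> smooth_on I (c j)"
  shows "subspace (symmetry_algebra n I (linear_ode n c))" (is "subspace ?S")
proof -
  have eq: "X \<in> ?S \<longleftrightarrow>
    (\<exists>\<xi> a b. X = affine_field I \<xi> a b \<and> symmetry_pair n I c \<xi> a \<and> smooth_on I b \<and> (\<forall>x\<in>I. linear_op n c b x = 0))" for X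
    by (rule symmetry_algebra_iff[OF assms(1,2)]) (rule c)
  have comb: "X + r *\<^sub>R Y \<in> ?S" if XY: "X \<in> ?S" "Y \<in> ?S" for X Y r
  proof -
    obtain \<xi> a b where X: "X = affine_field I \<xi> a b" "symmetry_pair n I c \<xi> a" "smooth_on I b" "\<forall>x\<in>I. linear_op n c b x = 0"
      using XY(1) unfolding eq by blast
    obtain \<xi>' a' b' where Y: "Y = affine_field I \<xi>' a' b'" "symmetry_pair n I c \<xi>' a'" "smooth_on I b'" "\<forall>x\<in>I. linear_op n c b' x = 0"
      using XY(2) unfolding eq by blast
    have sb: "smooth_on I (\<lambda>x. r * b' x)" using Y(3) assms(2) by (intro smooth_intros)
    have "linear_op n c (\<lambda>x. b x + r * b' x) x = 0" if "x \<in> I" for x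
      using linear_op_add[OF assms(2) X(3) sb that] linear_op_cmult[OF assms(2) Y(3) that] X(4) Y(4) that by simp
    moreover have "smooth_on I (\<lambda>x. b x + r * b' x)" using smooth_on_add[OF assms(2) X(3) sb] .
    ultimately show ?thesis
      unfolding eq X(1) Y(1) affine_field_comb using symmetry_pair_comb[OF assms(2) X(2) Y(2)] by blast
  qed
  have "defect n c (\<lambda>x. 0) (\<lambda>x. 0) j x = 0" for j x
    unfolding defect_def by (simp add: funpow_deriv_const)
  then have "symmetry_pair n I c (\<lambda>x. 0) (\<lambda>x. 0)" by (simp add: symmetry_pair_def smooth_on_const)
  moreover have "affine_field I (\<lambda>x. 0) (\<lambda>x. 0) (\<lambda>x. 0) = 0"
    by (auto simp: fun_eq_iff affine_field_def zero_prod_def)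
  moreover have "linear_op n c (\<lambda>x. 0) x = 0" for x
    by (simp add: linear_op_eq funpow_deriv_const)
  ultimately have 0: "0 \<in> ?S" unfolding eq using smooth_on_const[of I 0] by metis
  show ?thesis
    using 0 comb[of _ _ 1] comb[OF 0] by (intro subspaceI) auto
qed

text \<open>A symmetry is determined by the initial values of its three components, which solve linear equations of
  orders \<open>3\<close>, \<open>1\<close> and \<open>n\<close>. So the dimension is at most \<open>n + 4\<close>, with equality when all initial values occur;
  for the component in the solution space they always do.\<close>

theorem maximal_iff_all_initial_values:
  assumes "n \<ge> 3" "open_interval I" and c: "\<And>j. j < n \<Longrightarrow> smooth_on I (c j)" and x0: "x0 \<in> I"
  shows "has_maximal_symmetry_algebra n I c \<longleftrightarrow>
    (\<forall>v. \<exists>\<xi> a. symmetry_pair n I c \<xi> a \<and> (\<forall>k<3. (deriv ^^ k) \<xi> x0 = v k) \<and> a x0 = v 3)"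
proof -
  let ?S = "symmetry_algebra n I (linear_ode n c)"
  have o: "open I" using assms(2) by (simp add: open_interval_def)
  have eq: "X \<in> ?S \<longleftrightarrow>
    (\<exists>\<xi> a b. X = affine_field I \<xi> a b \<and> symmetry_pair n I c \<xi> a \<and> smooth_on I b \<and> (\<forall>x\<in>I. linear_op n c b x = 0))" for X
    by (rule symmetry_algebra_iff[OF assms(1) o]) (rule c)
  have sm: "smooth_on (I \<times> UNIV) X" if "X \<in> ?S" for X using that by (simp add: symmetry_algebra_def)
  have "has_maximal_symmetry_algebra n I c \<longleftrightarrow> (\<forall>v. \<exists>X\<in>?S. \<forall>i<n + 4. field_jet n x0 X i = v i)"
    unfolding has_maximal_symmetry_algebra_def
  proof (rule dim_eq_iff_functionals_onto)
    show "subspace ?S" by (rule subspace_symmetry_algebra[OF assms(1) o]) (rule c)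
    show "field_jet n x0 (X + Y) i = field_jet n x0 X i + field_jet n x0 Y i" if "X \<in> ?S" "Y \<in> ?S" for X Y i
      using field_jet_linear(1)[OF o x0] sm that by blast
    show "field_jet n x0 (r *\<^sub>R X) i = r * field_jet n x0 X i" if "X \<in> ?S" for r X i
      using field_jet_linear(2)[OF o x0] sm that by blast
    fix X assume X: "X \<in> ?S" and z: "\<And>i. i < n + 4 \<Longrightarrow> field_jet n x0 X i = 0"
    obtain \<xi> a b where p: "X = affine_field I \<xi> a b" "symmetry_pair n I c \<xi> a" "smooth_on I b" "\<And>x. x \<in> I \<Longrightarrow> linear_op n c b x = 0"
      using X unfolding eq by blast
    note z' = z[unfolded p(1) field_jet_affine_field[OF o x0]]
    have "(deriv ^^ j) b x0 = 0" if "j < n" for j using z'[of j] that by simp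
    from linear_ode_unique[where c = c and n = n, OF assms(2) c x0 p(3,4) this] assms(1)
    have b: "b x = 0" if "x \<in> I" for x using that by simp
    have "(deriv ^^ k) \<xi> x0 = 0" if "k < 3" for k using z'[of "n + k"] that by simp
    moreover have "a x0 = 0" using z'[of "n + 3"] by simp
    ultimately have "\<xi> x = 0" "a x = 0" if "x \<in> I" for x
      using symmetry_pair_zero[where c = c, OF assms(1,2) c p(2) x0] that by blast+
    with b show "X = 0" by (auto simp: p(1) fun_eq_iff affine_field_def zero_prod_def)
  qed simp
  also have "\<dots> \<longleftrightarrow> (\<forall>v. \<exists>\<xi> a. symmetry_pair n I c \<xi> a \<and> (\<forall>k<3. (deriv ^^ k) \<xi> x0 = v k) \<and> a x0 = v 3)"
  proof safe
    fix v :: "nat \<Rightarrow> real"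
    assume "\<forall>v. \<exists>X\<in>?S. \<forall>i<n + 4. field_jet n x0 X i = v i"
    then have "\<exists>X\<in>?S. \<forall>i<n + 4. field_jet n x0 X i = v (i - n)"
      by (rule allE[where x = "\<lambda>i. v (i - n)"])
    then obtain X where X: "X \<in> ?S" "\<And>i. i < n + 4 \<Longrightarrow> field_jet n x0 X i = v (i - n)"
      by blast
    obtain \<xi> a b where p: "X = affine_field I \<xi> a b" "symmetry_pair n I c \<xi> a"
      using X(1) unfolding eq by blast
    note z' = X(2)[unfolded p(1) field_jet_affine_field[OF o x0]]
    have "(deriv ^^ k) \<xi> x0 = v k" if "k < 3" for k using z'[of "n + k"] that by simp
    moreover have "a x0 = v 3" using z'[of "n + 3"] by simp
    ultimately show "\<exists>\<xi> a. symmetry_pair n I c \<xi> a \<and> (\<forall>k<3. (deriv ^^ k) \<xi> x0 = v k) \<and> a x0 = v 3"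
      using p(2) by blast
  next
    fix v :: "nat \<Rightarrow> real"
    assume "\<forall>v. \<exists>\<xi> a. symmetry_pair n I c \<xi> a \<and> (\<forall>k<3. (deriv ^^ k) \<xi> x0 = v k) \<and> a x0 = v 3"
    from this[rule_format, of "\<lambda>k. v (n + k)"]
    obtain \<xi> a where p: "symmetry_pair n I c \<xi> a" "\<And>k. k < 3 \<Longrightarrow> (deriv ^^ k) \<xi> x0 = v (n + k)" "a x0 = v (n + 3)"
      by blast
    obtain b where b: "smooth_on I b" "\<And>x. x \<in> I \<Longrightarrow> linear_op n c b x = 0" "\<And>j. j < n \<Longrightarrow> (deriv ^^ j) b x0 = v j"
      using linear_ode_exists[where n = n and c = c and v = v, OF assms(2) c x0] assms(1) by auto
    have "affine_field I \<xi> a b \<in> ?S" unfolding eq using p(1) b(1,2) by blast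
    moreover have "field_jet n x0 (affine_field I \<xi> a b) i = v i" if "i < n + 4" for i
    proof -
      consider "i < n" | "n \<le> i" "i < n + 3" | "i = n + 3" using \<open>i < n + 4\<close> by linarith
      then show ?thesis
      proof cases
        case 2
        then show ?thesis using p(2)[of "i - n"] by (simp add: field_jet_affine_field[OF o x0])
      qed (simp_all add: field_jet_affine_field[OF o x0] b(3) p(3))
    qed
    ultimately show "\<exists>X\<in>?S. \<forall>i<n + 4. field_jet n x0 X i = v i" by blast
  qed
  finally show ?thesis .
qed

section \<open>Change of variables\<close>

text \<open>A derivative without zeros makes \<open>f\<close> injective by the mean value theorem, and an injective continuous function on an
  interval is open.\<close>

lemma diffeo_inverse:
  fixes f :: "real \<Rightarrow> real"
  assumes "open_interval J" "smooth_on J f" "\<forall>z\<in>J. deriv f z \<noteq> 0"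
  shows "open_interval (f ` J)" "\<And>z. z \<in> J \<Longrightarrow> inv_into J f (f z) = z"
    "smooth_on (f ` J) (inv_into J f)"
    "\<And>z. z \<in> J \<Longrightarrow> (inv_into J f has_real_derivative inverse (deriv f z)) (at (f z))"
proof -
  have o: "open J" and i: "is_interval J" and ne: "J \<noteq> {}" using assms(1) by (auto simp: open_interval_def)
  have cont: "continuous_on J f" by (rule smooth_on_imp_continuous_on[OF assms(2)])
  have lt: "f z \<noteq> f w" if "z \<in> J" "w \<in> J" "z < w" for z w
  proof -
    have sub: "t \<in> J" if "z \<le> t" "t \<le> w" for t
      using i \<open>z \<in> J\<close> \<open>w \<in> J\<close> that unfolding is_interval_1 by blast
    obtain t where "z < t" "t < w" "f w - f z = (w - z) * deriv f t"
      using MVT2[OF \<open>z < w\<close>, of f "deriv f"] smooth_on_DERIV[OF assms(2)] sub by blast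
    moreover have "deriv f t \<noteq> 0" using bspec[OF assms(3)] sub calculation by simp
    ultimately show ?thesis using \<open>z < w\<close> by auto
  qed
  have inj: "inj_on f J"
  proof (rule inj_onI)
    fix z w assume "z \<in> J" "w \<in> J" "f z = f w"
    then show "z = w" using lt[of z w] lt[of w z] by (cases z w rule: linorder_cases) auto
  qed
  show inv: "inv_into J f (f z) = z" if "z \<in> J" for z using inj that by simp
  have "open (f ` J)" using injective_eq_1d_open_map_UNIV[OF cont i] inj o by blast
  moreover have "is_interval (f ` J)"
    using connected_continuous_image[OF cont] i by (simp add: is_interval_connected_1)
  ultimately show oi: "open_interval (f ` J)" using ne by (simp add: open_interval_def)
  show D: "(inv_into J f has_real_derivative inverse (deriv f z)) (at (f z))" if "z \<in> J" for z
  proof -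
    have "(inv_into J f has_derivative (*) (inverse (deriv f z))) (at (f z))"
    proof (rule has_derivative_inverse_strong[OF o that cont inv])
      show "(f has_derivative (*) (deriv f z)) (at z)"
        using smooth_on_DERIV[OF assms(2) that] by (simp add: has_field_derivative_def)
      show "(*) (deriv f z) \<circ> (*) (inverse (deriv f z)) = id" using bspec[OF assms(3) that] by (auto simp: fun_eq_iff)
    qed
    then show ?thesis by (simp add: has_field_derivative_def)
  qed
  show "smooth_on (f ` J) (inv_into J f)"
  proof (rule smooth_on_inverse_function[OF o _ assms(2)])
    show "deriv f z \<noteq> 0" if "z \<in> J" for z using bspec[OF assms(3) that] .
    show "open (f ` J)" by fact
    show "inv_into J f y \<in> J" if "y \<in> f ` J" for y using that by (rule inv_into_into)
    show "(inv_into J f has_real_derivative inverse (deriv f (inv_into J f y))) (at y)" if y: "y \<in> f ` J" for y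
    proof -
      obtain z where "z \<in> J" "y = f z" using y by blast
      then show ?thesis using D[of z] inv[of z] by simp
    qed
  qed
qed

lemma transforms_toD:
  assumes "transforms_to n I c f g J d"
  shows "open_interval J" "open J" "\<And>j. j < n \<Longrightarrow> smooth_on J (d j)" "smooth_on J f" "\<And>z. z \<in> J \<Longrightarrow> deriv f z \<noteq> 0"
    "f ` J \<subseteq> I" "smooth_on J g" "\<And>z. z \<in> J \<Longrightarrow> g z \<noteq> 0" "\<forall>z\<in>J. deriv f z \<noteq> 0"
  using assms unfolding transforms_to_def by (simp_all add: open_interval_def)

text \<open>The multiplier of a transformation with its characteristic property, as a predicate so that it can be chosen once.\<close>

definition intertwiner ::
  "nat \<Rightarrow> (nat \<Rightarrow> real \<Rightarrow> real) \<Rightarrow> (real \<Rightarrow> real) \<Rightarrow> (real \<Rightarrow> real) \<Rightarrow> real set \<Rightarrow> (nat \<Rightarrow> real \<Rightarrow> real) \<Rightarrow> (real \<Rightarrow> real) \<Rightarrow> bool" where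
  "intertwiner n c f g J d \<mu> \<longleftrightarrow> (\<forall>z\<in>J. \<mu> z \<noteq> 0) \<and>
     (\<forall>y w. smooth_on (f ` J) y \<longrightarrow> smooth_on J w \<longrightarrow> (\<forall>z\<in>J. y (f z) = g z * w z) \<longrightarrow>
        (\<forall>z\<in>J. linear_op n c y (f z) = \<mu> z * linear_op n d w z))"

lemma intertwiner_exists: "transforms_to n I c f g J d \<Longrightarrow> \<exists>\<mu>. intertwiner n c f g J d \<mu>"
  unfolding transforms_to_def intertwiner_def by (elim conjE)

lemma intertwinerD:
  assumes "intertwiner n c f g J d \<mu>"
  shows "z \<in> J \<Longrightarrow> \<mu> z \<noteq> 0"
    and "smooth_on (f ` J) y \<Longrightarrow> smooth_on J w \<Longrightarrow> (\<And>z. z \<in> J \<Longrightarrow> y (f z) = g z * w z) \<Longrightarrow> z \<in> J \<Longrightarrow>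
       linear_op n c y (f z) = \<mu> z * linear_op n d w z"
  using assms unfolding intertwiner_def by simp_all

text \<open>A transformation acts on all functions, so reading it backwards is again a transformation.\<close>

lemma transforms_to_inverse:
  assumes t: "transforms_to n I c f g J d" and c: "\<And>j. j < n \<Longrightarrow> smooth_on I (c j)"
  defines "F \<equiv> inv_into J f"
  shows "transforms_to n J d F (\<lambda>x. inverse (g (F x))) (f ` J) c"
proof -
  note T = transforms_toD[OF t]
  note inv = diffeo_inverse[OF T(1,4,9), folded F_def]
  have o: "open (f ` J)" using inv(1) by (simp add: open_interval_def)
  obtain \<mu> where m: "intertwiner n c f g J d \<mu>" using intertwiner_exists[OF t] by blast
  note \<mu> = intertwinerD[OF m]
  have F: "F x \<in> J" "f (F x) = x" if "x \<in> f ` J" for x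
    using that inv(2) by auto
  have FJ: "F ` (f ` J) = J" using inv(2) by (force simp: image_image)
  have F': "deriv F x \<noteq> 0" if "x \<in> f ` J" for x
    using that DERIV_imp_deriv[OF inv(4)] T(5) by auto
  have gF: "smooth_on (f ` J) (\<lambda>x. g (F x))" using smooth_on_compose[OF o T(2,7) inv(3) F(1)] .
  have ig: "smooth_on (f ` J) (\<lambda>x. inverse (g (F x)))"
    using smooth_on_inverse[OF o gF] T(8) F(1) by blast
  have K: "linear_op n d y (F x) = inverse (\<mu> (F x)) * linear_op n c w x"
    if "smooth_on (F ` f ` J) y" "smooth_on (f ` J) w" "\<And>x. x \<in> f ` J \<Longrightarrow> y (F x) = inverse (g (F x)) * w x" "x \<in> f ` J" for y w x
  proof -
    have "w (f z) = g z * y z" if "z \<in> J" for z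
      using \<open>\<And>x. x \<in> f ` J \<Longrightarrow> y (F x) = inverse (g (F x)) * w x\<close>[of "f z"] that inv(2) T(8) by (simp add: field_simps)
    from \<mu>(2)[OF that(2) _ this F(1)[OF that(4)]] that(1) FJ
    have "linear_op n c w x = \<mu> (F x) * linear_op n d y (F x)" using F(2)[OF that(4)] by simp
    then show ?thesis using \<mu>(1)[OF F(1)[OF that(4)]] by (simp add: field_simps)
  qed
  have "\<exists>\<nu>. intertwiner n d F (\<lambda>x. inverse (g (F x))) (f ` J) c \<nu>"
    unfolding intertwiner_def
  proof (intro exI[of _ "\<lambda>x. inverse (\<mu> (F x))"] conjI ballI allI impI)
    show "inverse (\<mu> (F x)) \<noteq> 0" if "x \<in> f ` J" for x using \<mu>(1) F(1)[OF that] by simp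
    show "linear_op n d y (F x) = inverse (\<mu> (F x)) * linear_op n c w x"
      if "smooth_on (F ` f ` J) y" "smooth_on (f ` J) w" "\<forall>x\<in>f ` J. y (F x) = inverse (g (F x)) * w x" "x \<in> f ` J" for y w x
      using that(3) by (intro K[OF that(1,2) _ that(4)]) blast
  qed
  then show ?thesis
    unfolding transforms_to_def intertwiner_def
    using inv(1,3) F' FJ smooth_on_subset[OF c T(6)] T(8) F(1) ig by (intro conjI ballI allI impI) simp_all
qed

text \<open>The multiplier is differentiable at each point because near it the multiplier is a quotient of smooth functions,
  obtained from one test function that the new operator does not annihilate there.\<close>

lemma transforms_to_multiplier:
  assumes t: "transforms_to n I c f g J d" and c: "\<And>j. j < n \<Longrightarrow> smooth_on I (c j)"
  obtains \<mu> where "intertwiner n c f g J d \<mu>" "\<And>z. z \<in> J \<Longrightarrow> \<mu> differentiable (at z)"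
proof -
  note T = transforms_toD[OF t]
  note inv = diffeo_inverse[OF T(1,4,9)]
  let ?F = "inv_into J f"
  have o: "open (f ` J)" using inv(1) by (simp add: open_interval_def)
  have F: "?F x \<in> J" if "x \<in> f ` J" for x using that by (rule inv_into_into)
  obtain \<mu> where m: "intertwiner n c f g J d \<mu>" using intertwiner_exists[OF t] by blast
  note \<mu> = intertwinerD[OF m]
  have "\<mu> differentiable (at z)" if z: "z \<in> J" for z
  proof -
    let ?w = "hpow z n"
    let ?y = "\<lambda>x. g (?F x) * ?w (?F x)"
    have w: "smooth_on J ?w" by (rule smooth_on_hpow[OF T(2)])
    have y: "smooth_on (f ` J) ?y"
      by (intro smooth_on_mult[OF o] smooth_on_compose[OF o T(2) T(7) inv(3)] smooth_on_compose[OF o T(2) w inv(3)] F)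
    have eq: "linear_op n c ?y (f t) = \<mu> t * linear_op n d ?w t" if "t \<in> J" for t
      by (rule \<mu>(2)[OF y w _ that]) (simp add: inv(2))
    have smd: "smooth_on J (linear_op n d ?w)" by (intro smooth_on_linear_op T(2) w T(3))
    have "smooth_on (f ` J) (linear_op n c ?y)"
      by (intro smooth_on_linear_op o y smooth_on_subset[OF c T(6)])
    from smooth_on_compose[OF T(2) o this T(4)]
    have smc: "smooth_on J (\<lambda>t. linear_op n c ?y (f t))" by blast
    have one: "linear_op n d ?w z = 1" by (rule linear_op_hpow)
    have "isCont (linear_op n d ?w) z" using smooth_on_DERIV[OF smd z] by (rule DERIV_isCont)
    then have "\<forall>\<^sub>F t in nhds z. linear_op n d ?w t \<noteq> 0"
      using one tendsto_imp_eventually_ne[of "linear_op n d ?w" 1 "nhds z" 0] by (simp add: isCont_def tendsto_nhds_iff)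
    moreover have "\<forall>\<^sub>F t in nhds z. t \<in> J" using T(2) z eventually_nhds by blast
    ultimately have ev: "\<forall>\<^sub>F t in nhds z. linear_op n c ?y (f t) / linear_op n d ?w t = \<mu> t"
      by eventually_elim (simp add: eq)
    have "((\<lambda>t. linear_op n c ?y (f t) / linear_op n d ?w t) has_real_derivative
       (deriv (\<lambda>t. linear_op n c ?y (f t)) z * linear_op n d ?w z
         - linear_op n c ?y (f z) * deriv (linear_op n d ?w) z) / (linear_op n d ?w z * linear_op n d ?w z)) (at z)"
      by (rule DERIV_divide[OF smooth_on_DERIV[OF smc z] smooth_on_DERIV[OF smd z]]) (simp add: one)
    then have "(\<mu> has_real_derivative
       (deriv (\<lambda>t. linear_op n c ?y (f t)) z * linear_op n d ?w z
         - linear_op n c ?y (f z) * deriv (linear_op n d ?w) z) / (linear_op n d ?w z * linear_op n d ?w z)) (at z)"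
      using DERIV_cong_ev[OF refl ev refl] by blast
    then show ?thesis unfolding real_differentiable_def by blast
  qed
  with m show ?thesis using that by blast
qed

text \<open>A symmetry pair says that the operator \<open>a - \<xi> d/dx\<close> maps solutions to solutions. Under a change of variables
  this operator becomes one of the same kind.\<close>

lemma symmetry_pair_transport:
  assumes t: "transforms_to n I c f g J d" and c: "\<And>j. j < n \<Longrightarrow> smooth_on I (c j)"
    and p: "symmetry_pair n (f ` J) c \<xi> a"
  shows "symmetry_pair n J d (\<lambda>z. \<xi> (f z) / deriv f z) (\<lambda>z. a (f z) - \<xi> (f z) / deriv f z * (deriv g z / g z))"
    (is "symmetry_pair n J d ?\<zeta> ?\<alpha>")
proof -
  note T = transforms_toD[OF t]
  note inv = diffeo_inverse[OF T(1,4,9)]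
  let ?F = "inv_into J f"
  have o: "open (f ` J)" using inv(1) by (simp add: open_interval_def)
  have F: "?F x \<in> J" if "x \<in> f ` J" for x using that by (rule inv_into_into)
  have cs: "smooth_on (f ` J) (c j)" if "j < n" for j using smooth_on_subset[OF c[OF that] T(6)] .
  have s: "smooth_on (f ` J) \<xi>" "smooth_on (f ` J) a" using p by (simp_all add: symmetry_pair_def)
  have sf: "smooth_on J (\<lambda>z. h (f z))" if "smooth_on (f ` J) h" for h :: "real \<Rightarrow> real"
    using smooth_on_compose[OF T(2) o that T(4)] by blast
  have z_s: "smooth_on J ?\<zeta>" by (intro smooth_on_divide smooth_on_deriv T sf s)
  have a_s: "smooth_on J ?\<alpha>" by (intro smooth_on_diff smooth_on_mult smooth_on_divide smooth_on_deriv T sf s)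
  obtain \<mu> where m: "intertwiner n c f g J d \<mu>" and md: "\<And>z. z \<in> J \<Longrightarrow> \<mu> differentiable (at z)"
    using transforms_to_multiplier[where c = c, OF t c] by blast
  note \<mu> = intertwinerD[OF m]
  have "defect n d ?\<zeta> ?\<alpha> j z = 0" if "j < n" "z \<in> J" for j z
  proof (rule defect_zero_if_multiple[OF T(2) T(3) z_s a_s \<open>z \<in> J\<close> _ \<open>j < n\<close>,
       where l = "(a (f z) - real n * deriv \<xi> (f z)) - ?\<zeta> z * deriv \<mu> z / \<mu> z"])
    fix w :: "real \<Rightarrow> real" assume w: "smooth_on J w"
    define y where "y = (\<lambda>x. g (?F x) * w (?F x))"
    have y: "smooth_on (f ` J) y" unfolding y_def
      by (intro smooth_on_mult[OF o] smooth_on_compose[OF o T(2) T(7) inv(3)] smooth_on_compose[OF o T(2) w inv(3)] F)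
    have yf: "y (f t) = g t * w t" if "t \<in> J" for t using inv(2)[OF that] by (simp add: y_def)
    have L: "linear_op n c y (f t) = \<mu> t * linear_op n d w t" if "t \<in> J" for t
      by (rule \<mu>(2)[OF y w yf that])
    have y': "deriv y (f t) * deriv f t = deriv g t * w t + g t * deriv w t" if "t \<in> J" for t
    proof -
      have "((\<lambda>t. y (f t)) has_real_derivative deriv y (f t) * deriv f t) (at t)"
        using DERIV_chain2[OF smooth_on_DERIV[OF y] smooth_on_DERIV[OF T(4)]] that by blast
      then have "((\<lambda>t. g t * w t) has_real_derivative deriv y (f t) * deriv f t) (at t)"
        by (rule has_field_derivative_transform_within_open[OF _ T(2) that]) (rule yf)
      moreover have "((\<lambda>t. g t * w t) has_real_derivative deriv g t * w t + deriv w t * g t) (at t)"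
        by (rule DERIV_mult[OF smooth_on_DERIV[OF T(7) that] smooth_on_DERIV[OF w that]])
      ultimately have "deriv y (f t) * deriv f t = deriv g t * w t + deriv w t * g t" by (rule DERIV_unique)
      then show ?thesis by (simp only: mult.commute)
    qed
    let ?Q = "\<lambda>x. a x * y x - \<xi> x * deriv y x"
    let ?q = "\<lambda>z. ?\<alpha> z * w z - ?\<zeta> z * deriv w z"
    have Q: "smooth_on (f ` J) ?Q" and q: "smooth_on J ?q"
      by (intro smooth_on_diff smooth_on_mult smooth_on_deriv o s y T w z_s a_s)+
    have Qf: "?Q (f t) = g t * ?q t" if "t \<in> J" for t
    proof -
      have "deriv y (f t) = (deriv g t * w t + g t * deriv w t) / deriv f t"
        using y'[OF that] T(5)[OF that] by (simp add: field_simps)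
      then show ?thesis using T(5,8)[OF that] by (simp add: yf[OF that] field_simps)
    qed
    have LQ: "linear_op n c ?Q (f z) = \<mu> z * linear_op n d ?q z"
      by (rule \<mu>(2)[OF Q q Qf \<open>z \<in> J\<close>])
    have fz: "f z \<in> f ` J" using \<open>z \<in> J\<close> by blast
    have LQ': "linear_op n c ?Q (f z) = - \<xi> (f z) * deriv (linear_op n c y) (f z)
       + (a (f z) - real n * deriv \<xi> (f z)) * linear_op n c y (f z)"
    proof -
      have "linear_op n c ?Q (f z) + \<xi> (f z) * deriv (linear_op n c y) (f z)
        - (a (f z) - real n * deriv \<xi> (f z)) * linear_op n c y (f z) = (\<Sum>j<n. defect n c \<xi> a j (f z) * (deriv ^^ j) y (f z))"
        by (rule commutator_identity[OF o cs s y fz])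
      also have "\<dots> = 0" using p \<open>z \<in> J\<close> by (simp add: symmetry_pair_def)
      finally show ?thesis by simp
    qed
    have "smooth_on (f ` J) (linear_op n c y)" by (intro smooth_on_linear_op o y cs)
    then have "((\<lambda>t. linear_op n c y (f t)) has_real_derivative deriv (linear_op n c y) (f z) * deriv f z) (at z)"
      using DERIV_chain2[OF smooth_on_DERIV smooth_on_DERIV[OF T(4) \<open>z \<in> J\<close>]] fz by blast
    then have "((\<lambda>t. \<mu> t * linear_op n d w t) has_real_derivative deriv (linear_op n c y) (f z) * deriv f z) (at z)"
      by (rule has_field_derivative_transform_within_open[OF _ T(2) \<open>z \<in> J\<close>]) (rule L)
    moreover have "smooth_on J (linear_op n d w)" by (intro smooth_on_linear_op T(2) w T(3))
    then have "((\<lambda>t. \<mu> t * linear_op n d w t) has_real_derivative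
        deriv \<mu> z * linear_op n d w z + deriv (linear_op n d w) z * \<mu> z) (at z)"
      using md[OF \<open>z \<in> J\<close>] \<open>z \<in> J\<close>
      by (intro DERIV_mult) (simp_all add: DERIV_deriv_iff_real_differentiable smooth_on_imp_differentiable)
    ultimately have L': "deriv (linear_op n c y) (f z) * deriv f z = deriv \<mu> z * linear_op n d w z + deriv (linear_op n d w) z * \<mu> z"
      by (rule DERIV_unique)
    have "\<xi> (f z) * deriv (linear_op n c y) (f z) = ?\<zeta> z * (deriv (linear_op n c y) (f z) * deriv f z)"
      using T(5)[OF \<open>z \<in> J\<close>] by simp
    then have "\<mu> z * linear_op n d ?q z = - ?\<zeta> z * (deriv \<mu> z * linear_op n d w z + deriv (linear_op n d w) z * \<mu> z)
       + (a (f z) - real n * deriv \<xi> (f z)) * (\<mu> z * linear_op n d w z)"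
      using LQ LQ' L[OF \<open>z \<in> J\<close>] unfolding L' by simp
    then have "linear_op n d ?q z = (- ?\<zeta> z * (deriv \<mu> z * linear_op n d w z + deriv (linear_op n d w) z * \<mu> z)
       + (a (f z) - real n * deriv \<xi> (f z)) * (\<mu> z * linear_op n d w z)) / \<mu> z"
      using \<mu>(1)[OF \<open>z \<in> J\<close>] by (simp add: eq_divide_eq mult.commute)
    also have "\<dots> = - ?\<zeta> z * deriv (linear_op n d w) z
       + ((a (f z) - real n * deriv \<xi> (f z)) - ?\<zeta> z * deriv \<mu> z / \<mu> z) * linear_op n d w z"
      using \<mu>(1)[OF \<open>z \<in> J\<close>] by (simp add: add_divide_distrib diff_divide_distrib algebra_simps)
    finally show "linear_op n d ?q z = - ?\<zeta> z * deriv (linear_op n d w) z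
       + ((a (f z) - real n * deriv \<xi> (f z)) - ?\<zeta> z * deriv \<mu> z / \<mu> z) * linear_op n d w z" .
  qed
  with z_s a_s show ?thesis by (simp add: symmetry_pair_def)
qed

section \<open>Maximal symmetry and the Laguerre-Forsyth form\<close>

text \<open>The transported pair depends on the initial values of the given one through a triangular system, which can
  be solved for them.\<close>

lemma transport_initial_values:
  fixes f g :: "real \<Rightarrow> real"
  assumes o: "open J" "open (f ` J)" and f: "smooth_on J f" "\<forall>z\<in>J. deriv f z \<noteq> 0" and z: "z \<in> J"
  obtains v where "\<And>\<xi> a. smooth_on (f ` J) \<xi> \<Longrightarrow> (\<forall>k<3. (deriv ^^ k) \<xi> (f z) = v k) \<Longrightarrow> a (f z) = v 3 \<Longrightarrow>
    (\<forall>k<3. (deriv ^^ k) (\<lambda>z. \<xi> (f z) / deriv f z) z = p k) \<and> a (f z) - \<xi> (f z) / deriv f z * (deriv g z / g z) = p 3"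
proof -
  define s where "s = deriv f"
  have s: "smooth_on J s" unfolding s_def by (rule smooth_on_deriv[OF o(1) f(1)])
  have s0: "s t \<noteq> 0" if "t \<in> J" for t using f(2) that by (simp add: s_def)
  define v1 where "v1 = (p 1 * s z + p 0 * deriv s z) / s z"
  define v :: "nat \<Rightarrow> real" where "v k = (if k = 0 then p 0 * s z else if k = 1 then v1
     else if k = 2 then (p 2 * s z + 2 * p 1 * deriv s z + p 0 * deriv (deriv s) z - v1 * deriv s z) / (s z)\<^sup>2
     else p 3 + p 0 * (deriv g z / g z))" for k
  show ?thesis
  proof (rule that[of v])
    fix \<xi> a :: "real \<Rightarrow> real"
    assume xi: "smooth_on (f ` J) \<xi>" and jets: "\<forall>k<3. (deriv ^^ k) \<xi> (f z) = v k" and a: "a (f z) = v 3"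
    define q where "q = (\<lambda>z. \<xi> (f z) / s z)"
    have comp: "((\<lambda>t. h (f t)) has_real_derivative deriv h (f t) * s t) (at t)"
      if "smooth_on (f ` J) h" "t \<in> J" for h :: "real \<Rightarrow> real" and t
      unfolding s_def using DERIV_chain2[OF smooth_on_DERIV[OF that(1)] smooth_on_DERIV[OF f(1) that(2)]] that(2) by blast
    have "smooth_on J (\<lambda>t. \<xi> (f t))" using smooth_on_compose[OF o xi f(1)] by blast
    then have q: "smooth_on J q" unfolding q_def by (rule smooth_on_divide[OF o(1) _ s s0])
    have E0: "q t * s t = \<xi> (f t)" if "t \<in> J" for t using s0[OF that] by (simp add: q_def)
    have E1: "deriv q t * s t + deriv s t * q t = deriv \<xi> (f t) * s t" if "t \<in> J" for t
    proof (rule DERIV_unique)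
      show "((\<lambda>t. q t * s t) has_real_derivative deriv q t * s t + deriv s t * q t) (at t)"
        by (rule DERIV_mult[OF smooth_on_DERIV[OF q that] smooth_on_DERIV[OF s that]])
      show "((\<lambda>t. q t * s t) has_real_derivative deriv \<xi> (f t) * s t) (at t)"
        by (rule has_field_derivative_transform_within_open[OF comp[OF xi that] o(1) that]) (simp add: E0)
    qed
    have E2: "deriv (deriv q) z * s z + deriv s z * deriv q z + (deriv (deriv s) z * q z + deriv q z * deriv s z)
       = deriv (deriv \<xi>) (f z) * s z * s z + deriv s z * deriv \<xi> (f z)"
    proof (rule DERIV_unique)
      show "((\<lambda>t. deriv q t * s t + deriv s t * q t) has_real_derivative
         deriv (deriv q) z * s z + deriv s z * deriv q z + (deriv (deriv s) z * q z + deriv q z * deriv s z)) (at z)"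
        by (intro DERIV_add DERIV_mult smooth_on_DERIV[OF _ z] smooth_on_deriv o(1) q s)
      have "((\<lambda>t. deriv \<xi> (f t) * s t) has_real_derivative deriv (deriv \<xi>) (f z) * s z * s z + deriv s z * deriv \<xi> (f z)) (at z)"
        by (intro DERIV_mult comp[OF smooth_on_deriv[OF o(2) xi] z] smooth_on_DERIV[OF s z])
      then show "((\<lambda>t. deriv q t * s t + deriv s t * q t) has_real_derivative
         deriv (deriv \<xi>) (f z) * s z * s z + deriv s z * deriv \<xi> (f z)) (at z)"
        by (rule has_field_derivative_transform_within_open[OF _ o(1) z]) (simp add: E1)
    qed
    have j: "\<xi> (f z) = p 0 * s z" "deriv \<xi> (f z) = v1"
      "deriv (deriv \<xi>) (f z) = (p 2 * s z + 2 * p 1 * deriv s z + p 0 * deriv (deriv s) z - v1 * deriv s z) / (s z)\<^sup>2"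
      using jets[rule_format, of 0] jets[rule_format, of 1] jets[rule_format, of 2]
      by (simp_all add: v_def numeral_2_eq_2)
    have q0: "q z = p 0" using s0[OF z] by (simp add: q_def j)
    have q1: "deriv q z = p 1"
    proof -
      have "deriv q z * s z = p 1 * s z"
        using E1[OF z] s0[OF z] unfolding q0 j(2) v1_def by simp
      then show ?thesis using s0[OF z] by simp
    qed
    have q2: "deriv (deriv q) z = p 2"
    proof -
      have "deriv (deriv \<xi>) (f z) * s z * s z = p 2 * s z + 2 * p 1 * deriv s z + p 0 * deriv (deriv s) z - v1 * deriv s z"
        unfolding j(3) using s0[OF z] by (simp add: power2_eq_square)
      then have "deriv (deriv q) z * s z = p 2 * s z"
        using E2 unfolding q0 q1 j(2) by (simp add: algebra_simps)
      then show ?thesis using s0[OF z] by simp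
    qed
    have "(deriv ^^ k) q z = p k" if "k < 3" for k
    proof -
      have "k = 0 \<or> k = 1 \<or> k = 2" using that by linarith
      then show ?thesis using q0 q1 q2 by (auto simp: numeral_2_eq_2)
    qed
    moreover have "a (f z) - q z * (deriv g z / g z) = p 3" using a q0 by (simp add: v_def)
    ultimately show "(\<forall>k<3. (deriv ^^ k) (\<lambda>z. \<xi> (f z) / deriv f z) z = p k) \<and> a (f z) - \<xi> (f z) / deriv f z * (deriv g z / g z) = p 3"
      unfolding q_def s_def by simp
  qed
qed

lemma funpow_deriv_taylor_poly_high: "m < j \<Longrightarrow> (deriv ^^ j) (taylor_poly x0 u m) x = 0"
proof -
  assume "m < j"
  have "(deriv ^^ j) (taylor_poly x0 u m) x = (\<Sum>k\<le>m. (deriv ^^ j) (\<lambda>x. u k * hpow x0 k x) x)"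
    unfolding taylor_poly_def by (rule funpow_deriv_sum[where S = UNIV]) (auto intro!: smooth_intros)
  also have "\<dots> = (\<Sum>k\<le>m. 0)"
  proof (rule sum.cong)
    fix k assume "k \<in> {..m}"
    then show "(deriv ^^ j) (\<lambda>x. u k * hpow x0 k x) x = 0"
      using \<open>m < j\<close> funpow_deriv_cmult[OF open_UNIV smooth_on_hpow[OF open_UNIV] UNIV_I, of j "u k" x0 k x]
      by (simp add: funpow_deriv_hpow)
  qed simp
  finally show ?thesis by simp
qed

lemma laguerre_invariant_zero:
  assumes "open J" "\<forall>z\<in>J. d (n - 1) z = 0 \<and> d (n - 2) z = 0" "z \<in> J"
  shows "laguerre_invariant n d z = 0" "deriv (laguerre_invariant n d) z = 0" "deriv (d (n - 1)) z = 0"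
proof -
  have D: "deriv (d (n - 1)) t = 0" if "t \<in> J" for t
    using funpow_deriv_cong[OF assms(1), of "d (n - 1)" "\<lambda>x. 0" t 1] assms(2) that by simp
  then show "deriv (d (n - 1)) z = 0" using assms(3) .
  have L: "laguerre_invariant n d t = 0" if "t \<in> J" for t
    using D[OF that] assms(2) that by (simp add: laguerre_invariant_def)
  then show "laguerre_invariant n d z = 0" using assms(3) .
  show "deriv (laguerre_invariant n d) z = 0"
    using funpow_deriv_cong[OF assms(1), of "laguerre_invariant n d" "\<lambda>x. 0" z 1] L assms(3) by simp
qed

text \<open>The invariant vanishes, so the equation of order three is \<open>\<zeta>''' = 0\<close>.\<close>

lemma symmetry_pair_Laguerre_Forsyth:
  assumes "n \<ge> 3" "open_interval J" and d: "\<And>j. j < n \<Longrightarrow> smooth_on J (d j)" and LF: "\<forall>z\<in>J. d (n - 1) z = 0 \<and> d (n - 2) z = 0"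
    and p: "symmetry_pair n J d \<zeta> \<alpha>" and z0: "z0 \<in> J" "\<And>k. k < 3 \<Longrightarrow> (deriv ^^ k) \<zeta> z0 = p k" and z: "z \<in> J"
  shows "\<zeta> z = taylor_poly z0 p 2 z" "deriv \<alpha> z = (real n - 1) / 2 * deriv (deriv \<zeta>) z"
proof -
  have o: "open J" using assms(2) by (simp add: open_interval_def)
  have s: "smooth_on J \<zeta>" using p by (simp add: symmetry_pair_def)
  have 3: "(deriv ^^ 3) \<zeta> t = 0" if "t \<in> J" for t
  proof -
    have "real n * (real n - 1) * (real n + 1) / 12 * deriv (deriv (deriv \<zeta>)) t
     + 2 * laguerre_invariant n d t * deriv \<zeta> t + deriv (laguerre_invariant n d) t * \<zeta> t = 0"
      by (rule symmetry_pair_second[OF assms(1) o d p that])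
    then show ?thesis
      using assms(1) laguerre_invariant_zero[OF o LF that] by (simp add: numeral_3_eq_3)
  qed
  have tp: "smooth_on J (taylor_poly z0 p 2)" by (rule smooth_on_taylor_poly[OF o])
  have "\<zeta> z - taylor_poly z0 p 2 z = 0"
  proof (rule linear_ode_unique[where n = 3 and c = "\<lambda>j x. 0", OF assms(2) smooth_on_const z0(1) _ _ _ _ z])
    show "smooth_on J (\<lambda>z. \<zeta> z - taylor_poly z0 p 2 z)" by (intro smooth_on_diff o s tp)
    show "linear_op 3 (\<lambda>j x. 0) (\<lambda>z. \<zeta> z - taylor_poly z0 p 2 z) t = 0" if "t \<in> J" for t
      using funpow_deriv_diff[OF o s tp that, of 3] 3[OF that] funpow_deriv_taylor_poly_high[of 2 3 z0 p t]
      by (simp add: linear_op_eq)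
    show "(deriv ^^ j) (\<lambda>z. \<zeta> z - taylor_poly z0 p 2 z) z0 = 0" if "j < 3" for j
      using funpow_deriv_diff[OF o s tp z0(1), of j] z0(2)[OF that] funpow_deriv_taylor_poly[of j 2 z0 p] that by simp
  qed simp
  then show "\<zeta> z = taylor_poly z0 p 2 z" by simp
  show "deriv \<alpha> z = (real n - 1) / 2 * deriv (deriv \<zeta>) z"
    using symmetry_pair_first[OF assms(1) p z] LF z laguerre_invariant_zero(3)[OF o LF z] by simp
qed

lemma defect_cong:
  assumes "open S" "\<And>x. x \<in> S \<Longrightarrow> \<xi> x = \<xi>' x" "\<And>x. x \<in> S \<Longrightarrow> a x = a' x" "x \<in> S"
  shows "defect n c \<xi> a j x = defect n c \<xi>' a' j x"
proof -
  have "(deriv ^^ k) \<xi> x = (deriv ^^ k) \<xi>' x" "(deriv ^^ k) a x = (deriv ^^ k) a' x" for k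
    using funpow_deriv_cong[OF assms(1) assms(2) assms(4)] funpow_deriv_cong[OF assms(1) assms(3) assms(4)] by auto
  moreover from this(1)[of 1] have "deriv \<xi> x = deriv \<xi>' x" by simp
  ultimately show ?thesis unfolding defect_def using assms(2,4) by (simp del: funpow.simps)
qed

lemma symmetry_pair_subset:
  assumes "symmetry_pair n I c \<xi> a" "J \<subseteq> I"
  shows "symmetry_pair n J c \<xi> a"
  using assms smooth_on_subset unfolding symmetry_pair_def by blast

text \<open>A maximally symmetric equation in Laguerre-Forsyth form has all translations and dilations of the
  independent variable among its symmetries. By translation invariance the coefficients are constant, and the
  only constant coefficients with the scaling behaviour required by dilations are zero.\<close>

theorem maximal_imp_canonical:
  assumes "n \<ge> 3" "open_interval I" and c: "\<And>j. j < n \<Longrightarrow> smooth_on I (c j)"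
    and M: "has_maximal_symmetry_algebra n I c" and LF: "laguerre_forsyth_form n I c f g J d"
  shows "canonical_on n J d"
proof -
  have t: "transforms_to n I c f g J d" and LF0: "\<forall>z\<in>J. d (n - 1) z = 0 \<and> d (n - 2) z = 0"
    using LF by (simp_all add: laguerre_forsyth_form_def)
  note T = transforms_toD[OF t]
  note inv = diffeo_inverse[OF T(1,4,9)]
  have of: "open (f ` J)" using inv(1) by (simp add: open_interval_def)
  have pair: "symmetry_pair n J d (taylor_poly z0 p 2) (\<lambda>x. p 3)"
    if z0: "z0 \<in> J" and p2: "p 2 = 0" for z0 p
  proof -
    obtain v where v: "\<And>\<xi> a. smooth_on (f ` J) \<xi> \<Longrightarrow> (\<forall>k<3. (deriv ^^ k) \<xi> (f z0) = v k) \<Longrightarrow> a (f z0) = v 3 \<Longrightarrow>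
      (\<forall>k<3. (deriv ^^ k) (\<lambda>z. \<xi> (f z) / deriv f z) z0 = p k) \<and> a (f z0) - \<xi> (f z0) / deriv f z0 * (deriv g z0 / g z0) = p 3"
      using transport_initial_values[OF T(2) of T(4,9) z0, where g = g and p = p] by blast
    have "f z0 \<in> I" using T(6) z0 by blast
    then obtain \<xi> a where xa: "symmetry_pair n I c \<xi> a" "\<forall>k<3. (deriv ^^ k) \<xi> (f z0) = v k" "a (f z0) = v 3"
      using maximal_iff_all_initial_values[where c = c, OF assms(1,2) c] M by blast
    have xa': "symmetry_pair n (f ` J) c \<xi> a" by (rule symmetry_pair_subset[OF xa(1) T(6)])
    define \<zeta> where "\<zeta> = (\<lambda>z. \<xi> (f z) / deriv f z)"
    define \<alpha> where "\<alpha> = (\<lambda>z. a (f z) - \<xi> (f z) / deriv f z * (deriv g z / g z))"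
    have q: "symmetry_pair n J d \<zeta> \<alpha>"
      unfolding \<zeta>_def \<alpha>_def by (rule symmetry_pair_transport[OF t _ xa']) (rule c)
    have "smooth_on (f ` J) \<xi>" using xa' by (simp add: symmetry_pair_def)
    from v[where a = a, OF this xa(2,3)] have jets: "\<And>k. k < 3 \<Longrightarrow> (deriv ^^ k) \<zeta> z0 = p k" and a0: "\<alpha> z0 = p 3"
      unfolding \<zeta>_def \<alpha>_def by simp_all
    have form: "\<zeta> z = taylor_poly z0 p 2 z" "deriv \<alpha> z = (real n - 1) / 2 * deriv (deriv \<zeta>) z" if "z \<in> J" for z
      using symmetry_pair_Laguerre_Forsyth[where d = d and p = p, OF assms(1) T(1) T(3) LF0 q z0 jets that] by auto
    have "(deriv ^^ 2) \<zeta> z = 0" if "z \<in> J" for z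
    proof -
      have "taylor_poly z0 p 2 = taylor_poly z0 p 1"
        using p2 by (auto simp: taylor_poly_def fun_eq_iff numeral_2_eq_2)
      moreover have "(deriv ^^ 2) \<zeta> z = (deriv ^^ 2) (taylor_poly z0 p 2) z"
        by (rule funpow_deriv_cong[OF T(2) form(1) that])
      ultimately show ?thesis using funpow_deriv_taylor_poly_high[of 1 2 z0 p z] by simp
    qed
    then have "deriv \<alpha> z = 0" if "z \<in> J" for z using form(2)[OF that] that by (simp add: numeral_2_eq_2)
    moreover have sa: "smooth_on J \<alpha>" using q by (simp add: symmetry_pair_def)
    ultimately have "(\<alpha> has_real_derivative 0) (at z within J)" if "z \<in> J" for z
      using smooth_on_DERIV[OF sa that] that by (simp add: has_field_derivative_at_within)
    moreover have "convex J" using T(1) by (simp add: open_interval_def is_interval_convex_1)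
    ultimately obtain k where "\<And>z. z \<in> J \<Longrightarrow> \<alpha> z = k"
      using has_field_derivative_zero_constant[of J \<alpha>] by blast
    then have al: "\<alpha> z = p 3" if "z \<in> J" for z using a0 z0 that by metis
    have "defect n d (taylor_poly z0 p 2) (\<lambda>x. p 3) j z = 0" if "j < n" "z \<in> J" for j z
    proof -
      have "defect n d \<zeta> \<alpha> j z = defect n d (taylor_poly z0 p 2) (\<lambda>x. p 3) j z"
        by (rule defect_cong[OF T(2) form(1) al that(2)])
      then show ?thesis using q that unfolding symmetry_pair_def by simp
    qed
    then show ?thesis
      unfolding symmetry_pair_def using smooth_on_taylor_poly[OF T(2)] smooth_on_const by simp
  qed
  have "d j z = 0" if j: "j < n" and z: "z \<in> J" for j z
  proof -
    have z2: "(deriv ^^ k) (taylor_poly z p 2) z = (if k \<le> 2 then p k else 0)" for k p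
      using funpow_deriv_taylor_poly[of k 2 z p] funpow_deriv_taylor_poly_high[of 2 k z p z] by simp
    have k: "(deriv ^^ k) (\<lambda>x. 0 :: real) z = 0" for k by (simp add: funpow_deriv_const)
    define e :: "nat \<Rightarrow> nat \<Rightarrow> real" where "e i = (\<lambda>k. if k = i then 1 else 0)" for i
    \<comment> \<open>\<open>e 0\<close> is the translation and \<open>e 1\<close> the dilation that fixes \<open>z\<close>.\<close>
    have E: "defect n d (taylor_poly z (e i) 2) (\<lambda>x. 0) j z = 0" if "i < 2" for i
      using pair[OF z, of "e i"] that j z by (simp add: symmetry_pair_def e_def)
    have S0: "(\<Sum>k\<in>{j<..n}. full_coeff n d k z * (real (k choose j) * (deriv ^^ (k - j)) (\<lambda>x. 0) z
        - (if j = 0 then 0 else real (k choose (j - 1))) * (deriv ^^ Suc (k - j)) (taylor_poly z (e i) 2) z)) = 0" if "i < 2" for i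
    proof (rule sum.neutral, rule ballI)
      fix k assume "k \<in> {j<..n}"
      then have "Suc (k - j) \<noteq> i" using that by auto
      then show "full_coeff n d k z * (real (k choose j) * (deriv ^^ (k - j)) (\<lambda>x. 0) z
        - (if j = 0 then 0 else real (k choose (j - 1))) * (deriv ^^ Suc (k - j)) (taylor_poly z (e i) 2) z) = 0"
        unfolding z2 k by (simp add: e_def)
    qed
    have t: "taylor_poly z (e i) 2 z = e i 0" "deriv (taylor_poly z (e i) 2) z = e i 1" for i
      using z2[of 0 "e i"] z2[of 1 "e i"] by simp_all
    have R: "real (n - j) * e i 1 * d j z + e i 0 * deriv (d j) z = 0" if "i < 2" for i
      using E[OF that] unfolding defect_def S0[OF that] t by simp
    have "deriv (d j) z = 0" using R[of 0] by (simp add: e_def)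
    then have "real (n - j) * d j z = 0" using R[of 1] by (simp add: e_def)
    then show ?thesis using j by simp
  qed
  then show ?thesis by (simp add: canonical_on_def)
qed

text \<open>The projective symmetries of \<open>y\<^sup>(\<^sup>n\<^sup>) = 0\<close>. Only the determining equation of order \<open>n - 1\<close> is not trivial, because
  third derivatives of a quadratic polynomial vanish, and it fixes the factor \<open>(n - 1) / 2\<close>.\<close>

lemma symmetry_pair_canonical:
  assumes "n \<ge> 3" "open J" and d: "\<And>j z. j < n \<Longrightarrow> z \<in> J \<Longrightarrow> d j z = 0"
  shows "symmetry_pair n J d (taylor_poly z0 p 2) (\<lambda>z. (real n - 1) / 2 * deriv (taylor_poly z0 p 2) z + r)"
proof -
  let ?t = "taylor_poly z0 p 2" and ?\<alpha> = "\<lambda>z. (real n - 1) / 2 * deriv (taylor_poly z0 p 2) z + r"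
  obtain m where n: "n = Suc (Suc (Suc m))" using le_Suc_ex[OF assms(1)] by (auto simp: numeral_3_eq_3)
  have ts: "smooth_on J ?t" by (rule smooth_on_taylor_poly[OF assms(2)])
  have al: "smooth_on J ?\<alpha>" by (intro smooth_intros assms(2) ts)
  have D: "(deriv ^^ k) ?\<alpha> z = (real n - 1) / 2 * (deriv ^^ Suc k) ?t z" if "k > 0" "z \<in> J" for k z
  proof -
    have "(deriv ^^ k) ?\<alpha> z = (deriv ^^ k) (\<lambda>z. (real n - 1) / 2 * deriv ?t z) z + (deriv ^^ k) (\<lambda>z. r) z"
      by (rule funpow_deriv_add[OF assms(2) _ smooth_on_const that(2)]) (intro smooth_intros assms(2) ts)
    also have "(deriv ^^ k) (\<lambda>z. r) z = 0" using that by (simp add: funpow_deriv_const)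
    also have "(deriv ^^ k) (\<lambda>z. (real n - 1) / 2 * deriv ?t z) z = (real n - 1) / 2 * (deriv ^^ k) (deriv ?t) z"
      by (rule funpow_deriv_cmult[OF assms(2) smooth_on_deriv[OF assms(2) ts] that(2)])
    finally show ?thesis by (simp only: funpow_deriv_Suc_deriv add_0_right)
  qed
  have "defect n d ?t ?\<alpha> j z = 0" if "j < n" "z \<in> J" for j z
  proof -
    have "deriv (d j) z = 0"
      using funpow_deriv_cong[OF assms(2), of "d j" "\<lambda>x. 0" z 1] d that by simp
    then have e: "defect n d ?t ?\<alpha> j z = (\<Sum>k\<in>{j<..n}. full_coeff n d k z * (real (k choose j) * (deriv ^^ (k - j)) ?\<alpha> z
        - (if j = 0 then 0 else real (k choose (j - 1))) * (deriv ^^ Suc (k - j)) ?t z))"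
      unfolding defect_def using d that by simp
    also have "\<dots> = 0"
    proof (rule sum.neutral, rule ballI)
      fix k assume k: "k \<in> {j<..n}"
      show "full_coeff n d k z * (real (k choose j) * (deriv ^^ (k - j)) ?\<alpha> z
        - (if j = 0 then 0 else real (k choose (j - 1))) * (deriv ^^ Suc (k - j)) ?t z) = 0"
      proof (cases "k = n")
        case False
        then show ?thesis using k d that by (simp add: full_coeff_def)
      next
        case True
        have D': "(deriv ^^ (k - j)) ?\<alpha> z = (real n - 1) / 2 * (deriv ^^ Suc (k - j)) ?t z"
          using D[of "k - j" z] k that by simp
        show ?thesis
        proof (cases "j = n - 1")
          case True
          have c1: "real (n choose j) = real n" using True n binomial_Suc_n by simp
          have c2: "real (n choose (j - 1)) = real n * (real n - 1) / 2"
            using choose_Suc_Suc[of "Suc m"] True by (simp add: n algebra_simps)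
          have nz: "j \<noteq> 0" using True n by simp
          show ?thesis unfolding D' unfolding \<open>k = n\<close> c1 c2 if_not_P[OF nz] by (simp add: algebra_simps)
        next
          case False
          then have "2 < Suc (k - j)" using \<open>j < n\<close> \<open>k = n\<close> by linarith
          then show ?thesis unfolding D' by (simp add: funpow_deriv_taylor_poly_high del: funpow.simps)
        qed
      qed
    qed
    finally show ?thesis .
  qed
  then show ?thesis unfolding symmetry_pair_def using ts al by simp
qed

text \<open>The projective symmetries are transported back along the inverse transformation.\<close>

lemma local_symmetry_pair:
  assumes "n \<ge> 3" and c: "\<And>j. j < n \<Longrightarrow> smooth_on I (c j)" and t: "transforms_to n I c f g J d"
    and can: "canonical_on n J d" and z: "z \<in> J"
  obtains \<xi> a where "symmetry_pair n (f ` J) c \<xi> a" "\<forall>k<3. (deriv ^^ k) \<xi> (f z) = p k" "a (f z) = p 3"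
proof -
  note T = transforms_toD[OF t]
  note inv = diffeo_inverse[OF T(1,4,9)]
  have of: "open (f ` J)" using inv(1) by (simp add: open_interval_def)
  define F where "F = inv_into J f"
  define G where "G = (\<lambda>x. inverse (g (F x)))"
  have t': "transforms_to n J d F G (f ` J) c"
    unfolding F_def G_def by (rule transforms_to_inverse[OF t]) (rule c)
  note T' = transforms_toD[OF t']
  have FJ: "F ` (f ` J) = J" using inv(2) by (force simp: image_image F_def)
  have Fz: "F (f z) = z" using inv(2)[OF z] by (simp add: F_def)
  have fz: "f z \<in> f ` J" using z by blast
  have oF: "open (F ` f ` J)" unfolding FJ by (rule T(2))
  obtain v where v: "\<And>\<zeta> \<alpha>. smooth_on (F ` f ` J) \<zeta> \<Longrightarrow> (\<forall>k<3. (deriv ^^ k) \<zeta> (F (f z)) = v k) \<Longrightarrow> \<alpha> (F (f z)) = v 3 \<Longrightarrow>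
    (\<forall>k<3. (deriv ^^ k) (\<lambda>x. \<zeta> (F x) / deriv F x) (f z) = p k)
      \<and> \<alpha> (F (f z)) - \<zeta> (F (f z)) / deriv F (f z) * (deriv G (f z) / G (f z)) = p 3"
    using transport_initial_values[OF T'(2) oF T'(4,9) fz, where g = G and p = p] by blast
  let ?t = "taylor_poly z v 2"
  define r where "r = v 3 - (real n - 1) / 2 * deriv ?t z"
  let ?\<alpha> = "\<lambda>z. (real n - 1) / 2 * deriv ?t z + r"
  have "symmetry_pair n J d ?t ?\<alpha>"
    using can by (intro symmetry_pair_canonical[OF assms(1) T(2)]) (simp add: canonical_on_def)
  then have q: "symmetry_pair n (F ` f ` J) d ?t ?\<alpha>" unfolding FJ .
  have "(deriv ^^ k) ?t z = v k" if "k < 3" for k using funpow_deriv_taylor_poly[of k 2 z v] that by simp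
  then have jets: "\<forall>k<3. (deriv ^^ k) ?t (F (f z)) = v k" unfolding Fz by blast
  have s: "smooth_on (F ` f ` J) ?t" by (rule smooth_on_taylor_poly[OF oF])
  have a: "?\<alpha> (F (f z)) = v 3" unfolding Fz by (simp add: r_def)
  show ?thesis
  proof (rule that)
    show "symmetry_pair n (f ` J) c (\<lambda>x. ?t (F x) / deriv F x) (\<lambda>x. ?\<alpha> (F x) - ?t (F x) / deriv F x * (deriv G x / G x))"
      by (rule symmetry_pair_transport[OF t' _ q]) (rule T(3))
    show "\<forall>k<3. (deriv ^^ k) (\<lambda>x. ?t (F x) / deriv F x) (f z) = p k"
      "?\<alpha> (F (f z)) - ?t (F (f z)) / deriv F (f z) * (deriv G (f z) / G (f z)) = p 3"
      using v[where \<alpha> = "?\<alpha>", OF s jets a] by blast+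
  qed
qed

text \<open>Near each point the canonical form provides symmetry pairs with arbitrary initial values. They solve the two
  leading determining equations, which are linear differential equations on the whole interval; so a global solution
  of these agrees near each point with a local symmetry pair and satisfies the other determining equations too.\<close>

theorem locally_canonical_imp_maximal:
  assumes "n \<ge> 3" "open_interval I" and c: "\<And>j. j < n \<Longrightarrow> smooth_on I (c j)"
    and loc: "\<And>x. x \<in> I \<Longrightarrow> \<exists>f g J d. transforms_to n I c f g J d \<and> x \<in> f ` J \<and> canonical_on n J d"
  shows "has_maximal_symmetry_algebra n I c"
proof -
  have o: "open I" and ne: "I \<noteq> {}" using assms(2) by (simp_all add: open_interval_def)
  obtain x0 where x0: "x0 \<in> I" using ne by blast
  define K where "K = real n * (real n - 1) * (real n + 1) / 12"
  have K: "K \<noteq> 0" using assms(1) by (simp add: K_def)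
  let ?B = "laguerre_invariant n c"
  have B: "smooth_on I ?B" by (rule smooth_on_laguerre_invariant[OF o assms(1)]) (rule c)
  define e where "e j = (if j = 0 then (\<lambda>x. deriv ?B x / K) else if j = 1 then (\<lambda>x. 2 * ?B x / K) else (\<lambda>x. 0))" for j :: nat
  have es: "smooth_on I (e j)" for j unfolding e_def using B o K by (auto intro!: smooth_intros)
  have e3: "linear_op 3 e \<xi> x = deriv (deriv (deriv \<xi>)) x + 2 * ?B x / K * deriv \<xi> x + deriv ?B x / K * \<xi> x" for \<xi> x
    by (simp add: linear_op_eq numeral_3_eq_3 e_def)
  have cn: "smooth_on I (c (n - 1))" using c assms(1) by simp
  define A where "A \<xi> x = (real n - 1) / 2 * deriv (deriv \<xi>) x - (deriv \<xi> x * c (n - 1) x + \<xi> x * deriv (c (n - 1)) x) / real n" for \<xi> :: "real \<Rightarrow> real" and x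
  have "\<exists>\<xi> a. symmetry_pair n I c \<xi> a \<and> (\<forall>k<3. (deriv ^^ k) \<xi> x0 = v k) \<and> a x0 = v 3" for v
  proof -
    obtain \<xi> where xi: "smooth_on I \<xi>" "\<And>x. x \<in> I \<Longrightarrow> linear_op 3 e \<xi> x = 0" "\<And>j. j < 3 \<Longrightarrow> (deriv ^^ j) \<xi> x0 = v j"
      using linear_ode_exists[where n = 3 and c = e and v = v, OF assms(2) es x0] by auto
    have As: "smooth_on I (A \<xi>)" unfolding A_def[abs_def] using assms(1) by (intro smooth_intros o xi(1) cn) auto
    define a where "a x = v 3 + primitive x0 (A \<xi>) x" for x
    have as: "smooth_on I a" unfolding a_def[abs_def] by (intro smooth_on_add smooth_on_const o smooth_on_primitive assms(2) As x0)
    have a': "(a has_real_derivative A \<xi> x) (at x)" if "x \<in> I" for x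
    proof -
      have "(a has_real_derivative 0 + A \<xi> x) (at x)" unfolding a_def[abs_def]
        by (intro DERIV_add DERIV_const DERIV_primitive[OF assms(2) smooth_on_imp_continuous_on[OF As] x0 that])
      then show ?thesis by simp
    qed
    have "defect n c \<xi> a j x1 = 0" if j: "j < n" and x1: "x1 \<in> I" for j x1
    proof -
      obtain f g J d where t: "transforms_to n I c f g J d" and xf: "x1 \<in> f ` J" and can: "canonical_on n J d"
        using loc[OF x1] by blast
      obtain z where z: "z \<in> J" "x1 = f z" using xf by blast
      note T = transforms_toD[OF t]
      have oi: "open_interval (f ` J)" by (rule diffeo_inverse(1)[OF T(1,4,9)])
      then have of: "open (f ` J)" by (simp add: open_interval_def)
      define p where "p k = (if k = 3 then a x1 else (deriv ^^ k) \<xi> x1)" for k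
      obtain \<zeta> b where q: "symmetry_pair n (f ` J) c \<zeta> b" "\<forall>k<3. (deriv ^^ k) \<zeta> (f z) = p k" "b (f z) = p 3"
        using local_symmetry_pair[where c = c and p = p, OF assms(1) c t can z(1)] by blast
      have cf: "smooth_on (f ` J) (c j)" if "j < n" for j using smooth_on_subset[OF c[OF that] T(6)] .
      have qs: "smooth_on (f ` J) \<zeta>" "smooth_on (f ` J) b" using q(1) by (simp_all add: symmetry_pair_def)
      have xs: "smooth_on (f ` J) \<xi>" using smooth_on_subset[OF xi(1) T(6)] .
      have esf: "smooth_on (f ` J) (e j)" for j using smooth_on_subset[OF es T(6)] .
      have zeta: "\<zeta> x = \<xi> x" if "x \<in> f ` J" for x
      proof -
        have "\<zeta> x - \<xi> x = 0"
        proof (rule linear_ode_unique[where n = 3 and c = e, OF oi esf xf smooth_on_diff[OF of qs(1) xs] _ _ _ that])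
          fix y assume y: "y \<in> f ` J"
          have "K * deriv (deriv (deriv \<zeta>)) y + 2 * ?B y * deriv \<zeta> y + deriv ?B y * \<zeta> y = 0"
            unfolding K_def by (rule symmetry_pair_second[OF assms(1) of cf q(1) y])
          then have "linear_op 3 e \<zeta> y = 0" unfolding e3 using K by (simp add: field_simps)
          moreover have "linear_op 3 e \<xi> y = 0" using xi(2) T(6) y by blast
          ultimately show "linear_op 3 e (\<lambda>x. \<zeta> x - \<xi> x) y = 0"
            using linear_op_diff[OF of qs(1) xs y] by simp
        next
          fix k :: nat assume "k < 3"
          then show "(deriv ^^ k) (\<lambda>x. \<zeta> x - \<xi> x) x1 = 0"
            using q(2) funpow_deriv_diff[OF of qs(1) xs xf] by (simp add: z(2)[symmetric] p_def)
        qed simp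
        then show ?thesis by simp
      qed
      have "b x = a x" if "x \<in> f ` J" for x
      proof -
        have "((\<lambda>x. b x - a x) has_real_derivative 0) (at y within f ` J)" if y: "y \<in> f ` J" for y
        proof -
          have "deriv b y = A \<zeta> y" unfolding A_def by (rule symmetry_pair_first[OF assms(1) q(1) y])
          also have "A \<zeta> y = A \<xi> y"
          proof -
            have "(deriv ^^ k) \<zeta> y = (deriv ^^ k) \<xi> y" for k by (rule funpow_deriv_cong[OF of zeta y])
            from this[of 0] this[of 1] this[of 2] show ?thesis by (simp add: A_def numeral_2_eq_2)
          qed
          finally have "(b has_real_derivative A \<xi> y) (at y)" using smooth_on_DERIV[OF qs(2) y] by simp
          then have "((\<lambda>x. b x - a x) has_real_derivative A \<xi> y - A \<xi> y) (at y)"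
            using T(6) y by (intro DERIV_diff a') auto
          then show ?thesis by (simp add: has_field_derivative_at_within)
        qed
        moreover have "convex (f ` J)" using oi by (simp add: open_interval_def is_interval_convex_1)
        ultimately obtain k where k: "\<And>x. x \<in> f ` J \<Longrightarrow> b x - a x = k"
          using has_field_derivative_zero_constant[of "f ` J" "\<lambda>x. b x - a x"] by blast
        have "b x1 = a x1" using q(3) by (simp add: z(2)[symmetric] p_def)
        then show ?thesis using k[OF xf] k[OF that] by simp
      qed
      then have "defect n c \<zeta> b j x1 = defect n c \<xi> a j x1"
        by (intro defect_cong[OF of zeta _ xf])
      moreover have "defect n c \<zeta> b j x1 = 0" using q(1) j xf unfolding symmetry_pair_def by blast
      ultimately show ?thesis by simp
    qed
    moreover have "a x0 = v 3" by (simp add: a_def)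
    ultimately show ?thesis using xi as unfolding symmetry_pair_def by blast
  qed
  moreover have "has_maximal_symmetry_algebra n I c \<longleftrightarrow>
    (\<forall>v. \<exists>\<xi> a. symmetry_pair n I c \<xi> a \<and> (\<forall>k<3. (deriv ^^ k) \<xi> x0 = v k) \<and> a x0 = v 3)"
    by (rule maximal_iff_all_initial_values[OF assms(1,2) _ x0]) (rule c)
  ultimately show ?thesis by blast
qed

section \<open>Existence of Laguerre-Forsyth forms\<close>

lemma sum_shift:
  fixes s s' w :: "nat \<Rightarrow> real"
  assumes "s' (Suc j) = 0"
  shows "(\<Sum>i\<le>j. s' i * w i + s i * w (Suc i)) = (\<Sum>i\<le>Suc j. (s' i + (if i = 0 then 0 else s (i - 1))) * w i)"
proof -
  have "(\<Sum>i\<le>Suc j. (s' i + (if i = 0 then 0 else s (i - 1))) * w i) =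
     (\<Sum>i\<le>Suc j. s' i * w i) + (\<Sum>i\<le>Suc j. (if i = 0 then 0 else s (i - 1)) * w i)"
    by (simp add: distrib_right sum.distrib)
  also have "(\<Sum>i\<le>Suc j. (if i = 0 then 0 else s (i - 1)) * w i) = (\<Sum>i\<le>j. s i * w (Suc i))"
    by (subst sum.atMost_Suc_shift) simp
  finally show ?thesis using assms by (simp add: sum.distrib)
qed

text \<open>If \<open>y (f z) = g z * w z\<close>, then \<open>chain_coeff f g j i\<close> is the coefficient of \<open>w\<^sup>(\<^sup>i\<^sup>)\<close> in \<open>y\<^sup>(\<^sup>j\<^sup>) (f z)\<close>; the recursion is
  the rule \<open>d/dx = (1 / f') d/dz\<close>.\<close>

primrec chain_coeff :: "(real \<Rightarrow> real) \<Rightarrow> (real \<Rightarrow> real) \<Rightarrow> nat \<Rightarrow> nat \<Rightarrow> real \<Rightarrow> real" where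
  "chain_coeff f g 0 = (\<lambda>i z. if i = 0 then g z else 0)"
| "chain_coeff f g (Suc j) = (\<lambda>i z. (deriv (chain_coeff f g j i) z + (if i = 0 then 0 else chain_coeff f g j (i - 1) z)) / deriv f z)"

lemma chain_coeff_zero: "j < i \<Longrightarrow> chain_coeff f g j i = (\<lambda>z. 0)"
proof (induction j arbitrary: i)
  case (Suc j)
  then obtain i' where "i = Suc i'" "j < i'" by (cases i) auto
  with Suc.IH[of "Suc i'"] Suc.IH[of i'] show ?case by simp
qed simp

lemma smooth_on_chain_coeff:
  assumes "open J" "smooth_on J f" "\<forall>z\<in>J. deriv f z \<noteq> 0" "smooth_on J g"
  shows "smooth_on J (chain_coeff f g j i)"
proof (induction j arbitrary: i)
  case 0
  then show ?case using assms(4) smooth_on_const[of J 0] by (cases "i = 0") simp_all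
next
  case (Suc j)
  have "smooth_on J (\<lambda>z. if i = 0 then 0 else chain_coeff f g j (i - 1) z)"
    using Suc smooth_on_const[of J 0] by (cases "i = 0") simp_all
  then have "smooth_on J (\<lambda>z. (deriv (chain_coeff f g j i) z + (if i = 0 then 0 else chain_coeff f g j (i - 1) z)) / deriv f z)"
    using assms(3) by (intro smooth_on_divide smooth_on_add smooth_on_deriv assms(1,2) Suc) simp_all
  then show ?case by simp
qed

lemma chain_expansion:
  assumes J: "open J" "open (f ` J)" "smooth_on J f" "\<forall>z\<in>J. deriv f z \<noteq> 0" "smooth_on J g"
    and y: "smooth_on (f ` J) y" "smooth_on J w" "\<And>z. z \<in> J \<Longrightarrow> y (f z) = g z * w z" and "z \<in> J"
  shows "(deriv ^^ j) y (f z) = (\<Sum>i\<le>j. chain_coeff f g j i z * (deriv ^^ i) w z)"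
  using \<open>z \<in> J\<close>
proof (induction j arbitrary: z)
  case 0
  then show ?case using y(3) by simp
next
  case (Suc j)
  let ?s = "chain_coeff f g j" and ?w = "\<lambda>i. (deriv ^^ i) w z"
  have "((\<lambda>t. (deriv ^^ j) y (f t)) has_real_derivative (deriv ^^ Suc j) y (f z) * deriv f z) (at z)"
    using DERIV_chain2[OF smooth_on_funpow_DERIV[OF J(2) y(1)] smooth_on_DERIV[OF J(3) Suc.prems]] Suc.prems by blast
  moreover have "((\<lambda>t. (deriv ^^ j) y (f t)) has_real_derivative (\<Sum>i\<le>j. deriv (?s i) z * ?w i + ?s i z * ?w (Suc i))) (at z)"
  proof (rule has_field_derivative_transform_within_open[OF _ J(1) Suc.prems])
    show "(\<Sum>i\<le>j. ?s i t * (deriv ^^ i) w t) = (deriv ^^ j) y (f t)" if "t \<in> J" for t using Suc.IH[OF that] by simp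
    have "((\<lambda>t. ?s i t * (deriv ^^ i) w t) has_real_derivative deriv (?s i) z * ?w i + ?s i z * ?w (Suc i)) (at z)" for i
      using DERIV_mult[OF smooth_on_DERIV[OF smooth_on_chain_coeff[OF J(1,3-5)] Suc.prems] smooth_on_funpow_DERIV[OF J(1) y(2) Suc.prems], of j i i]
      by (simp only: mult.commute)
    then show "((\<lambda>t. \<Sum>i\<le>j. ?s i t * (deriv ^^ i) w t) has_real_derivative (\<Sum>i\<le>j. deriv (?s i) z * ?w i + ?s i z * ?w (Suc i))) (at z)"
      by (intro DERIV_sum)
  qed
  ultimately have "(deriv ^^ Suc j) y (f z) * deriv f z = (\<Sum>i\<le>j. deriv (?s i) z * ?w i + ?s i z * ?w (Suc i))"
    by (rule DERIV_unique)
  also have "\<dots> = (\<Sum>i\<le>Suc j. (deriv (?s i) z + (if i = 0 then 0 else ?s (i - 1) z)) * ?w i)"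
    by (rule sum_shift) (simp add: chain_coeff_zero)
  finally have "(deriv ^^ Suc j) y (f z) = (\<Sum>i\<le>Suc j. (deriv (?s i) z + (if i = 0 then 0 else ?s (i - 1) z)) * ?w i) / deriv f z"
    using J(4) Suc.prems by (simp add: eq_divide_eq del: funpow.simps sum.atMost_Suc)
  also have "\<dots> = (\<Sum>i\<le>Suc j. chain_coeff f g (Suc j) i z * ?w i)"
    unfolding sum_divide_distrib by (intro sum.cong refl) simp
  finally show ?case .
qed

text \<open>If \<open>\<tau>\<close> and \<open>\<gamma>\<close> are the logarithmic derivatives of \<open>v\<close> and \<open>G\<close>, these are the coefficients of
  \<open>(G / v\<^sup>2\<^sup>k) (v\<^sup>2 d/dx)\<^sup>k (1 / G)\<close>, an operator of order \<open>k\<close> with leading coefficient \<open>1\<close>.\<close>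

primrec rho :: "(real \<Rightarrow> real) \<Rightarrow> (real \<Rightarrow> real) \<Rightarrow> nat \<Rightarrow> nat \<Rightarrow> real \<Rightarrow> real" where
  "rho \<tau> \<gamma> 0 = (\<lambda>j x. if j = 0 then 1 else 0)"
| "rho \<tau> \<gamma> (Suc k) = (\<lambda>j x. deriv (rho \<tau> \<gamma> k j) x + (2 * real k * \<tau> x - \<gamma> x) * rho \<tau> \<gamma> k j x
     + (if j = 0 then 0 else rho \<tau> \<gamma> k (j - 1) x))"

lemma rho_zero: "k < j \<Longrightarrow> rho \<tau> \<gamma> k j = (\<lambda>x. 0)"
proof (induction k arbitrary: j)
  case (Suc k)
  then obtain j' where "j = Suc j'" "k < j'" by (cases j) auto
  with Suc.IH[of "Suc j'"] Suc.IH[of j'] show ?case by simp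
qed simp

lemma rho_leading: "rho \<tau> \<gamma> k k = (\<lambda>x. 1)"
  by (induction k) (simp_all add: rho_zero)

lemma rho_first: "rho \<tau> \<gamma> (Suc k) k = (\<lambda>x. real (Suc k) * real k * \<tau> x - real (Suc k) * \<gamma> x)"
proof (induction k)
  case (Suc k)
  have "rho \<tau> \<gamma> (Suc (Suc k)) (Suc k) = (\<lambda>x. deriv (rho \<tau> \<gamma> (Suc k) (Suc k)) x
      + (2 * real (Suc k) * \<tau> x - \<gamma> x) * rho \<tau> \<gamma> (Suc k) (Suc k) x + rho \<tau> \<gamma> (Suc k) k x)"
    by (subst rho.simps(2)) simp
  then show ?case unfolding rho_leading Suc by (simp add: fun_eq_iff algebra_simps)
qed simp

lemma rho_second_step:
  fixes k t' g' t g :: real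
  shows "(k + 1 + 1) * (k + 1) * t' - (k + 1 + 1) * g' + (2 * (k + 1 + 1) * t - g) * ((k + 1 + 1) * (k + 1) * t - (k + 1 + 1) * g)
   + (k + 2) * (k + 1) * (k / 3 * t' - g' / 2 + k * (3 * k + 5) / 6 * t\<^sup>2 - (k + 1) * t * g + g\<^sup>2 / 2)
   = (k + 1 + 2) * (k + 1 + 1) * ((k + 1) / 3 * t' - g' / 2 + (k + 1) * (3 * (k + 1) + 5) / 6 * t\<^sup>2 - (k + 1 + 1) * t * g + g\<^sup>2 / 2)"
  by (simp add: algebra_simps power2_eq_square add_divide_distrib diff_divide_distrib)

lemma rho_second:
  assumes "(\<tau> has_real_derivative \<tau>') (at x)" "(\<gamma> has_real_derivative \<gamma>') (at x)"
  shows "rho \<tau> \<gamma> (Suc (Suc k)) k x = (real k + 2) * (real k + 1) * (real k / 3 * \<tau>' - \<gamma>' / 2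
      + real k * (3 * real k + 5) / 6 * (\<tau> x)\<^sup>2 - (real k + 1) * \<tau> x * \<gamma> x + (\<gamma> x)\<^sup>2 / 2)"
proof -
  have D: "deriv (rho \<tau> \<gamma> (Suc k) k) x = real (Suc k) * real k * \<tau>' - real (Suc k) * \<gamma>'" for k
    unfolding rho_first by (intro DERIV_imp_deriv DERIV_diff DERIV_cmult assms)
  have S: "real (Suc k) = real k + 1" for k by simp
  show ?thesis
  proof (induction k)
    case 0
    have "rho \<tau> \<gamma> (Suc (Suc 0)) 0 x = deriv (rho \<tau> \<gamma> (Suc 0) 0) x + (2 * real (Suc 0) * \<tau> x - \<gamma> x) * rho \<tau> \<gamma> (Suc 0) 0 x"
      by (subst rho.simps(2)) simp
    then show ?case unfolding D unfolding rho_first by (simp add: power2_eq_square algebra_simps)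
  next
    case (Suc k)
    have "rho \<tau> \<gamma> (Suc (Suc (Suc k))) (Suc k) x = deriv (rho \<tau> \<gamma> (Suc (Suc k)) (Suc k)) x
        + (2 * real (Suc (Suc k)) * \<tau> x - \<gamma> x) * rho \<tau> \<gamma> (Suc (Suc k)) (Suc k) x + rho \<tau> \<gamma> (Suc (Suc k)) k x"
      by (subst rho.simps(2)) simp
    also have "\<dots> = (real (Suc k) + 2) * (real (Suc k) + 1) * (real (Suc k) / 3 * \<tau>' - \<gamma>' / 2
      + real (Suc k) * (3 * real (Suc k) + 5) / 6 * (\<tau> x)\<^sup>2 - (real (Suc k) + 1) * \<tau> x * \<gamma> x + (\<gamma> x)\<^sup>2 / 2)"
      unfolding D Suc.IH unfolding rho_first S by (rule rho_second_step)
    finally show ?case .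
  qed
qed

lemma smooth_on_rho:
  assumes "open U" "smooth_on U \<tau>" "smooth_on U \<gamma>"
  shows "smooth_on U (rho \<tau> \<gamma> k j)"
proof (induction k arbitrary: j)
  case 0
  then show ?case using smooth_on_const[of U 0] smooth_on_const[of U 1] by (cases "j = 0") simp_all
next
  case (Suc k)
  have "smooth_on U (\<lambda>x. if j = 0 then 0 else rho \<tau> \<gamma> k (j - 1) x)"
    using Suc smooth_on_const[of U 0] by (cases "j = 0") simp_all
  then have "smooth_on U (\<lambda>x. deriv (rho \<tau> \<gamma> k j) x + (2 * real k * \<tau> x - \<gamma> x) * rho \<tau> \<gamma> k j x
     + (if j = 0 then 0 else rho \<tau> \<gamma> k (j - 1) x))"
    by (intro smooth_on_add smooth_on_mult smooth_on_diff smooth_on_const smooth_on_deriv assms Suc)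
  then show ?case by simp
qed

text \<open>The new independent variable \<open>z = \<phi> x\<close> has \<open>d/dz = v\<^sup>2 d/dx\<close>.\<close>

lemma rho_expansion:
  assumes U: "open U" "open J" "\<And>x. x \<in> U \<Longrightarrow> \<phi> x \<in> J" "\<And>x. x \<in> U \<Longrightarrow> (\<phi> has_real_derivative inverse ((v x)\<^sup>2)) (at x)"
    and v: "\<And>x. x \<in> U \<Longrightarrow> v x \<noteq> 0" "\<And>x. x \<in> U \<Longrightarrow> (v has_real_derivative \<tau> x * v x) (at x)" "smooth_on U \<tau>"
    and G: "\<And>x. x \<in> U \<Longrightarrow> G x \<noteq> 0" "\<And>x. x \<in> U \<Longrightarrow> (G has_real_derivative \<gamma> x * G x) (at x)" "smooth_on U \<gamma>"
    and y: "smooth_on U y" "smooth_on J w" "\<And>x. x \<in> U \<Longrightarrow> y x = G x * w (\<phi> x)" and "x \<in> U"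
  shows "G x * (deriv ^^ k) w (\<phi> x) = (v x) ^ (2 * k) * (\<Sum>j\<le>k. rho \<tau> \<gamma> k j x * (deriv ^^ j) y x)"
  using \<open>x \<in> U\<close>
proof (induction k arbitrary: x)
  case 0
  then show ?case using y(3) by simp
next
  case (Suc k)
  note x = Suc.prems
  let ?r = "rho \<tau> \<gamma> k" and ?y = "\<lambda>j. (deriv ^^ j) y x" and ?m = "2 * k"
  let ?S = "\<lambda>t. \<Sum>j\<le>k. ?r j t * (deriv ^^ j) y t"
  have "((\<lambda>t. (deriv ^^ k) w (\<phi> t)) has_real_derivative (deriv ^^ Suc k) w (\<phi> x) * inverse ((v x)\<^sup>2)) (at x)"
    by (rule DERIV_chain2[OF smooth_on_funpow_DERIV[OF U(2) y(2) U(3)[OF x]] U(4)[OF x]])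
  from DERIV_mult[OF G(2)[OF x] this]
  have L: "((\<lambda>t. G t * (deriv ^^ k) w (\<phi> t)) has_real_derivative
      \<gamma> x * G x * (deriv ^^ k) w (\<phi> x) + (deriv ^^ Suc k) w (\<phi> x) * inverse ((v x)\<^sup>2) * G x) (at x)" .
  have vp: "((\<lambda>t. v t ^ ?m) has_real_derivative real ?m * \<tau> x * v x ^ ?m) (at x)"
  proof (cases k)
    case (Suc i)
    then show ?thesis using DERIV_power[OF v(2)[OF x], of ?m] by (simp add: algebra_simps)
  qed simp
  have "((\<lambda>t. ?r j t * (deriv ^^ j) y t) has_real_derivative deriv (?r j) x * ?y j + ?r j x * ?y (Suc j)) (at x)" for j
    using DERIV_mult[OF smooth_on_DERIV[OF smooth_on_rho[OF U(1) v(3) G(3)] x] smooth_on_funpow_DERIV[OF U(1) y(1) x], of k j j]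
    by (simp only: mult.commute)
  then have Sd: "(?S has_real_derivative (\<Sum>j\<le>k. deriv (?r j) x * ?y j + ?r j x * ?y (Suc j))) (at x)"
    by (intro DERIV_sum)
  have "((\<lambda>t. G t * (deriv ^^ k) w (\<phi> t)) has_real_derivative real ?m * \<tau> x * v x ^ ?m * ?S x
      + (\<Sum>j\<le>k. deriv (?r j) x * ?y j + ?r j x * ?y (Suc j)) * v x ^ ?m) (at x)"
    by (rule has_field_derivative_transform_within_open[OF DERIV_mult[OF vp Sd] U(1) x]) (simp add: Suc.IH)
  from DERIV_unique[OF L this]
  have "\<gamma> x * G x * (deriv ^^ k) w (\<phi> x) + (deriv ^^ Suc k) w (\<phi> x) * inverse ((v x)\<^sup>2) * G x =
     real ?m * \<tau> x * v x ^ ?m * ?S x + (\<Sum>j\<le>k. deriv (?r j) x * ?y j + ?r j x * ?y (Suc j)) * v x ^ ?m" .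
  moreover have "\<gamma> x * G x * (deriv ^^ k) w (\<phi> x) = \<gamma> x * (v x ^ ?m * ?S x)"
    using Suc.IH[OF x] by (simp only: mult.assoc)
  ultimately have "(deriv ^^ Suc k) w (\<phi> x) * inverse ((v x)\<^sup>2) * G x =
     real ?m * \<tau> x * v x ^ ?m * ?S x + (\<Sum>j\<le>k. deriv (?r j) x * ?y j + ?r j x * ?y (Suc j)) * v x ^ ?m - \<gamma> x * (v x ^ ?m * ?S x)"
    by linarith
  also have "\<dots> = v x ^ ?m * ((\<Sum>j\<le>k. deriv (?r j) x * ?y j + ?r j x * ?y (Suc j)) + (real ?m * \<tau> x - \<gamma> x) * ?S x)"
    by (simp only: distrib_left left_diff_distrib right_diff_distrib mult_ac)
  also have "(\<Sum>j\<le>k. deriv (?r j) x * ?y j + ?r j x * ?y (Suc j)) =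
     (\<Sum>j\<le>Suc k. (deriv (?r j) x + (if j = 0 then 0 else ?r (j - 1) x)) * ?y j)"
    by (rule sum_shift) (simp add: rho_zero)
  also have "?S x = (\<Sum>j\<le>Suc k. ?r j x * ?y j)" by (simp add: rho_zero)
  also have "(\<Sum>j\<le>Suc k. (deriv (?r j) x + (if j = 0 then 0 else ?r (j - 1) x)) * ?y j) + (real ?m * \<tau> x - \<gamma> x) * (\<Sum>j\<le>Suc k. ?r j x * ?y j)
     = (\<Sum>j\<le>Suc k. rho \<tau> \<gamma> (Suc k) j x * ?y j)"
    unfolding sum_distrib_left sum.distrib[symmetric] by (intro sum.cong refl) (simp add: algebra_simps)
  finally have "(deriv ^^ Suc k) w (\<phi> x) * inverse ((v x)\<^sup>2) * G x = v x ^ ?m * (\<Sum>j\<le>Suc k. rho \<tau> \<gamma> (Suc k) j x * ?y j)" .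
  then have "(v x)\<^sup>2 * ((deriv ^^ Suc k) w (\<phi> x) * inverse ((v x)\<^sup>2) * G x) = (v x)\<^sup>2 * (v x ^ ?m * (\<Sum>j\<le>Suc k. rho \<tau> \<gamma> (Suc k) j x * ?y j))"
    by (rule arg_cong)
  moreover have "(v x)\<^sup>2 * ((deriv ^^ Suc k) w (\<phi> x) * inverse ((v x)\<^sup>2) * G x) = G x * (deriv ^^ Suc k) w (\<phi> x)"
    using v(1)[OF x] by (simp add: field_simps)
  moreover have "(v x)\<^sup>2 * (v x ^ ?m * (\<Sum>j\<le>Suc k. rho \<tau> \<gamma> (Suc k) j x * ?y j)) = v x ^ (2 * Suc k) * (\<Sum>j\<le>Suc k. rho \<tau> \<gamma> (Suc k) j x * ?y j)"
    by (simp only: mult_Suc_right power_add mult.assoc)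
  ultimately show ?case by (simp only:)
qed

text \<open>The two leading coefficients of the equation are reproduced when \<open>G = h v\<^sup>n\<^sup>-\<^sup>1\<close>, where \<open>h\<close> removes the coefficient of order \<open>n - 1\<close>
  and \<open>v\<close> solves \<open>v'' + q v = 0\<close> for the multiple \<open>q\<close> of the invariant below; in terms of \<open>\<tau>\<close> this is a Riccati equation.
  Up to the factor \<open>h\<close> and terms of order at most \<open>n - 3\<close> the equation is then the \<open>(n - 1)\<close>-st symmetric power of this
  second order equation.\<close>

lemma rho_leading_coefficients:
  assumes n: "n = Suc (Suc m)" and x: "(\<tau> has_real_derivative - q - (\<tau> x)\<^sup>2) (at x)"
    and q: "real n * (real n - 1) * (real n + 1) / 6 * q = laguerre_invariant n c x"
    and c: "(c (n - 1) has_real_derivative deriv (c (n - 1)) x) (at x)"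
    and \<gamma>: "\<gamma> = (\<lambda>x. (real n - 1) * \<tau> x - c (n - 1) x / real n)"
  shows "rho \<tau> \<gamma> n (n - 1) x = c (n - 1) x" "rho \<tau> \<gamma> n (n - 2) x = c (n - 2) x"
proof -
  define N where "N = real n"
  have N: "real m = N - 2" "N \<noteq> 0" by (simp_all add: N_def n)
  define C where "C = c (n - 1) x"
  define C' where "C' = deriv (c (n - 1)) x"
  have "rho \<tau> \<gamma> (Suc (Suc m)) (Suc m) x = N * (N - 1) * \<tau> x - N * \<gamma> x"
    unfolding rho_first using N(1) by (simp add: N_def n)
  also have "\<dots> = C" using N(2) by (simp add: \<gamma> N_def[symmetric] C_def field_simps)
  finally show "rho \<tau> \<gamma> n (n - 1) x = c (n - 1) x" by (simp add: n C_def)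
  have "(\<gamma> has_real_derivative (N - 1) * (- q - (\<tau> x)\<^sup>2) - C' / N) (at x)"
    unfolding \<gamma> N_def[symmetric] C'_def by (intro DERIV_diff DERIV_cmult DERIV_cdivide x c)
  from rho_second[OF x this, of m]
  have "rho \<tau> \<gamma> (Suc (Suc m)) m x = N * (N - 1) * ((N - 2) / 3 * (- q - (\<tau> x)\<^sup>2) - ((N - 1) * (- q - (\<tau> x)\<^sup>2) - C' / N) / 2
      + (N - 2) * (3 * (N - 2) + 5) / 6 * (\<tau> x)\<^sup>2 - (N - 1) * \<tau> x * \<gamma> x + (\<gamma> x)\<^sup>2 / 2)"
    unfolding N(1) by (simp add: algebra_simps)
  also have "\<gamma> x = (N - 1) * \<tau> x - C / N" by (simp add: \<gamma> N_def C_def)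
  also have "N * (N - 1) * ((N - 2) / 3 * (- q - (\<tau> x)\<^sup>2) - ((N - 1) * (- q - (\<tau> x)\<^sup>2) - C' / N) / 2
      + (N - 2) * (3 * (N - 2) + 5) / 6 * (\<tau> x)\<^sup>2 - (N - 1) * \<tau> x * ((N - 1) * \<tau> x - C / N) + ((N - 1) * \<tau> x - C / N)\<^sup>2 / 2)
     = N * (N - 1) * (N + 1) / 6 * q + (N - 1) / 2 * C' + (N - 1) / (2 * N) * C\<^sup>2"
    using N(2) by (simp add: field_simps power2_eq_square)
  also have "N * (N - 1) * (N + 1) / 6 * q = c (n - 2) x - (N - 1) / 2 * C' - (N - 1) / (2 * N) * C\<^sup>2"
    using q unfolding N_def[symmetric] laguerre_invariant_def C_def[symmetric] C'_def[symmetric] .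
  also have "c (n - 2) x - (N - 1) / 2 * C' - (N - 1) / (2 * N) * C\<^sup>2 + (N - 1) / 2 * C' + (N - 1) / (2 * N) * C\<^sup>2 = c (n - 2) x"
    by simp
  finally show "rho \<tau> \<gamma> n (n - 2) x = c (n - 2) x" by (simp add: n)
qed

text \<open>For a nonvanishing solution \<open>v\<close> of the second order equation the new independent variable is the
  quotient of a second solution by \<open>v\<close>, that is, a primitive of \<open>1 / v\<^sup>2\<close>.\<close>

theorem laguerre_forsyth_form_exists:
  assumes "n \<ge> 3" "open_interval I" and c: "\<And>j. j < n \<Longrightarrow> smooth_on I (c j)" and x0: "x0 \<in> I"
  shows "\<exists>f g J d. laguerre_forsyth_form n I c f g J d \<and> x0 \<in> f ` J"
proof -
  have o: "open I" using assms(2) by (simp add: open_interval_def)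
  obtain m where n: "n = Suc (Suc m)" using le_Suc_ex[OF assms(1)] by (auto simp: numeral_3_eq_3)
  define K where "K = real n * (real n - 1) * (real n + 1) / 6"
  have K: "K \<noteq> 0" using assms(1) by (simp add: K_def)
  have Bs: "smooth_on I (laguerre_invariant n c)" by (rule smooth_on_laguerre_invariant[OF o assms(1)]) (rule c)
  define q where "q x = laguerre_invariant n c x / K" for x
  have qs: "smooth_on I q" unfolding q_def[abs_def] by (intro smooth_on_divide smooth_on_const o Bs K)
  have cn: "smooth_on I (c (n - 1))" using c n by simp
  define e where "e j = (if j = 0 then q else (\<lambda>x. 0))" for j :: nat
  have es: "smooth_on I (e j)" for j by (cases "j = 0") (simp_all add: e_def qs smooth_on_const)
  obtain v where v: "smooth_on I v" "\<And>x. x \<in> I \<Longrightarrow> linear_op 2 e v x = 0" "\<And>j. j < 2 \<Longrightarrow> (deriv ^^ j) v x0 = (if j = 0 then 1 else 0)"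
    using linear_ode_exists[where n = 2 and c = e and v = "\<lambda>j. if j = 0 then 1 else 0", OF assms(2) es x0] by auto
  have v'': "deriv (deriv v) x = - q x * v x" if "x \<in> I" for x
    using v(2)[OF that] by (simp add: linear_op_eq numeral_2_eq_2 e_def)
  have "open {x \<in> I. v x \<in> {0<..}}"
    using continuous_open_preimage[OF smooth_on_imp_continuous_on[OF v(1)] o open_greaterThan] by (simp add: vimage_def Int_def)
  moreover have "x0 \<in> {x \<in> I. v x \<in> {0<..}}" using v(3)[of 0] x0 by simp
  ultimately obtain r where r: "r > 0" "ball x0 r \<subseteq> {x \<in> I. v x \<in> {0<..}}" using open_contains_ball by blast
  \<comment> \<open>The solution \<open>v\<close> may have zeros on \<open>I\<close>, so the form is constructed near \<open>x0\<close> only.\<close>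
  define U where "U = ball x0 r"
  have U: "open_interval U" "open U" and UI: "U \<subseteq> I" and vpos: "\<And>x. x \<in> U \<Longrightarrow> v x \<noteq> 0" and x0U: "x0 \<in> U"
    using r by (auto simp: open_interval_def U_def is_interval_ball_real)
  have vU: "smooth_on U v" by (rule smooth_on_subset[OF v(1) UI])
  have cU: "smooth_on U (c j)" if "j < n" for j by (rule smooth_on_subset[OF c[OF that] UI])
  define h where "h x = exp (primitive x0 (\<lambda>x. - c (n - 1) x / real n) x)" for x
  have ls: "smooth_on I (\<lambda>x. - c (n - 1) x / real n)" using n by (intro smooth_intros o cn) simp
  have hs: "smooth_on U h"
    unfolding h_def[abs_def]
    by (rule smooth_on_compose[OF U(2) open_UNIV smooth_on_exp smooth_on_subset[OF smooth_on_primitive[OF assms(2) ls x0] UI]]) simp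
  have h': "(h has_real_derivative - c (n - 1) x / real n * h x) (at x)" if "x \<in> I" for x
    unfolding h_def[abs_def]
    using DERIV_fun_exp[OF DERIV_primitive[OF assms(2) smooth_on_imp_continuous_on[OF ls] x0 that]] by (simp add: mult.commute)
  define \<tau> where "\<tau> x = deriv v x / v x" for x
  define \<gamma> where "\<gamma> = (\<lambda>x. (real n - 1) * \<tau> x - c (n - 1) x / real n)"
  have ts: "smooth_on U \<tau>" unfolding \<tau>_def[abs_def] by (intro smooth_on_divide smooth_on_deriv U(2) vU vpos)
  have gs: "smooth_on U \<gamma>" unfolding \<gamma>_def
    using n by (intro smooth_on_diff smooth_on_mult smooth_on_divide smooth_on_const U(2) ts cU) simp_all
  have v': "(v has_real_derivative \<tau> x * v x) (at x)" if "x \<in> U" for x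
    using smooth_on_DERIV[OF vU that] vpos[OF that] by (simp add: \<tau>_def)
  have \<tau>': "(\<tau> has_real_derivative - q x - (\<tau> x)\<^sup>2) (at x)" if "x \<in> U" for x
  proof -
    have "(\<tau> has_real_derivative (deriv (deriv v) x * v x - deriv v x * deriv v x) / (v x * v x)) (at x)"
      unfolding \<tau>_def[abs_def]
      by (rule DERIV_divide[OF smooth_on_DERIV[OF smooth_on_deriv[OF U(2) vU] that] smooth_on_DERIV[OF vU that] vpos[OF that]])
    moreover have "(deriv (deriv v) x * v x - deriv v x * deriv v x) / (v x * v x) = - q x - (\<tau> x)\<^sup>2"
      using vpos[OF that] v''[of x] UI that by (simp add: \<tau>_def subset_iff power2_eq_square field_simps)
    ultimately show ?thesis by simp
  qed
  define G where "G x = h x * v x ^ (n - 1)" for x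
  have Gs: "smooth_on U G" unfolding G_def[abs_def] by (intro smooth_on_mult smooth_on_power U(2) hs vU)
  have G0: "G x \<noteq> 0" if "x \<in> U" for x using vpos[OF that] by (simp add: G_def h_def)
  have G': "(G has_real_derivative \<gamma> x * G x) (at x)" if "x \<in> U" for x
  proof -
    have "((\<lambda>x. v x ^ Suc m) has_real_derivative (1 + real m) * (\<tau> x * v x * v x ^ m)) (at x)"
      by (rule DERIV_power_Suc[OF v'[OF that]])
    then have "((\<lambda>x. h x * v x ^ Suc m) has_real_derivative
       - c (n - 1) x / real n * h x * v x ^ Suc m + (1 + real m) * (\<tau> x * v x * v x ^ m) * h x) (at x)"
      using UI that by (intro DERIV_mult h') auto
    moreover have "- c (n - 1) x / real n * h x * v x ^ Suc m + (1 + real m) * (\<tau> x * v x * v x ^ m) * h x = \<gamma> x * (h x * v x ^ Suc m)"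
    proof -
      have "real n - 1 = 1 + real m" by (simp add: n)
      then show ?thesis unfolding \<gamma>_def by (simp add: algebra_simps)
    qed
    ultimately show ?thesis unfolding G_def[abs_def] by (simp add: n)
  qed
  have vis: "smooth_on U (\<lambda>x. inverse ((v x)\<^sup>2))" by (intro smooth_on_inverse smooth_on_power U(2) vU) (simp add: vpos)
  define \<phi> where "\<phi> = primitive x0 (\<lambda>x. inverse ((v x)\<^sup>2))"
  have \<phi>s: "smooth_on U \<phi>" unfolding \<phi>_def by (rule smooth_on_primitive[OF U(1) vis x0U])
  have \<phi>': "(\<phi> has_real_derivative inverse ((v x)\<^sup>2)) (at x)" if "x \<in> U" for x
    unfolding \<phi>_def by (rule DERIV_primitive[OF U(1) smooth_on_imp_continuous_on[OF vis] x0U that])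
  have \<phi>0: "\<forall>x\<in>U. deriv \<phi> x \<noteq> 0" using DERIV_imp_deriv[OF \<phi>'] vpos by simp
  define J where "J = \<phi> ` U"
  define f where "f = inv_into U \<phi>"
  note inv = diffeo_inverse[OF U(1) \<phi>s \<phi>0, folded J_def f_def]
  have Jo: "open J" using inv(1) by (simp add: open_interval_def)
  have fU: "f z \<in> U" "\<phi> (f z) = z" if "z \<in> J" for z using that inv(2) by (auto simp: J_def)
  have fJ: "f ` J = U" using inv(2) by (force simp: J_def image_image)
  have f0: "\<forall>z\<in>J. deriv f z \<noteq> 0"
  proof
    fix z assume "z \<in> J"
    then obtain x where "x \<in> U" "z = \<phi> x" by (auto simp: J_def)
    then show "deriv f z \<noteq> 0" using DERIV_imp_deriv[OF inv(4)] \<phi>0 by simp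
  qed
  have comp: "smooth_on J (\<lambda>z. F (f z))" if "smooth_on U F" for F :: "real \<Rightarrow> real"
    by (rule smooth_on_compose[OF Jo U(2) that inv(3) fU(1)])
  define g where "g z = G (f z)" for z
  have gJ: "smooth_on J g" unfolding g_def[abs_def] by (rule comp[OF Gs])
  \<comment> \<open>What is left of the equation after the operator that becomes \<open>d\<^sup>n/dz\<^sup>n\<close> has been subtracted: order at most \<open>n - 3\<close>.\<close>
  define b where "b j x = c j x - rho \<tau> \<gamma> n j x" for j x
  have bs: "smooth_on U (b j)" if "j < n" for j
    unfolding b_def[abs_def] by (intro smooth_on_diff U(2) cU that smooth_on_rho ts gs)
  have b0: "b (n - 1) x = 0" "b (n - 2) x = 0" if "x \<in> U" for x
  proof -
    have "K * q x = laguerre_invariant n c x" using K by (simp add: q_def)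
    then have "real n * (real n - 1) * (real n + 1) / 6 * q x = laguerre_invariant n c x" by (simp add: K_def)
    from rho_leading_coefficients[where c = c, OF n \<tau>'[OF that] this smooth_on_DERIV[OF cU that] \<gamma>_def] n
    show "b (n - 1) x = 0" "b (n - 2) x = 0" by (simp_all add: b_def)
  qed
  define \<kappa> where "\<kappa> x = G x / v x ^ (2 * n)" for x
  have \<kappa>0: "\<kappa> x \<noteq> 0" if "x \<in> U" for x using G0[OF that] vpos[OF that] by (simp add: \<kappa>_def)
  have \<kappa>s: "smooth_on U \<kappa>" unfolding \<kappa>_def[abs_def] by (intro smooth_on_divide smooth_on_power U(2) Gs vU) (simp add: vpos)
  define s where "s = chain_coeff f g"
  define d where "d i z = inverse (\<kappa> (f z)) * (\<Sum>j<m. b j (f z) * s j i z)" for i z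
  have ss: "smooth_on J (s j i)" for j i unfolding s_def by (rule smooth_on_chain_coeff[OF Jo inv(3) f0 gJ])
  have ds: "smooth_on J (d i)" for i
    unfolding d_def[abs_def]
    by (intro smooth_on_mult smooth_on_sum smooth_on_inverse comp \<kappa>s bs ss Jo) (simp_all add: n \<kappa>0 fU(1))
  have d0: "d (n - 1) z = 0" "d (n - 2) z = 0" for z
    unfolding d_def s_def using n by (simp_all add: chain_coeff_zero)
  have "linear_op n c y (f z) = \<kappa> (f z) * linear_op n d w z"
    if y: "smooth_on (f ` J) y" and w: "smooth_on J w" and yw: "\<And>z. z \<in> J \<Longrightarrow> y (f z) = g z * w z" and z: "z \<in> J" for y w z
  proof -
    let ?x = "f z" and ?y = "\<lambda>j. (deriv ^^ j) y (f z)" and ?w = "\<lambda>i. (deriv ^^ i) w z"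
    have xU: "?x \<in> U" and \<phi>x: "\<phi> ?x = z" using fU[OF z] by simp_all
    have yU: "smooth_on U y" using y fJ by simp
    have \<phi>J: "\<phi> x \<in> J" if "x \<in> U" for x using that by (simp add: J_def)
    have yG: "y x = G x * w (\<phi> x)" if "x \<in> U" for x
      using yw[OF \<phi>J[OF that]] inv(2)[OF that] by (simp add: g_def)
    have "G ?x * ?w n = v ?x ^ (2 * n) * (\<Sum>j\<le>n. rho \<tau> \<gamma> n j ?x * ?y j)"
      using rho_expansion[where v = v and G = G, OF U(2) Jo \<phi>J \<phi>' vpos v' ts G0 G' gs yU w yG xU, of n] unfolding \<phi>x by blast
    then have "\<kappa> ?x * ?w n = (\<Sum>j\<le>n. rho \<tau> \<gamma> n j ?x * ?y j)"
      using vpos[OF xU] by (simp add: \<kappa>_def field_simps)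
    also have "\<dots> = ?y n + (\<Sum>j<n. rho \<tau> \<gamma> n j ?x * ?y j)"
      unfolding lessThan_Suc_atMost[symmetric] sum.lessThan_Suc by (simp add: rho_leading)
    finally have "linear_op n c y ?x = \<kappa> ?x * ?w n + (\<Sum>j<n. b j ?x * ?y j)"
      unfolding linear_op_eq b_def by (simp add: left_diff_distrib sum_subtractf)
    also have "(\<Sum>j<n. b j ?x * ?y j) = (\<Sum>j<m. b j ?x * ?y j)"
      using b0[OF xU] by (simp add: n)
    also have "\<dots> = (\<Sum>j<m. b j ?x * (\<Sum>i<n. s j i z * ?w i))"
    proof (intro sum.cong refl arg_cong[where f = "(*) _"])
      fix j assume "j \<in> {..<m}"
      then have "{..j} \<subseteq> {..<n}" "\<forall>i\<in>{..<n} - {..j}. s j i z * ?w i = 0" using n by (auto simp: s_def chain_coeff_zero)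
      then have "(\<Sum>i\<le>j. s j i z * ?w i) = (\<Sum>i<n. s j i z * ?w i)" by (intro sum.mono_neutral_left) auto
      then show "?y j = (\<Sum>i<n. s j i z * ?w i)"
        using chain_expansion[OF Jo _ inv(3) f0 gJ y w yw z, of j] U(2) unfolding fJ s_def by simp
    qed
    also have "\<dots> = (\<Sum>i<n. (\<Sum>j<m. b j ?x * s j i z) * ?w i)"
      unfolding sum_distrib_left sum_distrib_right by (subst sum.swap) (simp add: mult.assoc)
    also have "\<dots> = \<kappa> ?x * (\<Sum>i<n. d i z * ?w i)"
      using \<kappa>0[OF xU] by (simp add: d_def sum_distrib_left mult.assoc[symmetric])
    finally show ?thesis by (simp add: linear_op_eq distrib_left)
  qed
  then have "transforms_to n I c f g J d"
    unfolding transforms_to_def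
    using inv(1,3) ds f0 gJ fJ UI \<kappa>0 fU(1) G0
    by (intro conjI ballI allI impI exI[of _ "\<lambda>z. \<kappa> (f z)"]) (simp_all add: g_def)
  then have "laguerre_forsyth_form n I c f g J d" using d0 by (simp add: laguerre_forsyth_form_def)
  moreover have "x0 \<in> f ` J" using fJ x0U by simp
  ultimately show ?thesis by blast
qed

section \<open>The characterisation of maximal symmetry\<close>

lemma transforms_to_identity:
  assumes "open_interval I" "\<And>j. j < n \<Longrightarrow> smooth_on I (c j)"
  shows "transforms_to n I c (\<lambda>z. z) (\<lambda>z. 1) I c"
proof -
  have o: "open I" using assms(1) by (simp add: open_interval_def)
  have "linear_op n c y z = 1 * linear_op n c w z" if "\<forall>z\<in>I. y z = 1 * w z" "z \<in> I" for y w z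
    using linear_op_cong[OF o _ that(2), of y w n c] that(1) by simp
  then show ?thesis
    unfolding transforms_to_def using assms smooth_on_ident[OF o] smooth_on_const[of I 1]
    by (intro conjI ballI allI impI exI[of _ "\<lambda>z. 1"]) simp_all
qed

theorem corollary1:
  fixes n :: nat and I :: "real set" and c :: "nat \<Rightarrow> real \<Rightarrow> real"
  assumes "n \<ge> 3"
    and "open_interval I"
    and "\<forall>j<n. smooth_on I (c j)"
  shows "((\<forall>x\<in>I. c (n - 1) x = 0 \<and> c (n - 2) x = 0) \<longrightarrow>
           (has_maximal_symmetry_algebra n I c \<longleftrightarrow> (\<forall>j<n. \<forall>x\<in>I. c j x = 0))) \<and>
         (has_maximal_symmetry_algebra n I c \<longleftrightarrow>
           (\<forall>f g J d. laguerre_forsyth_form n I c f g J d \<longrightarrow> canonical_on n J d)) \<and>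
         (has_maximal_symmetry_algebra n I c \<longleftrightarrow>
           (\<forall>x\<in>I. \<exists>f g J d. laguerre_forsyth_form n I c f g J d \<and> x \<in> f ` J \<and> canonical_on n J d))"
proof -
  let ?M = "has_maximal_symmetry_algebra n I c"
  let ?all = "\<forall>f g J d. laguerre_forsyth_form n I c f g J d \<longrightarrow> canonical_on n J d"
  let ?loc = "\<forall>x\<in>I. \<exists>f g J d. laguerre_forsyth_form n I c f g J d \<and> x \<in> f ` J \<and> canonical_on n J d"
  have c: "smooth_on I (c j)" if "j < n" for j using assms(3) that by blast
  have M_all: ?all if M: ?M
  proof (intro allI impI)
    fix f g J d assume LF: "laguerre_forsyth_form n I c f g J d"
    show "canonical_on n J d" by (rule maximal_imp_canonical[OF assms(1,2) _ M LF]) (rule c)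
  qed
  have all_loc: ?loc if all: ?all
  proof
    fix x assume x: "x \<in> I"
    have "\<exists>f g J d. laguerre_forsyth_form n I c f g J d \<and> x \<in> f ` J"
      by (rule laguerre_forsyth_form_exists[OF assms(1,2) _ x]) (rule c)
    with all show "\<exists>f g J d. laguerre_forsyth_form n I c f g J d \<and> x \<in> f ` J \<and> canonical_on n J d" by blast
  qed
  have loc_M: ?M if loc: "\<And>x. x \<in> I \<Longrightarrow> \<exists>f g J d. transforms_to n I c f g J d \<and> x \<in> f ` J \<and> canonical_on n J d"
    by (rule locally_canonical_imp_maximal[OF assms(1,2) _ loc]) (rule c)
  have id: "transforms_to n I c (\<lambda>z. z) (\<lambda>z. 1) I c"
    by (rule transforms_to_identity[OF assms(2)]) (rule c)
  have first: "?M \<longleftrightarrow> (\<forall>j<n. \<forall>x\<in>I. c j x = 0)" if LF: "\<forall>x\<in>I. c (n - 1) x = 0 \<and> c (n - 2) x = 0"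
  proof
    assume M: ?M
    have "laguerre_forsyth_form n I c (\<lambda>z. z) (\<lambda>z. 1) I c" using id LF by (simp add: laguerre_forsyth_form_def)
    with M_all[OF M] show "\<forall>j<n. \<forall>x\<in>I. c j x = 0" unfolding canonical_on_def by blast
  next
    assume "\<forall>j<n. \<forall>x\<in>I. c j x = 0"
    then have can: "canonical_on n I c" by (simp add: canonical_on_def)
    show ?M
    proof (rule loc_M)
      fix x assume "x \<in> I"
      then have "x \<in> (\<lambda>z. z) ` I" by simp
      with id can show "\<exists>f g J d. transforms_to n I c f g J d \<and> x \<in> f ` J \<and> canonical_on n J d" by blast
    qed
  qed
  have "?M" if loc: ?loc
  proof (rule loc_M)
    fix x assume "x \<in> I"
    with loc show "\<exists>f g J d. transforms_to n I c f g J d \<and> x \<in> f ` J \<and> canonical_on n J d"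
      unfolding laguerre_forsyth_form_def by blast
  qed
  with M_all all_loc first show ?thesis by blast
qed

end
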